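(* The following relations hold between classes of intersection graphs: (1) the class of grounded segment graphs equals the class of downward ray graphs; (2) the class of downward ray graphs is a proper subclass of the class of ray graphs; (3) the class of ray graphs is a proper subclass of the class of outer segment graphs; (4) the class of outer segment graphs is a proper subclass of the class of outer $1$-string graphs; (5) the class of outer $1$-string graphs equals the class of grounded $1$-string graphs.
   Context: All graphs are finite and simple. The intersection graph of a finite collection of sets has one vertex per set, and two distinct vertices are adjacent if and only if the corresponding sets have nonempty intersection; a graph belongs to a class below if it is isomorphic to the intersection graph of a collection of the indicated type. All objects live in the plane $\mathbb{R}^2$. Grounded segment graphs: fix a line $\ell$ (the grounding line). A segment is grounded if one of its endpoints (its base point) lies on $\ell$ and its interior is above $\ell$. A grounded segment graph is the intersection graph of a collection of segments all grounded with respect to the same line $\ell$. Outer segment graphs: fix a circle $\mathcal{C}$ (the grounding circle). A segment is an outer segment if exactly one of its endpoints (its base point) lies on $\mathcal{C}$ and its interior is inside $\mathcal{C}$. An outer segment graph is the intersection graph of a collection of outer segments with respect to the same circle. Ray graphs: intersection graphs of collections of rays (halflines). A downward ray is a ray whose apex is above (has strictly larger $y$-coordinate than) all its other points. Downward ray graphs are intersection graphs of collections of downward rays. $1$-strings: a collection of simple curves in the plane, no three of which meet in a common point, such that any two of the curves intersect at most once. Grounded $1$-string graphs and outer $1$-string graphs are the intersection graphs of collections of $1$-strings satisfying the same grounding condition as for segments: for grounded, each curve has one endpoint (base point) on a common line $\ell$ and the rest of it above $\ell$; for outer, each curve has exactly one endpoint (base point) on a common circle $\mathcal{C}$ and the rest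 of it inside $\mathcal{C}$. *)

theory Defs
  imports
    "HOL-Analysis.Analysis"
    "HOL-Library.Infinite_Typeclass"
    "Graph_Theory.Pair_Digraph"
    "Graph_Theory.Digraph_Isomorphism"
begin

text \<open>
  The plane is \<^typ>\<open>complex\<close>, with \<^const>\<open>Re\<close> and \<^const>\<open>Im\<close> as the two coordinates.
  A finite simple graph is a \<^locale>\<open>pair_graph\<close>: each undirected edge is a symmetric pair of arcs.
\<close>

definition intersection_graph :: "'p set set \<Rightarrow> 'p set pair_pre_digraph" where
  "intersection_graph S =
     \<lparr> pverts = S, parcs = {(A, B). A \<in> S \<and> B \<in> S \<and> A \<noteq> B \<and> A \<inter> B \<noteq> {}} \<rparr>"

text \<open>
  The class of graphs, with vertices drawn from the type \<^typ>\<open>'v\<close>, that are isomorphic to the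
  intersection graph of a finite collection of plane sets admitted by \<^term>\<open>P\<close>. Over an infinite
  vertex type every isomorphism class of finite graphs is represented.
\<close>

definition intersection_graph_class :: "(complex set set \<Rightarrow> bool) \<Rightarrow> 'v pair_pre_digraph set" where
  "intersection_graph_class P =
     {G. pair_graph G \<and>
         (\<exists>S. finite S \<and> P S \<and> digraph_iso (with_proj G) (with_proj (intersection_graph S)))}"


text \<open>
  A grounding line must be non-vertical for ``above'' to make sense, so it is given by its
  slope \<^term>\<open>m\<close> and its intercept \<^term>\<open>c\<close>.
\<close>

definition ground_line :: "real \<Rightarrow> real \<Rightarrow> complex set" where
  "ground_line m c = {z. Im z = m * Re z + c}"

definition above_line :: "real \<Rightarrow> real \<Rightarrow> complex set" where
  "above_line m c = {z. Im z > m * Re z + c}"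

definition grounded_segment :: "real \<Rightarrow> real \<Rightarrow> complex set \<Rightarrow> bool" where
  "grounded_segment m c A \<longleftrightarrow>
     (\<exists>a b. a \<noteq> b \<and> A = closed_segment a b \<and>
            a \<in> ground_line m c \<and> open_segment a b \<subseteq> above_line m c)"

definition outer_segment :: "complex \<Rightarrow> real \<Rightarrow> complex set \<Rightarrow> bool" where
  "outer_segment x r A \<longleftrightarrow>
     (\<exists>a b. A = closed_segment a b \<and>
            a \<in> sphere x r \<and> b \<notin> sphere x r \<and> open_segment a b \<subseteq> ball x r)"

definition ray_from :: "complex \<Rightarrow> complex \<Rightarrow> complex set" where
  "ray_from a v = {a + t *\<^sub>R v | t. t \<ge> 0}"

definition is_ray :: "complex set \<Rightarrow> bool" where
  "is_ray A \<longleftrightarrow> (\<exists>a v. v \<noteq> 0 \<and> A = ray_from a v)"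

definition is_downward_ray :: "complex set \<Rightarrow> bool" where
  "is_downward_ray A \<longleftrightarrow>
     (\<exists>a v. v \<noteq> 0 \<and> A = ray_from a v \<and> (\<forall>z \<in> A - {a}. Im z < Im a))"


definition one_strings :: "complex set set \<Rightarrow> bool" where
  "one_strings S \<longleftrightarrow>
     (\<forall>A\<in>S. \<exists>g. arc g \<and> A = path_image g) \<and>
     (\<forall>A\<in>S. \<forall>B\<in>S. A \<noteq> B \<longrightarrow> (\<exists>p. A \<inter> B \<subseteq> {p})) \<and>
     (\<forall>A\<in>S. \<forall>B\<in>S. \<forall>C\<in>S. A \<noteq> B \<and> A \<noteq> C \<and> B \<noteq> C \<longrightarrow> A \<inter> B \<inter> C = {})"

definition grounded_string :: "real \<Rightarrow> real \<Rightarrow> complex set \<Rightarrow> bool" where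
  "grounded_string m c A \<longleftrightarrow>
     (\<exists>g. arc g \<and> A = path_image g \<and>
          pathstart g \<in> ground_line m c \<and> A - {pathstart g} \<subseteq> above_line m c)"

text \<open>The far endpoint of an outer string lies off the circle, since it is in the open disc.\<close>

definition outer_string :: "complex \<Rightarrow> real \<Rightarrow> complex set \<Rightarrow> bool" where
  "outer_string x r A \<longleftrightarrow>
     (\<exists>g. arc g \<and> A = path_image g \<and>
          pathstart g \<in> sphere x r \<and> A - {pathstart g} \<subseteq> ball x r)"


definition grounded_segment_graphs :: "'v pair_pre_digraph set" where
  "grounded_segment_graphs =
     intersection_graph_class (\<lambda>S. \<exists>m c. \<forall>A\<in>S. grounded_segment m c A)"

definition downward_ray_graphs :: "'v pair_pre_digraph set" where
  "downward_ray_graphs = intersection_graph_class (\<lambda>S. \<forall>A\<in>S. is_downward_ray A)"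

definition ray_graphs :: "'v pair_pre_digraph set" where
  "ray_graphs = intersection_graph_class (\<lambda>S. \<forall>A\<in>S. is_ray A)"

definition outer_segment_graphs :: "'v pair_pre_digraph set" where
  "outer_segment_graphs =
     intersection_graph_class (\<lambda>S. \<exists>x r. r > 0 \<and> (\<forall>A\<in>S. outer_segment x r A))"

definition outer_1_string_graphs :: "'v pair_pre_digraph set" where
  "outer_1_string_graphs =
     intersection_graph_class
       (\<lambda>S. one_strings S \<and> (\<exists>x r. r > 0 \<and> (\<forall>A\<in>S. outer_string x r A)))"

definition grounded_1_string_graphs :: "'v pair_pre_digraph set" where
  "grounded_1_string_graphs =
     intersection_graph_class
       (\<lambda>S. one_strings S \<and> (\<exists>m c. \<forall>A\<in>S. grounded_string m c A))"

end

theory Submission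
  imports Defs
begin

text \<open>
  The inclusions come from explicit transformations: a projective map sends the grounding line to
  infinity, rays are cut off by a large circle, outer segments are moved into general position, and
  a Moebius transformation carries the disc to the half-plane.

  For strictness, attach vertices to an induced cycle; in every outer representation this forces
  the cyclic order of their base points. If \<open>X - s - s' - Y\<close> is an induced path and the bases come in
  the order \<open>s, Y, X, s'\<close>, then the crossing point of outer segments \<open>s\<close> and \<open>s'\<close> lies on the
  same side of the line through their bases as the bases of \<open>X\<close> and \<open>Y\<close>. For rays this means that
  the arc of directions from \<open>s\<close> over \<open>Y\<close> and \<open>X\<close> to \<open>s'\<close> exceeds a half turn. Three such paths in a net
  exclude directions in an open half-plane, two such paths on disjoint arcs exclude rays, and two
  such paths on adjacent arcs that share a segment exclude outer segments.
\<close>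

text \<open>The crossing rule rests on strict convexity: if the base of \<open>X\<close> and the
  crossing point were on opposite sides, \<open>X\<close> could reach \<open>s\<close> beyond the
  crossing only through \<open>s'\<close>, which it must miss. For rays the side of a crossing is
  the sign of the cross product of the directions, hence the statement about half turns. In the fan
  the segment shared by the two paths would have its base in the triangle of its own tip and the two
  outer bases, so inside the disc. The order of bases on a circle is only cyclic. Sending a point
  \<open>q\<close> of the circle to infinity gives every base a real coordinate, and order
  statements are phrased by interlacing pairs, which do not depend on \<open>q\<close>. The
  laborious inclusion is that of outer segments in outer 1-strings: segments may overlap on a line,
  touch at an end, share a base or pass through a common point. They are prolonged, the circle is
  enlarged slightly, and the segments are rotated one at a time. The explicit witnesses have integer
  coordinates without parallel pairs, or are rectilinear, so their adjacencies are decided by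
  integer arithmetic.\<close>

section \<open>Intersection graph classes and numbered witness graphs\<close>

lemma intersection_graph_class_iff:
  "G \<in> intersection_graph_class P \<longleftrightarrow>
     pair_graph G \<and>
     (\<exists>f. inj_on f (pverts G) \<and> P (f ` pverts G) \<and>
        (\<forall>u\<in>pverts G. \<forall>v\<in>pverts G. u \<noteq> v \<longrightarrow> ((u, v) \<in> parcs G \<longleftrightarrow> f u \<inter> f v \<noteq> {})))"
  (is "?L \<longleftrightarrow> pair_graph G \<and> ?R")
proof safe
  assume L: ?L
  then obtain S where G: "pair_graph G" and S: "finite S" "P S"
    and iso: "digraph_iso (with_proj G) (with_proj (intersection_graph S))"
    unfolding intersection_graph_class_def by blast
  show "pair_graph G" by fact
  interpret pair_graph G by fact
  obtain h where h: "digraph_isomorphism h"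
    and eq: "with_proj (intersection_graph S) = app_iso h (with_proj G)"
    using iso unfolding digraph_iso_def by blast
  have vS: "S = iso_verts h ` pverts G"
    using arg_cong[OF eq, of verts] by (simp add: intersection_graph_def)
  have aS: "parcs (intersection_graph S) = iso_arcs h ` parcs G"
    using arg_cong[OF eq, of arcs] by simp
  have tl: "iso_tail h = fst" using arg_cong[OF eq, of tail] by simp
  have hd: "iso_head h = snd" using arg_cong[OF eq, of head] by simp
  have inj: "inj_on (iso_verts h) (pverts G)"
    using h by (simp add: digraph_isomorphism_def)
  have arc: "iso_arcs h a = (iso_verts h (fst a), iso_verts h (snd a))" if "a \<in> parcs G" for a
    using h that tl hd by (simp add: digraph_isomorphism_def prod_eq_iff)
  show ?R
  proof (intro exI[of _ "iso_verts h"] conjI ballI impI)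
    show "inj_on (iso_verts h) (pverts G)" by fact
    show "P (iso_verts h ` pverts G)" using S vS by simp
    fix u v assume uv: "u \<in> pverts G" "v \<in> pverts G" "u \<noteq> v"
    have ne: "iso_verts h u \<noteq> iso_verts h v" using inj uv by (auto dest: inj_onD)
    have "iso_verts h u \<inter> iso_verts h v \<noteq> {} \<longleftrightarrow>
        (iso_verts h u, iso_verts h v) \<in> parcs (intersection_graph S)"
      using uv ne vS by (auto simp: intersection_graph_def)
    also have "\<dots> \<longleftrightarrow> (u, v) \<in> parcs G"
    proof
      assume "(iso_verts h u, iso_verts h v) \<in> parcs (intersection_graph S)"
      then obtain a where a: "a \<in> parcs G" "(iso_verts h u, iso_verts h v) = iso_arcs h a"
        using aS by auto
      then have "fst a = u" "snd a = v"
        using arc[OF a(1)] inj uv arc_fst_in_verts arc_snd_in_verts by (auto dest: inj_onD)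
      then show "(u, v) \<in> parcs G" using a(1) by (metis prod.collapse)
    next
      assume "(u, v) \<in> parcs G"
      then show "(iso_verts h u, iso_verts h v) \<in> parcs (intersection_graph S)"
        using arc[of "(u,v)"] aS by force
    qed
    finally show "(u, v) \<in> parcs G \<longleftrightarrow> iso_verts h u \<inter> iso_verts h v \<noteq> {}" by simp
  qed
next
  fix f assume G: "pair_graph G" and inj: "inj_on f (pverts G)" and P: "P (f ` pverts G)"
    and adj: "\<forall>u\<in>pverts G. \<forall>v\<in>pverts G. u \<noteq> v \<longrightarrow> ((u, v) \<in> parcs G \<longleftrightarrow> f u \<inter> f v \<noteq> {})"
  interpret pair_graph G by fact
  define h where "h = \<lparr> iso_verts = f, iso_arcs = (\<lambda>a. (f (fst a), f (snd a))), iso_head = snd, iso_tail = fst \<rparr>"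
  have "inj_on (\<lambda>a. (f (fst a), f (snd a))) (parcs G)"
    using inj arc_fst_in_verts arc_snd_in_verts by (auto simp: inj_on_def prod_eq_iff)
  then have hom: "digraph_isomorphism h"
    unfolding digraph_isomorphism_def h_def using inj by (simp add: wf_digraph_axioms)
  have arcs: "(\<lambda>a. (f (fst a), f (snd a))) ` parcs G = parcs (intersection_graph (f ` pverts G))"
  proof (intro set_eqI iffI)
    fix x assume "x \<in> (\<lambda>a. (f (fst a), f (snd a))) ` parcs G"
    then obtain u v where uv: "(u, v) \<in> parcs G" "x = (f u, f v)" by auto
    have "u \<in> pverts G" "v \<in> pverts G" "u \<noteq> v"
      using uv arc_fst_in_verts arc_snd_in_verts pair_no_loops by fastforce+
    moreover have "f u \<noteq> f v" using calculation inj by (auto dest: inj_onD)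
    ultimately show "x \<in> parcs (intersection_graph (f ` pverts G))"
      using adj uv by (auto simp: intersection_graph_def)
  next
    fix x assume "x \<in> parcs (intersection_graph (f ` pverts G))"
    then obtain u v where "u \<in> pverts G" "v \<in> pverts G" "x = (f u, f v)" "f u \<noteq> f v" "f u \<inter> f v \<noteq> {}"
      by (auto simp: intersection_graph_def)
    then have "u \<noteq> v" by blast
    then have "(u, v) \<in> parcs G"
      using adj \<open>u \<in> pverts G\<close> \<open>v \<in> pverts G\<close> \<open>f u \<inter> f v \<noteq> {}\<close> by simp
    then show "x \<in> (\<lambda>a. (f (fst a), f (snd a))) ` parcs G" 
      using \<open>x = (f u, f v)\<close> by (intro image_eqI[of _ _ "(u, v)"]) simp_all
  qed
  have "with_proj (intersection_graph (f ` pverts G)) = app_iso h (with_proj G)"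
    using arcs by (simp add: with_proj_def app_iso_def h_def intersection_graph_def)
  then have "digraph_iso (with_proj G) (with_proj (intersection_graph (f ` pverts G)))"
    using hom unfolding digraph_iso_def by blast
  then show ?L
    unfolding intersection_graph_class_def using G P pair_finite_verts by blast
qed

text \<open>The inclusions between the classes are proved through this criterion. Injectivity of
  \<open>h\<close> is demanded because two vertices with the same set would collapse into
  one.\<close>

lemma intersection_graph_class_mono:
  assumes "\<And>S. finite S \<Longrightarrow> P S \<Longrightarrow>
    \<exists>h. inj_on h S \<and> Q (h ` S) \<and> (\<forall>A\<in>S. \<forall>B\<in>S. A \<noteq> B \<longrightarrow> (h A \<inter> h B \<noteq> {} \<longleftrightarrow> A \<inter> B \<noteq> {}))"
  shows "intersection_graph_class P \<subseteq> intersection_graph_class Q"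
proof
  fix G :: "'v pair_pre_digraph" assume "G \<in> intersection_graph_class P"
  then obtain f where G: "pair_graph G" and f: "inj_on f (pverts G)" "P (f ` pverts G)"
    and adj: "\<And>u v. u\<in>pverts G \<Longrightarrow> v\<in>pverts G \<Longrightarrow> u \<noteq> v \<Longrightarrow> ((u, v) \<in> parcs G \<longleftrightarrow> f u \<inter> f v \<noteq> {})"
    unfolding intersection_graph_class_iff by blast
  interpret pair_graph G by fact
  have "finite (f ` pverts G)" using pair_finite_verts by simp
  from assms[OF this f(2)] obtain h where h: "inj_on h (f ` pverts G)" "Q (h ` f ` pverts G)"
    "\<forall>A\<in>f ` pverts G. \<forall>B\<in>f ` pverts G. A \<noteq> B \<longrightarrow> (h A \<inter> h B \<noteq> {} \<longleftrightarrow> A \<inter> B \<noteq> {})"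
    by (elim exE conjE) rule
  have "inj_on (h \<circ> f) (pverts G)" using f(1) h(1) by (rule comp_inj_on)
  moreover have "Q ((h \<circ> f) ` pverts G)" using h(2) by (simp add: image_comp)
  moreover have "(u, v) \<in> parcs G \<longleftrightarrow> (h \<circ> f) u \<inter> (h \<circ> f) v \<noteq> {}"
    if uv: "u\<in>pverts G" "v\<in>pverts G" "u \<noteq> v" for u v
  proof -
    have "f u \<noteq> f v" using f(1) uv by (meson inj_onD)
    then have "h (f u) \<inter> h (f v) \<noteq> {} \<longleftrightarrow> f u \<inter> f v \<noteq> {}" using h(3) uv by simp
    then show ?thesis using adj[OF uv] by simp
  qed
  ultimately show "G \<in> intersection_graph_class Q"
    unfolding intersection_graph_class_iff using G by blast
qed

text \<open>The witness graphs live on an initial segment of the naturals and are carried into an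
  arbitrary infinite vertex type by \<open>e\<close>. The disjunction and
  \<open>i \<noteq> j\<close> make the result symmetric and, for injective \<open>e\<close>,
  loopless whatever \<open>adj\<close> is.\<close>

definition numbered_graph :: "(nat \<Rightarrow> 'v) \<Rightarrow> nat \<Rightarrow> (nat \<Rightarrow> nat \<Rightarrow> bool) \<Rightarrow> 'v pair_pre_digraph" where
  "numbered_graph e n adj = \<lparr> pverts = e ` {..<n}, parcs = {(e i, e j) | i j. i < n \<and> j < n \<and> i \<noteq> j \<and> (adj i j \<or> adj j i)} \<rparr>"

lemma numbered_graph_in_class_iff:
  assumes e: "inj e" and sym: "\<And>i j. adj i j \<longleftrightarrow> adj j i"
  shows "numbered_graph e n adj \<in> intersection_graph_class P \<longleftrightarrow>
     (\<exists>f. inj_on f {..<n} \<and> P (f ` {..<n}) \<and>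
        (\<forall>i<n. \<forall>j<n. i \<noteq> j \<longrightarrow> (adj i j \<longleftrightarrow> f i \<inter> f j \<noteq> {})))"
proof -
  let ?G = "numbered_graph e n adj"
  have pv: "pverts ?G = e ` {..<n}" by (simp add: numbered_graph_def)
  have pa: "(e i, e j) \<in> parcs ?G \<longleftrightarrow> i < n \<and> j < n \<and> i \<noteq> j \<and> adj i j" for i j
    using e sym[of i j] by (auto simp: numbered_graph_def inj_eq)
  have sub: "parcs ?G \<subseteq> pverts ?G \<times> pverts ?G" by (auto simp: numbered_graph_def)
  have "finite (parcs ?G)" by (rule finite_subset[OF sub]) (simp add: pv)
  moreover have "symmetric (with_proj ?G)"
    unfolding symmetric_def with_proj_simps by (rule symI) (auto simp: numbered_graph_def)
  moreover have "fst a \<noteq> snd a" if "a \<in> parcs ?G" for a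
    using that e by (auto simp: numbered_graph_def inj_eq)
  ultimately have G: "pair_graph ?G"
    using sub by unfold_locales (auto simp: pv)
  show ?thesis
  proof
    assume "?G \<in> intersection_graph_class P"
    then obtain f where f: "inj_on f (e ` {..<n})" "P (f ` e ` {..<n})"
     and adj: "\<forall>u\<in>pverts ?G. \<forall>v\<in>pverts ?G. u \<noteq> v \<longrightarrow> ((u, v) \<in> parcs ?G \<longleftrightarrow> f u \<inter> f v \<noteq> {})"
      unfolding intersection_graph_class_iff pv by blast
    have "inj_on (f \<circ> e) {..<n}" using f(1) e by (meson comp_inj_on inj_on_subset subset_UNIV)
    moreover have "P ((f \<circ> e) ` {..<n})" using f(2) by (simp add: image_comp)
    moreover have "adj i j \<longleftrightarrow> (f \<circ> e) i \<inter> (f \<circ> e) j \<noteq> {}" if "i < n" "j < n" "i \<noteq> j" for i j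
      using adj[rule_format, of "e i" "e j"] that e pa[of i j] by (simp add: pv inj_eq)
    ultimately show "\<exists>f. inj_on f {..<n} \<and> P (f ` {..<n}) \<and>
        (\<forall>i<n. \<forall>j<n. i \<noteq> j \<longrightarrow> (adj i j \<longleftrightarrow> f i \<inter> f j \<noteq> {}))" by blast
  next
    assume "\<exists>f. inj_on f {..<n} \<and> P (f ` {..<n}) \<and>
        (\<forall>i<n. \<forall>j<n. i \<noteq> j \<longrightarrow> (adj i j \<longleftrightarrow> f i \<inter> f j \<noteq> {}))"
    then obtain f where f: "inj_on f {..<n}" "P (f ` {..<n})"
        and adj: "\<And>i j. i<n \<Longrightarrow> j<n \<Longrightarrow> i \<noteq> j \<Longrightarrow> (adj i j \<longleftrightarrow> f i \<inter> f j \<noteq> {})" by blast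
    define F where "F = f \<circ> inv e"
    have F: "F (e i) = f i" for i using e by (simp add: F_def)
    have "inj_on F (e ` {..<n})" using f(1) by (auto simp: inj_on_def F)
    moreover have "P (F ` e ` {..<n})" using f(2) by (simp add: image_comp F comp_def)
    moreover have "\<forall>u\<in>pverts ?G. \<forall>v\<in>pverts ?G. u \<noteq> v \<longrightarrow> ((u, v) \<in> parcs ?G \<longleftrightarrow> F u \<inter> F v \<noteq> {})"
      using adj by (auto simp: pv pa F)
    ultimately show "?G \<in> intersection_graph_class P"
      unfolding intersection_graph_class_iff pv using G by blast
  qed
qed

subsection \<open>Grounded segments, downward rays and rays\<close>

text \<open>The parameter \<open>h\<close> is the vertical height above the line: the base has
  abscissa \<open>\<alpha>\<close>, and the abscissa changes by \<open>\<beta>\<close> per unit of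
  height. Two such segments meet exactly when they agree at a common height, so intersection becomes
  a linear equation on an interval.\<close>

definition gseg :: "real \<Rightarrow> real \<Rightarrow> real \<Rightarrow> real \<Rightarrow> real \<Rightarrow> complex set" where
  "gseg m c \<alpha> \<beta> H = (\<lambda>h. Complex (\<alpha> + \<beta> * h) (h + m * (\<alpha> + \<beta> * h) + c)) ` {0..H}"

text \<open>The parameter \<open>s\<close> is the depth below the horizontal axis and
  \<open>s0\<close> the depth of the apex. As for \<open>gseg\<close>, two rays can meet only at
  equal parameters.\<close>

definition dray :: "real \<Rightarrow> real \<Rightarrow> real \<Rightarrow> complex set" where
  "dray p q s0 = (\<lambda>s. Complex (p + q * s) (- s)) ` {s0..}"

lemma grounded_segment_gseg:
  assumes "grounded_segment m c A"
  shows "\<exists>\<alpha> \<beta> H. H > 0 \<and> A = gseg m c \<alpha> \<beta> H"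
proof -
  obtain a b where ab: "a \<noteq> b" "A = closed_segment a b" "Im a = m * Re a + c"
    "open_segment a b \<subseteq> above_line m c"
    using assms unfolding grounded_segment_def ground_line_def by auto
  define H where "H = Im b - m * Re b - c"
  have "midpoint a b \<in> open_segment a b" using ab(1) by simp
  then have "midpoint a b \<in> above_line m c" using ab(4) by blast
  then have H: "H > 0"
    using ab(3) by (simp add: above_line_def midpoint_def H_def algebra_simps)
  define \<beta> where "\<beta> = (Re b - Re a) / H"
  have bH: "\<beta> * H = Re b - Re a" using H by (simp add: \<beta>_def)
  have pt: "Complex (Re a + \<beta> * (u * H)) (u * H + m * (Re a + \<beta> * (u * H)) + c) = (1 - u) *\<^sub>R a + u *\<^sub>R b"
    for u
  proof -
    have e: "\<beta> * (u * H) = u * (Re b - Re a)" using bH by (metis mult.left_commute)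
    show ?thesis unfolding e
      by (rule complex_eqI) (simp_all add: H_def ab(3) algebra_simps)
  qed
  have "A = gseg m c (Re a) \<beta> H"
  proof (intro set_eqI iffI)
    fix z assume "z \<in> A"
    then obtain u where u: "0 \<le> u" "u \<le> 1" "z = (1 - u) *\<^sub>R a + u *\<^sub>R b"
      unfolding ab(2) closed_segment_def by auto
    then have "u * H \<in> {0..H}" using H by (auto simp: mult_left_le_one_le)
    then show "z \<in> gseg m c (Re a) \<beta> H"
      unfolding gseg_def u(3) by (rule rev_image_eqI) (rule pt[symmetric])
  next
    fix z assume "z \<in> gseg m c (Re a) \<beta> H"
    then obtain h where h: "0 \<le> h" "h \<le> H" "z = Complex (Re a + \<beta> * h) (h + m * (Re a + \<beta> * h) + c)"
      unfolding gseg_def by auto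
    have "h = (h / H) * H" using H by simp
    then have "z = (1 - h/H) *\<^sub>R a + (h/H) *\<^sub>R b" using pt[of "h / H"] h(3) by simp
    moreover have "0 \<le> h / H" "h / H \<le> 1" using h H by auto
    ultimately show "z \<in> A" unfolding ab(2) closed_segment_def by blast
  qed
  then show ?thesis using H by blast
qed

lemma gseg_grounded_segment:
  assumes "H > 0"
  shows "grounded_segment m c (gseg m c \<alpha> \<beta> H)"
proof -
  define P where "P h = Complex (\<alpha> + \<beta> * h) (h + m * (\<alpha> + \<beta> * h) + c)" for h
  have pt: "P (u * H) = (1 - u) *\<^sub>R P 0 + u *\<^sub>R P H" for u
    by (rule complex_eqI) (simp_all add: P_def algebra_simps)
  have "gseg m c \<alpha> \<beta> H = closed_segment (P 0) (P H)"
  proof (intro set_eqI iffI)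
    fix z assume "z \<in> closed_segment (P 0) (P H)"
    then obtain u where u: "0 \<le> u" "u \<le> 1" "z = P (u * H)"
      unfolding closed_segment_def pt by auto
    then have "u * H \<in> {0..H}" using assms by (auto simp: mult_left_le_one_le)
    then show "z \<in> gseg m c \<alpha> \<beta> H" unfolding gseg_def u(3) P_def by blast
  next
    fix z assume "z \<in> gseg m c \<alpha> \<beta> H"
    then obtain h where h: "0 \<le> h" "h \<le> H" "z = P h" unfolding gseg_def P_def by auto
    have "z = P ((h / H) * H)" using assms h(3) by simp
    moreover have "0 \<le> h / H" "h / H \<le> 1" using h assms by auto
    ultimately show "z \<in> closed_segment (P 0) (P H)" unfolding closed_segment_def pt by blast
  qed
  moreover have "open_segment (P 0) (P H) \<subseteq> above_line m c"
  proof
    fix z assume "z \<in> open_segment (P 0) (P H)"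
    then obtain u where "0 < u" "z = P (u * H)" unfolding in_segment pt by auto
    then show "z \<in> above_line m c" using assms by (simp add: above_line_def P_def)
  qed
  moreover have "P 0 \<noteq> P H" using assms by (auto simp: P_def)
  moreover have "P 0 \<in> ground_line m c" by (simp add: P_def ground_line_def)
  ultimately show ?thesis unfolding grounded_segment_def by blast
qed

lemma gseg_Int_iff:
  "gseg m c \<alpha> \<beta> H \<inter> gseg m c \<alpha>' \<beta>' H' \<noteq> {} \<longleftrightarrow> (\<exists>h. 0 \<le> h \<and> h \<le> H \<and> h \<le> H' \<and> \<alpha> + \<beta> * h = \<alpha>' + \<beta>' * h)"
proof
  assume "gseg m c \<alpha> \<beta> H \<inter> gseg m c \<alpha>' \<beta>' H' \<noteq> {}"
  then obtain h h' where h: "h \<in> {0..H}" "h' \<in> {0..H'}" 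
    "Complex (\<alpha> + \<beta> * h) (h + m * (\<alpha> + \<beta> * h) + c) = Complex (\<alpha>' + \<beta>' * h') (h' + m * (\<alpha>' + \<beta>' * h') + c)"
    unfolding gseg_def by blast
  note e = h(3)[unfolded complex.inject]
  have "h = h'" using e[THEN conjunct2] unfolding e[THEN conjunct1] by simp
  then show "\<exists>h. 0 \<le> h \<and> h \<le> H \<and> h \<le> H' \<and> \<alpha> + \<beta> * h = \<alpha>' + \<beta>' * h" using h by auto
next
  assume "\<exists>h. 0 \<le> h \<and> h \<le> H \<and> h \<le> H' \<and> \<alpha> + \<beta> * h = \<alpha>' + \<beta>' * h"
  then obtain h where h: "0 \<le> h" "h \<le> H" "h \<le> H'" "\<alpha> + \<beta> * h = \<alpha>' + \<beta>' * h" by blast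
  have "Complex (\<alpha> + \<beta> * h) (h + m * (\<alpha> + \<beta> * h) + c) \<in> gseg m c \<alpha> \<beta> H"
    unfolding gseg_def using h(1-3) by auto
  moreover have "Complex (\<alpha> + \<beta> * h) (h + m * (\<alpha> + \<beta> * h) + c) \<in> gseg m c \<alpha>' \<beta>' H'"
    unfolding gseg_def h(4) using h(1-3) by auto
  ultimately show "gseg m c \<alpha> \<beta> H \<inter> gseg m c \<alpha>' \<beta>' H' \<noteq> {}" by blast
qed

lemma dray_Int_iff:
  "dray p q s \<inter> dray p' q' s' \<noteq> {} \<longleftrightarrow> (\<exists>t. s \<le> t \<and> s' \<le> t \<and> p + q * t = p' + q' * t)"
  unfolding dray_def by auto

lemma gseg_eq_iff:
  assumes "H > 0" "H' > 0"
  shows "gseg m c \<alpha> \<beta> H = gseg m c \<alpha>' \<beta>' H' \<longleftrightarrow> \<alpha> = \<alpha>' \<and> \<beta> = \<beta>' \<and> H = H'"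
proof
  assume eq: "gseg m c \<alpha> \<beta> H = gseg m c \<alpha>' \<beta>' H'"
  have *: "h \<le> H' \<and> \<alpha> + \<beta> * h = \<alpha>' + \<beta>' * h" if "0 \<le> h" "h \<le> H" for h
  proof -
    have "Complex (\<alpha> + \<beta> * h) (h + m * (\<alpha> + \<beta> * h) + c) \<in> gseg m c \<alpha>' \<beta>' H'"
      unfolding eq[symmetric] unfolding gseg_def using that by auto
    then show ?thesis unfolding gseg_def by auto
  qed
  have **: "h \<le> H" if "0 \<le> h" "h \<le> H'" for h
  proof -
    have "Complex (\<alpha>' + \<beta>' * h) (h + m * (\<alpha>' + \<beta>' * h) + c) \<in> gseg m c \<alpha> \<beta> H"
      unfolding eq unfolding gseg_def using that by auto
    then show ?thesis unfolding gseg_def by auto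
  qed
  have "H = H'" using *[of H] **[of H'] assms by auto
  moreover have "\<alpha> = \<alpha>'" using *[of 0] assms by auto
  moreover have "\<beta> = \<beta>'" using *[of H] assms calculation by auto
  ultimately show "\<alpha> = \<alpha>' \<and> \<beta> = \<beta>' \<and> H = H'" by blast
qed auto

lemma dray_eq_iff: "dray p q s = dray p' q' s' \<longleftrightarrow> p = p' \<and> q = q' \<and> s = s'"
proof
  assume eq: "dray p q s = dray p' q' s'"
  have *: "s' \<le> t \<and> p + q * t = p' + q' * t" if "s \<le> t" for t
  proof -
    have "Complex (p + q * t) (- t) \<in> dray p' q' s'" unfolding eq[symmetric] unfolding dray_def using that by auto
    then show ?thesis unfolding dray_def by auto
  qed
  have **: "s \<le> s'"
  proof -
    have "Complex (p' + q' * s') (- s') \<in> dray p q s" unfolding eq unfolding dray_def by auto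
    then show ?thesis unfolding dray_def by auto
  qed
  have "s = s'" using *[of s] ** by auto
  moreover have "q = q'" using *[of s] *[of "s + 1"] by (auto simp: algebra_simps)
  moreover have "p = p'" using *[of s] calculation by auto
  ultimately show "p = p' \<and> q = q' \<and> s = s'" by blast
qed auto

lemma is_downward_ray_iff: "is_downward_ray A \<longleftrightarrow> (\<exists>p q s. A = dray p q s)"
proof
  assume "is_downward_ray A"
  then obtain a v where av: "v \<noteq> 0" "A = ray_from a v" "\<forall>z \<in> A - {a}. Im z < Im a"
    unfolding is_downward_ray_def by blast
  have "a + 1 *\<^sub>R v \<in> A" unfolding av(2) ray_from_def by (intro CollectI exI[of _ 1]) simp
  then have "a + 1 *\<^sub>R v \<in> A - {a}" using av(1) by simp
  then have "Im (a + 1 *\<^sub>R v) < Im a" using av(3) by blast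
  then have v: "Im v < 0" by simp
  define q where "q = - Re v / Im v"
  have q: "q * Im v = - Re v" using v by (simp add: q_def)
  have pt: "Complex (Re a + q * Im a + q * (- Im a - t * Im v)) (Im a + t * Im v) = a + t *\<^sub>R v" for t
    using q by (intro complex_eqI) (simp_all add: algebra_simps mult.left_commute[of q])
  have "A = dray (Re a + q * Im a) q (- Im a)"
  proof (intro set_eqI iffI)
    fix z assume "z \<in> A"
    then obtain t where t: "t \<ge> 0" "z = a + t *\<^sub>R v" unfolding av(2) ray_from_def by auto
    then have "- Im a - t * Im v \<in> {- Im a..}" using v by (simp add: mult_nonneg_nonpos)
    then show "z \<in> dray (Re a + q * Im a) q (- Im a)"
      unfolding dray_def by (rule rev_image_eqI) (unfold t(2) pt[of t, symmetric], simp)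
  next
    fix z assume "z \<in> dray (Re a + q * Im a) q (- Im a)"
    then obtain s where s: "s \<ge> - Im a" "z = Complex (Re a + q * Im a + q * s) (- s)"
      unfolding dray_def by auto
    define t where "t = (- s - Im a) / Im v"
    have "t * Im v = - s - Im a" using v by (simp add: t_def)
    then have "z = a + t *\<^sub>R v" using pt[of t] s(2) by simp
    moreover have "t \<ge> 0" using s v by (simp add: t_def divide_nonpos_neg)
    ultimately show "z \<in> A" unfolding av(2) ray_from_def by blast
  qed
  then show "\<exists>p q s. A = dray p q s" by blast
next
  assume "\<exists>p q s. A = dray p q s"
  then obtain p q s where A: "A = dray p q s" by blast
  have "A = ray_from (Complex (p + q * s) (- s)) (Complex q (-1))"
  proof (intro set_eqI iffI)
    fix z assume "z \<in> A"
    then obtain t where "t \<ge> s" "z = Complex (p + q * t) (- t)" unfolding A dray_def by auto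
    then have "z = Complex (p + q * s) (- s) + (t - s) *\<^sub>R Complex q (-1)" "t - s \<ge> 0"
      by (auto simp: complex_eq_iff algebra_simps)
    then show "z \<in> ray_from (Complex (p + q * s) (- s)) (Complex q (-1))"
      unfolding ray_from_def by blast
  next
    fix z assume "z \<in> ray_from (Complex (p + q * s) (- s)) (Complex q (-1))"
    then obtain t where "t \<ge> 0" "z = Complex (p + q * s) (- s) + t *\<^sub>R Complex q (-1)"
      unfolding ray_from_def by blast
    then have "z = Complex (p + q * (s + t)) (- (s + t))" "s + t \<in> {s..}"
      by (auto simp: complex_eq_iff algebra_simps)
    then show "z \<in> A" unfolding A dray_def by blast
  qed
  moreover have "\<forall>z\<in>A - {Complex (p + q * s) (- s)}. Im z < Im (Complex (p + q * s) (- s))"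
    unfolding A dray_def by (auto simp: order_le_less)
  moreover have "Complex q (-1) \<noteq> 0" by (simp add: complex_eq_iff)
  ultimately show "is_downward_ray A" unfolding is_downward_ray_def by blast
qed

text \<open>A horizontal line far below cuts all rays to segments grounded on it. It has to lie
  below every apex and not above one chosen common point of each meeting pair.\<close>

lemma downward_ray_graphs_subset_grounded_segment_graphs:
  "downward_ray_graphs \<subseteq> grounded_segment_graphs"
  unfolding downward_ray_graphs_def grounded_segment_graphs_def
proof (rule intersection_graph_class_mono)
  fix S assume fin: "finite S" and S: "\<forall>A\<in>S. is_downward_ray A"
  have "\<forall>A\<in>S. \<exists>x. A = dray (fst x) (fst (snd x)) (snd (snd x))"
    using S unfolding is_downward_ray_iff by fastforce
  then obtain x where x: "\<forall>A\<in>S. A = dray (fst (x A)) (fst (snd (x A))) (snd (snd (x A)))"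
    unfolding bchoice_iff by (elim exE)
  define p q s where "p A = fst (x A)" and "q A = fst (snd (x A))" and "s A = snd (snd (x A))" for A
  have pqs: "A = dray (p A) (q A) (s A)" if "A \<in> S" for A
    unfolding p_def q_def s_def by (rule bspec[OF x that])
  have ev: "\<forall>\<^sub>F M in at_top. s A < M \<and> (A \<inter> B \<noteq> {} \<longrightarrow>
      (\<exists>t. s A \<le> t \<and> s B \<le> t \<and> t \<le> M \<and> p A + q A * t = p B + q B * t))"
    if AB: "A \<in> S" "B \<in> S" for A B
  proof (cases "A \<inter> B = {}")
    case True then show ?thesis using eventually_gt_at_top by simp
  next
    case False
    then have "dray (p A) (q A) (s A) \<inter> dray (p B) (q B) (s B) \<noteq> {}"
      by (simp add: pqs[OF AB(1), symmetric] pqs[OF AB(2), symmetric])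
    then obtain t where t: "s A \<le> t" "s B \<le> t" "p A + q A * t = p B + q B * t"
      unfolding dray_Int_iff by blast
    show ?thesis
      using eventually_gt_at_top[of "s A"] eventually_ge_at_top[of t]
      by eventually_elim (use t in blast)
  qed
  have "\<forall>\<^sub>F M in at_top. \<forall>A\<in>S. \<forall>B\<in>S. s A < M \<and> (A \<inter> B \<noteq> {} \<longrightarrow>
      (\<exists>t. s A \<le> t \<and> s B \<le> t \<and> t \<le> M \<and> p A + q A * t = p B + q B * t))"
    using fin ev by (intro eventually_ball_finite ballI) 
  from eventually_happens'[OF trivial_limit_at_top_linorder this]
  obtain M where M0: "\<forall>A\<in>S. \<forall>B\<in>S. s A < M \<and> (A \<inter> B \<noteq> {} \<longrightarrow>
      (\<exists>t. s A \<le> t \<and> s B \<le> t \<and> t \<le> M \<and> p A + q A * t = p B + q B * t))"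
    by (elim exE) (rule that)
  note M = bspec[OF bspec[OF M0]]
  define h where "h A = gseg 0 (- M) (p A + q A * M) (- q A) (M - s A)" for A
  have pos: "M - s A > 0" if "A \<in> S" for A using M[OF that that] by simp
  show "\<exists>h. inj_on h S \<and> (\<exists>m c. \<forall>A\<in>h ` S. grounded_segment m c A) \<and>
      (\<forall>A\<in>S. \<forall>B\<in>S. A \<noteq> B \<longrightarrow> (h A \<inter> h B \<noteq> {} \<longleftrightarrow> A \<inter> B \<noteq> {}))"
  proof (intro exI[of _ h] conjI ballI impI)
    show "inj_on h S"
    proof (rule inj_onI)
      fix A B assume AB: "A \<in> S" "B \<in> S" "h A = h B"
      then have *: "p A + q A * M = p B + q B * M \<and> - q A = - q B \<and> M - s A = M - s B"
        unfolding h_def gseg_eq_iff[OF pos[OF AB(1)] pos[OF AB(2)]] by blast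
      then have q: "q A = q B" and s: "s A = s B" by simp_all
      have p: "p A = p B" using * unfolding q by simp
      have "dray (p A) (q A) (s A) = dray (p B) (q B) (s B)" unfolding p q s ..
      then show "A = B" using pqs[OF AB(1), symmetric] pqs[OF AB(2), symmetric] by simp
    qed
    show "\<exists>m c. \<forall>A\<in>h ` S. grounded_segment m c A"
      using gseg_grounded_segment pos by (intro exI[of _ 0] exI[of _ "- M"]) (auto simp: h_def)
    fix A B assume AB: "A \<in> S" "B \<in> S"
    have "h A \<inter> h B \<noteq> {} \<longleftrightarrow> (\<exists>t. s A \<le> t \<and> s B \<le> t \<and> t \<le> M \<and> p A + q A * t = p B + q B * t)"
      unfolding h_def gseg_Int_iff
    proof safe
      fix k assume "0 \<le> k" "k \<le> M - s A" "k \<le> M - s B" "p A + q A * M + - q A * k = p B + q B * M + - q B * k"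
      then show "\<exists>t. s A \<le> t \<and> s B \<le> t \<and> t \<le> M \<and> p A + q A * t = p B + q B * t"
        by (intro exI[of _ "M - k"]) (auto simp: algebra_simps)
    next
      fix t assume "s A \<le> t" "s B \<le> t" "t \<le> M" "p A + q A * t = p B + q B * t"
      then show "\<exists>k\<ge>0. k \<le> M - s A \<and> k \<le> M - s B \<and> p A + q A * M + - q A * k = p B + q B * M + - q B * k"
        by (intro exI[of _ "M - t"]) (simp add: algebra_simps)
    qed
    also have "\<dots> \<longleftrightarrow> dray (p A) (q A) (s A) \<inter> dray (p B) (q B) (s B) \<noteq> {}"
      using M[OF AB] dray_Int_iff[of "p A" "q A" "s A" "p B" "q B" "s B"]
      unfolding pqs[OF AB(1), symmetric] pqs[OF AB(2), symmetric] by blast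
    also have "\<dots> \<longleftrightarrow> A \<inter> B \<noteq> {}" by (simp add: pqs[OF AB(1), symmetric] pqs[OF AB(2), symmetric])
    finally show "h A \<inter> h B \<noteq> {} \<longleftrightarrow> A \<inter> B \<noteq> {}" .
  qed
qed

text \<open>
  The projective map \<open>(x, h) \<mapsto> (x / (h + \<epsilon>), - 1 / (h + \<epsilon>))\<close> turns a grounded segment, prolonged down
  to height \<open>- \<epsilon>\<close>, into a downward ray. The prolongation is needed because segments that meet only
  on the grounding line itself would otherwise become parallel.
\<close>

lemma grounded_segment_graphs_subset_downward_ray_graphs:
  "grounded_segment_graphs \<subseteq> downward_ray_graphs"
  unfolding downward_ray_graphs_def grounded_segment_graphs_def
proof (rule intersection_graph_class_mono)
  fix S assume fin: "finite S" and "\<exists>m c. \<forall>A\<in>S. grounded_segment m c A"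
  then obtain m c where S: "\<forall>A\<in>S. grounded_segment m c A" by blast
  have "\<forall>A\<in>S. \<exists>x. snd (snd x) > 0 \<and> A = gseg m c (fst x) (fst (snd x)) (snd (snd x))"
    using S grounded_segment_gseg by fastforce
  then obtain x where x: "\<forall>A\<in>S. snd (snd (x A)) > 0 \<and> A = gseg m c (fst (x A)) (fst (snd (x A))) (snd (snd (x A)))"
    unfolding bchoice_iff by (elim exE)
  define \<alpha> \<beta> H where "\<alpha> A = fst (x A)" and "\<beta> A = fst (snd (x A))" and "H A = snd (snd (x A))" for A
  have par: "H A > 0" "A = gseg m c (\<alpha> A) (\<beta> A) (H A)" if "A \<in> S" for A
    using bspec[OF x that] unfolding \<alpha>_def \<beta>_def H_def by - (elim conjE, assumption)+
  \<comment> \<open>The bound keeps segments with distinct bases apart in the strip between the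
    heights \<open>- \<epsilon>\<close> and \<open>0\<close> that the prolongation adds.\<close>
  have ev: "\<forall>\<^sub>F \<epsilon> in at_right 0. \<alpha> A \<noteq> \<alpha> B \<longrightarrow> \<epsilon> * \<bar>\<beta> A - \<beta> B\<bar> < \<bar>\<alpha> A - \<alpha> B\<bar>" for A B
  proof (cases "\<alpha> A = \<alpha> B")
    case False
    have "((\<lambda>\<epsilon>. \<epsilon> * \<bar>\<beta> A - \<beta> B\<bar>) \<longlongrightarrow> 0 * \<bar>\<beta> A - \<beta> B\<bar>) (at_right 0)" by (intro tendsto_intros)
    then have "\<forall>\<^sub>F \<epsilon> in at_right 0. \<epsilon> * \<bar>\<beta> A - \<beta> B\<bar> < \<bar>\<alpha> A - \<alpha> B\<bar>"
      by (rule order_tendstoD) (use False in simp)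
    then show ?thesis by eventually_elim blast
  qed simp
  have "\<forall>\<^sub>F \<epsilon> in at_right 0. \<forall>A\<in>S. \<forall>B\<in>S. \<alpha> A \<noteq> \<alpha> B \<longrightarrow> \<epsilon> * \<bar>\<beta> A - \<beta> B\<bar> < \<bar>\<alpha> A - \<alpha> B\<bar>"
    using fin ev by (intro eventually_ball_finite ballI)
  from eventually_happens'[OF trivial_limit_at_right_real eventually_conj[OF this eventually_at_right_less]]
  obtain \<epsilon> :: real where \<epsilon>: "\<epsilon> > 0"
    and small0: "\<forall>A\<in>S. \<forall>B\<in>S. \<alpha> A \<noteq> \<alpha> B \<longrightarrow> \<epsilon> * \<bar>\<beta> A - \<beta> B\<bar> < \<bar>\<alpha> A - \<alpha> B\<bar>"
    by (elim exE conjE) (rule that)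
  note small = mp[OF bspec[OF bspec[OF small0]]]
  \<comment> \<open>Height \<open>k\<close> goes to depth \<open>t = 1 / (k + \<epsilon>)\<close>,
    and \<open>(\<alpha> + \<beta> * k) * t\<close> equals
    \<open>\<beta> + (\<alpha> - \<beta> * \<epsilon>) * t\<close>. The largest height
    \<open>H A\<close> gives the smallest depth, that of the apex.\<close>
  define h where "h A = dray (\<beta> A) (\<alpha> A - \<beta> A * \<epsilon>) (1 / (H A + \<epsilon>))" for A
  show "\<exists>h. inj_on h S \<and> (\<forall>A\<in>h ` S. is_downward_ray A) \<and>
      (\<forall>A\<in>S. \<forall>B\<in>S. A \<noteq> B \<longrightarrow> (h A \<inter> h B \<noteq> {} \<longleftrightarrow> A \<inter> B \<noteq> {}))"
  proof (intro exI[of _ h] conjI ballI impI)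
    show "inj_on h S"
    proof (rule inj_onI)
      fix A B assume AB: "A \<in> S" "B \<in> S" "h A = h B"
      have *: "\<beta> A = \<beta> B \<and> \<alpha> A - \<beta> A * \<epsilon> = \<alpha> B - \<beta> B * \<epsilon> \<and> 1 / (H A + \<epsilon>) = 1 / (H B + \<epsilon>)"
        using AB(3) unfolding h_def dray_eq_iff .
      then have b: "\<beta> A = \<beta> B" and H: "H A = H B"
        using par(1)[OF AB(1)] par(1)[OF AB(2)] \<epsilon> by simp_all
      have a: "\<alpha> A = \<alpha> B" using * unfolding b by simp
      have "gseg m c (\<alpha> A) (\<beta> A) (H A) = gseg m c (\<alpha> B) (\<beta> B) (H B)" unfolding a b H ..
      then show "A = B" using par(2)[OF AB(1), symmetric] par(2)[OF AB(2), symmetric] by simp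
    qed
    show "is_downward_ray A" if "A \<in> h ` S" for A
      using that unfolding is_downward_ray_iff h_def by blast
    fix A B assume AB: "A \<in> S" "B \<in> S"
    have HA: "H A > 0" and HB: "H B > 0" using par(1) AB by auto
    have key: "\<beta> A + (\<alpha> A - \<beta> A * \<epsilon>) * (1 / (k + \<epsilon>)) = \<beta> B + (\<alpha> B - \<beta> B * \<epsilon>) * (1 / (k + \<epsilon>))
      \<longleftrightarrow> \<alpha> A + \<beta> A * k = \<alpha> B + \<beta> B * k" if "k + \<epsilon> > 0" for k
    proof -
      have "\<beta> C + (\<alpha> C - \<beta> C * \<epsilon>) * (1 / (k + \<epsilon>)) = (\<alpha> C + \<beta> C * k) / (k + \<epsilon>)" for C
        using that by (simp add: field_simps)
      then show ?thesis using that by simp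
    qed
    have "h A \<inter> h B \<noteq> {} \<longleftrightarrow> (\<exists>k. 0 \<le> k \<and> k \<le> H A \<and> k \<le> H B \<and> \<alpha> A + \<beta> A * k = \<alpha> B + \<beta> B * k)"
      unfolding h_def dray_Int_iff
    proof safe
      fix t assume t: "1 / (H A + \<epsilon>) \<le> t" "1 / (H B + \<epsilon>) \<le> t"
        "\<beta> A + (\<alpha> A - \<beta> A * \<epsilon>) * t = \<beta> B + (\<alpha> B - \<beta> B * \<epsilon>) * t"
      have tpos: "t > 0" using HA \<epsilon> by (intro less_le_trans[OF _ t(1)]) simp
      define k where "k = 1 / t - \<epsilon>"
      have k: "k + \<epsilon> > 0" "t = 1 / (k + \<epsilon>)" using tpos by (auto simp: k_def)
      have kH: "k \<le> H A" "k \<le> H B" using t(1,2) tpos HA HB \<epsilon> by (auto simp: k_def field_simps)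
      have eq: "\<alpha> A + \<beta> A * k = \<alpha> B + \<beta> B * k" using key[OF k(1)] t(3) k(2) by simp
      show "\<exists>k\<ge>0. k \<le> H A \<and> k \<le> H B \<and> \<alpha> A + \<beta> A * k = \<alpha> B + \<beta> B * k"
      proof (cases "k \<ge> 0")
        case True then show ?thesis using kH eq by blast
      next
        case False
        \<comment> \<open>A common point in the added strip is possible only for a common base, and
          then the segments already meet at height \<open>0\<close>.\<close>
        have "\<alpha> A = \<alpha> B"
        proof (rule ccontr)
          assume ne: "\<alpha> A \<noteq> \<alpha> B"
          have *: "\<alpha> A - \<alpha> B = k * (\<beta> B - \<beta> A)" if "\<alpha> A + \<beta> A * k = \<alpha> B + \<beta> B * k"
            using that by (simp add: algebra_simps)
          have "\<bar>\<alpha> A - \<alpha> B\<bar> = \<bar>k\<bar> * \<bar>\<beta> A - \<beta> B\<bar>"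
            unfolding *[OF eq] abs_mult by (simp add: abs_minus_commute)
          also have "\<dots> \<le> \<epsilon> * \<bar>\<beta> A - \<beta> B\<bar>" using False k(1) by (intro mult_right_mono) auto
          finally show False using small[OF AB ne] by simp
        qed
        then show ?thesis using HA HB by (intro exI[of _ 0]) auto
      qed
    next
      fix k assume k: "0 \<le> k" "k \<le> H A" "k \<le> H B" "\<alpha> A + \<beta> A * k = \<alpha> B + \<beta> B * k"
      then have pos: "k + \<epsilon> > 0" using \<epsilon> by simp
      show "\<exists>t\<ge>1 / (H A + \<epsilon>). 1 / (H B + \<epsilon>) \<le> t \<and>
         \<beta> A + (\<alpha> A - \<beta> A * \<epsilon>) * t = \<beta> B + (\<alpha> B - \<beta> B * \<epsilon>) * t"
        using key[OF pos] k pos HA HB \<epsilon>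
        by (intro exI[of _ "1 / (k + \<epsilon>)"] conjI) (simp_all add: frac_le)
    qed
    also have "\<dots> \<longleftrightarrow> A \<inter> B \<noteq> {}"
      using gseg_Int_iff[of m c "\<alpha> A" "\<beta> A" "H A" "\<alpha> B" "\<beta> B" "H B"]
      by (simp add: par(2)[OF AB(1), symmetric] par(2)[OF AB(2), symmetric])
    finally show "h A \<inter> h B \<noteq> {} \<longleftrightarrow> A \<inter> B \<noteq> {}" .
  qed
qed

section \<open>Strict convexity of the disc and truncated rays\<close>

text \<open>Positive weight on one inner point pulls the combination off the circle. Many
  contradictions below consist in writing a point of the circle in this form.\<close>

lemma convex_combination_in_ball:
  fixes a b p c :: complex
  assumes "a \<in> cball c r" "b \<in> cball c r" "p \<in> ball c r"
    and w: "u \<ge> 0" "v \<ge> 0" "w > 0" "u + v + w = 1"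
  shows "u *\<^sub>R a + v *\<^sub>R b + w *\<^sub>R p \<in> ball c r"
proof -
  have w1: "w = 1 - u - v" using w by simp
  have "u *\<^sub>R a + v *\<^sub>R b + w *\<^sub>R p - c = u *\<^sub>R (a - c) + v *\<^sub>R (b - c) + w *\<^sub>R (p - c)"
    unfolding w1 by (simp add: algebra_simps)
  then have "norm (u *\<^sub>R a + v *\<^sub>R b + w *\<^sub>R p - c) \<le> u * norm (a - c) + v * norm (b - c) + w * norm (p - c)"
    using norm_triangle_ineq[of "u *\<^sub>R (a - c) + v *\<^sub>R (b - c)" "w *\<^sub>R (p - c)"]
      norm_triangle_ineq[of "u *\<^sub>R (a - c)" "v *\<^sub>R (b - c)"] w by simp
  also have "\<dots> < u * r + v * r + w * r"
    using assms by (intro add_le_less_mono add_mono mult_left_mono mult_strict_left_mono)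
      (auto simp: dist_norm norm_minus_commute)
  also have "\<dots> = r" using w(4) by (simp flip: distrib_right)
  finally show ?thesis by (simp add: dist_norm norm_minus_commute)
qed

lemma segment_in_ball:
  fixes a b :: complex
  assumes "a \<in> sphere x r" "b \<in> ball x r" "z \<in> closed_segment a b" "z \<noteq> a"
  shows "z \<in> ball x r"
proof -
  obtain u where u: "0 \<le> u" "u \<le> 1" "z = (1 - u) *\<^sub>R a + u *\<^sub>R b" using assms(3) unfolding in_segment by blast
  have "u > 0" using u assms(4) by (cases "u = 0") auto
  then have "(1 - u) *\<^sub>R a + 0 *\<^sub>R a + u *\<^sub>R b \<in> ball x r"
    using u assms(1,2) by (intro convex_combination_in_ball) auto
  then show ?thesis using u by simp
qed

text \<open>The intermediate value theorem gives an exit parameter, and convexity makes it the only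
  one: each earlier point of the half-line is a mixture of a point of the closed disc with the inner
  point \<open>b\<close>.\<close>

lemma convex_exit:
  fixes b w x :: complex
  assumes b: "b \<in> ball x R" and T1: "T1 > 0" "b + T1 *\<^sub>R w \<notin> cball x R"
  shows "\<exists>T>0. T < T1 \<and> b + T *\<^sub>R w \<in> sphere x R \<and>
    (\<forall>t\<ge>0. (t < T \<longrightarrow> b + t *\<^sub>R w \<in> ball x R) \<and> (t > T \<longrightarrow> b + t *\<^sub>R w \<notin> cball x R))"
proof -
  define f where "f t = norm (b + t *\<^sub>R w - x)" for t
  have f0: "f 0 < R" using b by (simp add: f_def dist_norm norm_minus_commute)
  have fT1: "f T1 > R" using T1 by (simp add: f_def dist_norm norm_minus_commute)
  have "\<exists>T. 0 \<le> T \<and> T \<le> T1 \<and> f T = R"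
    using f0 fT1 T1(1) by (intro IVT) (auto simp: f_def intro!: continuous_intros)
  then obtain T where T: "0 \<le> T" "T \<le> T1" "f T = R" by blast
  have Tpos: "T > 0" "T < T1" using T f0 fT1 by (auto simp: order_le_less)
  have conv: "f (l * t) < R" if "0 \<le> l" "l < 1" "f t \<le> R" for l t
  proof -
    have "l *\<^sub>R (b + t *\<^sub>R w) + 0 *\<^sub>R b + (1 - l) *\<^sub>R b \<in> ball x R"
      using that b by (intro convex_combination_in_ball) (auto simp: f_def dist_norm norm_minus_commute)
    moreover have "l *\<^sub>R (b + t *\<^sub>R w) + 0 *\<^sub>R b + (1 - l) *\<^sub>R b = b + (l * t) *\<^sub>R w"
      by (simp add: algebra_simps)
    ultimately show ?thesis by (simp add: f_def dist_norm norm_minus_commute)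
  qed
  have "f t < R" if "0 \<le> t" "t < T" for t
    using conv[of "t / T" T] that T Tpos by simp
  moreover have "f t > R" if "t > T" for t
    using conv[of "T / t" t] that T Tpos by (cases "f t \<le> R") auto
  moreover have "b + t *\<^sub>R w \<in> ball x R \<longleftrightarrow> f t < R" "b + t *\<^sub>R w \<in> cball x R \<longleftrightarrow> f t \<le> R"
    "b + t *\<^sub>R w \<in> sphere x R \<longleftrightarrow> f t = R" for t
    by (auto simp: f_def dist_norm norm_minus_commute)
  ultimately show ?thesis
    using Tpos T(3) by (intro exI[of _ T]) (simp add: not_le)
qed

lemma truncated_ray:
  assumes v: "v \<noteq> 0" and a: "norm a < R"
  shows "\<exists>T>0. norm (a + T *\<^sub>R v) = R \<and> ray_from a v \<inter> cball 0 R = closed_segment (a + T *\<^sub>R v) a"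
proof -
  \<comment> \<open>By the triangle inequality the point with this parameter lies outside the
    circle.\<close>
  define T1 where "T1 = (R + norm a + 1) / norm v"
  have "R > 0" using a norm_ge_zero[of a] by linarith
  then have T1: "T1 > 0" using v by (simp add: T1_def add_pos_nonneg)
  have "norm (T1 *\<^sub>R v) = R + norm a + 1" using v T1 by (simp add: T1_def \<open>R > 0\<close> abs_of_pos add_pos_nonneg)
  then have "norm (a + T1 *\<^sub>R v) > R" using norm_triangle_ineq2[of "T1 *\<^sub>R v" "- a"] by (simp add: add.commute)
  then obtain T where T: "T > 0" "norm (a + T *\<^sub>R v) = R"
    "\<And>t. t \<ge> 0 \<Longrightarrow> t < T \<Longrightarrow> norm (a + t *\<^sub>R v) < R" "\<And>t. t \<ge> 0 \<Longrightarrow> t > T \<Longrightarrow> norm (a + t *\<^sub>R v) > R"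
    using convex_exit[of a 0 R T1 v] a T1 unfolding mem_ball mem_cball mem_sphere dist_0_norm not_le
    by blast
  have "ray_from a v \<inter> cball 0 R = closed_segment a (a + T *\<^sub>R v)"
  proof (intro set_eqI iffI)
    fix z assume "z \<in> ray_from a v \<inter> cball 0 R"
    then obtain t where t: "t \<ge> 0" "z = a + t *\<^sub>R v" "norm z \<le> R" unfolding ray_from_def by auto
    then have "t \<le> T" using T(4)[of t] by (cases "t > T") auto
    then show "z \<in> closed_segment a (a + T *\<^sub>R v)"
      unfolding in_segment using t T(1) by (intro exI[of _ "t / T"]) (simp add: algebra_simps)
  next
    fix z assume "z \<in> closed_segment a (a + T *\<^sub>R v)"
    then obtain u where u: "0 \<le> u" "u \<le> 1" "z = (1 - u) *\<^sub>R a + u *\<^sub>R (a + T *\<^sub>R v)"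
      unfolding in_segment by blast
    then have z: "z = a + (u * T) *\<^sub>R v" by (simp add: algebra_simps)
    moreover have "u * T \<ge> 0" "u * T \<le> T" using u T(1) by (auto simp: mult_left_le_one_le)
    moreover have "norm z \<le> R" using z T(2) T(3)[of "u * T"] calculation(2,3) by (cases "u * T < T") (auto simp: order_le_less)
    ultimately show "z \<in> ray_from a v \<inter> cball 0 R" unfolding ray_from_def by auto
  qed
  then show ?thesis using T(1,2) by (intro exI[of _ T]) (simp add: closed_segment_commute)
qed

lemma outer_segmentI:
  assumes "a \<in> sphere x r" "b \<in> ball x r"
  shows "outer_segment x r (closed_segment a b)"
proof -
  have "open_segment a b \<subseteq> ball x r"
    using segment_in_ball[OF assms] by (auto simp: open_segment_def)
  then show ?thesis unfolding outer_segment_def using assms by (intro exI[of _ a] exI[of _ b]) auto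
qed

lemma downward_ray_graphs_subset_ray_graphs: "downward_ray_graphs \<subseteq> ray_graphs"
  unfolding downward_ray_graphs_def ray_graphs_def
proof (rule intersection_graph_class_mono)
  fix S assume "\<forall>A\<in>S. is_downward_ray A"
  then have "\<forall>A\<in>S. is_ray A" unfolding is_downward_ray_def is_ray_def by blast
  then show "\<exists>h. inj_on h S \<and> (\<forall>A\<in>h ` S. is_ray A) \<and>
      (\<forall>A\<in>S. \<forall>B\<in>S. A \<noteq> B \<longrightarrow> (h A \<inter> h B \<noteq> {} \<longleftrightarrow> A \<inter> B \<noteq> {}))"
    by (intro exI[of _ id]) simp
qed

text \<open>The two ends of a truncated ray are told apart by their distance from the center.\<close>

lemma truncated_ray_inj:
  assumes "v \<noteq> 0" "norm a < R" "v' \<noteq> 0" "norm a' < R"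
    and eq: "ray_from a v \<inter> cball 0 R = ray_from a' v' \<inter> cball 0 R"
  shows "ray_from a v = ray_from a' v'"
proof -
  obtain T where T: "T > 0" "norm (a + T *\<^sub>R v) = R" "ray_from a v \<inter> cball 0 R = closed_segment (a + T *\<^sub>R v) a"
    using truncated_ray assms by blast
  obtain T' where T': "T' > 0" "norm (a' + T' *\<^sub>R v') = R" "ray_from a' v' \<inter> cball 0 R = closed_segment (a' + T' *\<^sub>R v') a'"
    using truncated_ray assms by blast
  have "{a + T *\<^sub>R v, a} = {a' + T' *\<^sub>R v', a'}"
    using T(3) T'(3) eq closed_segment_eq by (metis (no_types, lifting))
  then have a: "a = a'" and "a + T *\<^sub>R v = a' + T' *\<^sub>R v'"
    using T(2) T'(2) assms(2,4) by (auto simp: doubleton_eq_iff)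
  then have TT: "T *\<^sub>R v = T' *\<^sub>R v'" by simp
  have "ray_from a v = ray_from a (T *\<^sub>R v)" if "T > 0" for T and v :: complex
  proof (intro set_eqI iffI)
    fix z assume "z \<in> ray_from a v"
    then obtain t where "t \<ge> 0" "z = a + t *\<^sub>R v" unfolding ray_from_def by blast
    then have "z = a + (t / T) *\<^sub>R (T *\<^sub>R v)" "t / T \<ge> 0" using that by auto
    then show "z \<in> ray_from a (T *\<^sub>R v)" unfolding ray_from_def by blast
  next
    fix z assume "z \<in> ray_from a (T *\<^sub>R v)"
    then obtain t where "t \<ge> 0" "z = a + t *\<^sub>R (T *\<^sub>R v)" unfolding ray_from_def by blast
    then have "z = a + (t * T) *\<^sub>R v" "t * T \<ge> 0" using that by auto
    then show "z \<in> ray_from a v" unfolding ray_from_def by blast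
  qed
  then show ?thesis using a TT T(1) T'(1) by metis
qed

lemma ray_graphs_subset_outer_segment_graphs: "ray_graphs \<subseteq> outer_segment_graphs"
  unfolding ray_graphs_def outer_segment_graphs_def
proof (rule intersection_graph_class_mono)
  fix S assume fin: "finite S" and S: "\<forall>A\<in>S. is_ray A"
  have "\<forall>A\<in>S. \<exists>x. snd x \<noteq> 0 \<and> A = ray_from (fst x) (snd x)"
    using S unfolding is_ray_def by fastforce
  then obtain y where y0: "\<forall>A\<in>S. snd (y A) \<noteq> 0 \<and> A = ray_from (fst (y A)) (snd (y A))"
    unfolding bchoice_iff by (elim exE)
  note y = bspec[OF y0]
  \<comment> \<open>Finitely many conditions on the radius: the disc contains every apex and one
    common point of each meeting pair.\<close>
  have ev: "\<forall>\<^sub>F R in at_top. norm (fst (y A)) < R \<and> (A \<inter> B \<noteq> {} \<longrightarrow> A \<inter> B \<inter> cball 0 R \<noteq> {})" for A B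
  proof (cases "A \<inter> B = {}")
    case True then show ?thesis using eventually_gt_at_top by simp
  next
    case False
    then obtain p where p: "p \<in> A" "p \<in> B" by blast
    show ?thesis
      using eventually_gt_at_top[of "norm (fst (y A))"] eventually_ge_at_top[of "norm p"]
    proof eventually_elim
      case (elim R)
      then have "p \<in> A \<inter> B \<inter> cball 0 R" using p by simp
      then show ?case using elim(1) by blast
    qed
  qed
  have "\<forall>\<^sub>F R in at_top. \<forall>A\<in>S. \<forall>B\<in>S. norm (fst (y A)) < R \<and> (A \<inter> B \<noteq> {} \<longrightarrow> A \<inter> B \<inter> cball 0 R \<noteq> {})"
    using fin ev by (intro eventually_ball_finite ballI)
  from eventually_happens'[OF trivial_limit_at_top_linorder eventually_conj[OF this eventually_gt_at_top[of 0]]]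
  obtain R where R1: "R > 0" and "\<forall>A\<in>S. \<forall>B\<in>S. norm (fst (y A)) < R \<and> (A \<inter> B \<noteq> {} \<longrightarrow> A \<inter> B \<inter> cball 0 R \<noteq> {})"
    by (elim exE conjE) (rule that)
  note R = R1 bspec[OF bspec[OF this(2)]]
  define h where "h A = A \<inter> cball 0 R" for A :: "complex set"
  show "\<exists>h. inj_on h S \<and> (\<exists>x r. r > 0 \<and> (\<forall>A\<in>h ` S. outer_segment x r A)) \<and>
      (\<forall>A\<in>S. \<forall>B\<in>S. A \<noteq> B \<longrightarrow> (h A \<inter> h B \<noteq> {} \<longleftrightarrow> A \<inter> B \<noteq> {}))"
  proof (intro exI[of _ h] conjI ballI impI)
    show "inj_on h S"
    proof (rule inj_onI)
      fix A B assume AB: "A \<in> S" "B \<in> S" "h A = h B"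
      have "ray_from (fst (y A)) (snd (y A)) = ray_from (fst (y B)) (snd (y B))"
        using AB(3) y[OF AB(1), THEN conjunct1] y[OF AB(2), THEN conjunct1]
          R(2)[OF AB(1) AB(1)] R(2)[OF AB(2) AB(2)]
        by (intro truncated_ray_inj[where R=R])
          (simp_all add: h_def y[OF AB(1), THEN conjunct2, symmetric] y[OF AB(2), THEN conjunct2, symmetric])
      then show "A = B"
        by (simp add: y[OF AB(1), THEN conjunct2, symmetric] y[OF AB(2), THEN conjunct2, symmetric])
    qed
    have "outer_segment 0 R (h A)" if A: "A \<in> S" for A
    proof -
      obtain T where "norm (fst (y A) + T *\<^sub>R snd (y A)) = R"
        "h A = closed_segment (fst (y A) + T *\<^sub>R snd (y A)) (fst (y A))"
        using truncated_ray[of "snd (y A)" "fst (y A)" R] y[OF A, THEN conjunct1] R(2)[OF A A]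
        by (auto simp: h_def y[OF A, THEN conjunct2, symmetric])
      then show ?thesis using R(2)[OF A A] outer_segmentI[of "fst (y A) + T *\<^sub>R snd (y A)" 0 R "fst (y A)"] by simp
    qed
    then show "\<exists>x r. r > 0 \<and> (\<forall>A\<in>h ` S. outer_segment x r A)" using R(1) by blast
    fix A B assume AB: "A \<in> S" "B \<in> S"
    have "h A \<inter> h B = A \<inter> B \<inter> cball 0 R" by (auto simp: h_def)
    then show "h A \<inter> h B \<noteq> {} \<longleftrightarrow> A \<inter> B \<noteq> {}" using R(2)[OF AB] by blast
  qed
qed

subsection \<open>Outer and grounded 1-strings\<close>

text \<open>The Moebius transformation that sends \<open>q\<close> to infinity, the center
  \<open>x\<close> to \<open>\<i>\<close> and the antipode of \<open>q\<close> to \<open>0\<close>.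
  For \<open>q\<close> on a circle around \<open>x\<close> it takes the closed disc without
  \<open>q\<close> to the closed upper half-plane, and \<open>unchart\<close> is its inverse
  there.\<close>

definition chart :: "complex \<Rightarrow> complex \<Rightarrow> complex \<Rightarrow> complex" where
  "chart x q z = \<i> * (z + q - 2 * x) / (q - z)"

definition unchart :: "complex \<Rightarrow> complex \<Rightarrow> complex \<Rightarrow> complex" where
  "unchart x q \<zeta> = x + (q - x) * (\<zeta> - \<i>) / (\<zeta> + \<i>)"

lemma plus_imaginary_unit_nonzero: "Im \<zeta> \<ge> 0 \<Longrightarrow> \<zeta> + \<i> \<noteq> 0"
proof
  assume "Im \<zeta> \<ge> 0" "\<zeta> + \<i> = 0"
  then have "Im (\<zeta> + \<i>) = 0" by simp
  then show False using \<open>Im \<zeta> \<ge> 0\<close> by simp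
qed

lemma unchart_chart:
  assumes "z \<noteq> q" "q \<noteq> x"
  shows "unchart x q (chart x q z) = z"
proof -
  have "chart x q z - \<i> = 2 * \<i> * (z - x) / (q - z)" "chart x q z + \<i> = 2 * \<i> * (q - x) / (q - z)"
    using assms by (simp_all add: chart_def field_simps)
  then show ?thesis using assms by (simp add: unchart_def)
qed

lemma
  assumes "Im \<zeta> \<ge> 0" "q \<noteq> x"
  shows chart_unchart: "chart x q (unchart x q \<zeta>) = \<zeta>" and unchart_neq: "unchart x q \<zeta> \<noteq> q"
proof -
  have nz: "\<zeta> + \<i> \<noteq> 0" using plus_imaginary_unit_nonzero assms by blast
  have 1: "q - unchart x q \<zeta> = (q - x) * (2 * \<i>) / (\<zeta> + \<i>)"
    using nz by (simp add: unchart_def field_simps)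
  have 2: "unchart x q \<zeta> + q - 2 * x = (q - x) * (2 * \<zeta>) / (\<zeta> + \<i>)"
    using nz by (simp add: unchart_def field_simps)
  show "unchart x q \<zeta> \<noteq> q" using 1 nz assms by auto
  have *: "\<i> * (A * (2 * \<zeta>) / D) / (A * (2 * \<i>) / D) = \<zeta>" if "A \<noteq> 0" "D \<noteq> 0" for A D
    using that by simp
  show "chart x q (unchart x q \<zeta>) = \<zeta>" unfolding chart_def 1 2 using nz assms by (intro *) auto
qed

text \<open>The numerator is, up to sign, the power of \<open>z\<close> with respect to the circle
  around \<open>x\<close> through \<open>q\<close>, so the sign of the imaginary part tells disc,
  circle and exterior apart.\<close>

lemma Im_chart:
  assumes "z \<noteq> q"
  shows "Im (chart x q z) = ((dist x q)\<^sup>2 - (dist x z)\<^sup>2) / (cmod (q - z))\<^sup>2"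
proof -
  have "Im (chart x q z) = Re ((z + q - 2 * x) / (q - z))" by (simp add: chart_def times_divide_eq_right[symmetric] del: times_divide_eq_right)
  also have "\<dots> = Re ((z + q - 2 * x) * cnj (q - z)) / (cmod (q - z))\<^sup>2"
    by (simp add: complex_div_cnj[of "z + q - 2 * x"] Re_divide_of_real del: complex_cnj_diff flip: of_real_power)
  also have "Re ((z + q - 2 * x) * cnj (q - z)) = (cmod (q - x))\<^sup>2 - (cmod (z - x))\<^sup>2"
    unfolding cmod_power2 by (simp add: algebra_simps power2_eq_square)
  finally show ?thesis by (simp add: dist_norm norm_minus_commute)
qed

lemma continuous_on_chart: "q \<notin> S \<Longrightarrow> continuous_on S (chart x q)"
  unfolding chart_def by (intro continuous_intros) auto

lemma continuous_on_unchart: "S \<subseteq> {\<zeta>. Im \<zeta> \<ge> 0} \<Longrightarrow> continuous_on S (unchart x q)"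
  unfolding unchart_def using plus_imaginary_unit_nonzero by (intro continuous_intros) auto

lemma inj_on_chart: "q \<notin> S \<Longrightarrow> q \<noteq> x \<Longrightarrow> inj_on (chart x q) S"
  by (rule inj_on_inverseI[of _ "unchart x q"]) (auto intro!: unchart_chart)

lemma inj_on_unchart: "S \<subseteq> {\<zeta>. Im \<zeta> \<ge> 0} \<Longrightarrow> q \<noteq> x \<Longrightarrow> inj_on (unchart x q) S"
  by (rule inj_on_inverseI[of _ "chart x q"]) (auto intro!: chart_unchart)

lemma Im_chart_pos_iff:
  assumes "z \<noteq> q" "q \<in> sphere x r"
  shows "Im (chart x q z) > 0 \<longleftrightarrow> z \<in> ball x r" "Im (chart x q z) = 0 \<longleftrightarrow> z \<in> sphere x r"
proof -
  have r: "r \<ge> 0" "dist x q = r" using assms(2) by auto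
  have "(cmod (q - z))\<^sup>2 > 0" using assms(1) by simp
  then have "Im (chart x q z) > 0 \<longleftrightarrow> (dist x z)\<^sup>2 < r\<^sup>2" "Im (chart x q z) = 0 \<longleftrightarrow> (dist x z)\<^sup>2 = r\<^sup>2"
    unfolding Im_chart[OF assms(1)] r(2) by (auto simp: zero_less_divide_iff)
  moreover have "(dist x z)\<^sup>2 < r\<^sup>2 \<longleftrightarrow> dist x z < r"
    using r(1) by (metis power2_less_imp_less power_strict_mono zero_le_dist zero_less_numeral)
  moreover have "(dist x z)\<^sup>2 = r\<^sup>2 \<longleftrightarrow> dist x z = r" using r(1) by (simp add: power2_eq_iff_nonneg)
  ultimately show "Im (chart x q z) > 0 \<longleftrightarrow> z \<in> ball x r" "Im (chart x q z) = 0 \<longleftrightarrow> z \<in> sphere x r" by auto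
qed

lemma unchart_mem:
  assumes "Im \<zeta> \<ge> 0" "q \<in> sphere x r" "r > 0"
  shows "unchart x q \<zeta> \<in> ball x r \<longleftrightarrow> Im \<zeta> > 0" "unchart x q \<zeta> \<in> sphere x r \<longleftrightarrow> Im \<zeta> = 0"
proof -
  have "q \<noteq> x" using assms by auto
  then show "unchart x q \<zeta> \<in> ball x r \<longleftrightarrow> Im \<zeta> > 0" "unchart x q \<zeta> \<in> sphere x r \<longleftrightarrow> Im \<zeta> = 0"
    using Im_chart_pos_iff[of "unchart x q \<zeta>" q x r] unchart_neq[of \<zeta> q x] chart_unchart[of \<zeta> q x] assms by auto
qed

lemma arc_injective_image:
  assumes "arc g" "continuous_on U h" "inj_on h U" "path_image g \<subseteq> U"
  shows "arc (h \<circ> g)"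
  using assms unfolding arc_def path_image_def
  by (auto intro!: path_continuous_image comp_inj_on simp: path_image_def elim: continuous_on_subset inj_on_subset)

lemma one_strings_image:
  assumes S: "one_strings S" and h: "continuous_on U h" "inj_on h U" and sub: "\<And>A. A \<in> S \<Longrightarrow> A \<subseteq> U"
  shows "one_strings ((`) h ` S)"
proof -
  have Int: "h ` A \<inter> h ` B = h ` (A \<inter> B)" if "A \<in> S" "B \<in> S" for A B
    using inj_on_image_Int[OF h(2) sub sub] that by simp
  have 1: "\<exists>g. arc g \<and> h ` A = path_image g" if A: "A \<in> S" for A
  proof -
    obtain g where "arc g" "A = path_image g" 
      using S[unfolded one_strings_def, THEN conjunct1] A by blast
    then show ?thesis
      using arc_injective_image[OF _ h, of g] sub[OF A] by (intro exI[of _ "h \<circ> g"]) (simp add: path_image_compose)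
  qed
  have 2: "\<exists>p. h ` A \<inter> h ` B \<subseteq> {p}" if AB: "A \<in> S" "B \<in> S" "h ` A \<noteq> h ` B" for A B
  proof -
    have "A \<noteq> B" using AB(3) by auto
    then obtain p where "A \<inter> B \<subseteq> {p}"
      using S[unfolded one_strings_def, THEN conjunct2, THEN conjunct1] AB(1,2) by meson
    then have "h ` (A \<inter> B) \<subseteq> {h p}" by blast
    then show ?thesis using Int[OF AB(1,2)] by auto
  qed
  have 3: "h ` A \<inter> h ` B \<inter> h ` C = {}"
    if ABC: "A \<in> S" "B \<in> S" "C \<in> S" "h ` A \<noteq> h ` B" "h ` A \<noteq> h ` C" "h ` B \<noteq> h ` C" for A B C
  proof -
    have "A \<noteq> B \<and> A \<noteq> C \<and> B \<noteq> C" using ABC(4-6) by auto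
    then have "A \<inter> B \<inter> C = {}"
      using S[unfolded one_strings_def, THEN conjunct2, THEN conjunct2] ABC(1-3) by simp
    moreover have "h ` A \<inter> h ` B \<inter> h ` C = h ` (A \<inter> B \<inter> C)"
      using Int[OF ABC(1,2)] inj_on_image_Int[OF h(2), of "A \<inter> B" C] sub ABC(1-3) by auto
    ultimately show ?thesis by simp
  qed
  show ?thesis
    unfolding one_strings_def
  proof (intro conjI ballI impI)
    fix A assume "A \<in> (`) h ` S"
    then obtain A' where A: "A' \<in> S" "A = h ` A'" by blast
    show "\<exists>g. arc g \<and> A = path_image g" unfolding A(2) by (rule 1[OF A(1)])
    fix B assume "B \<in> (`) h ` S"
    then obtain B' where B: "B' \<in> S" "B = h ` B'" by blast
    show "\<exists>p. A \<inter> B \<subseteq> {p}" if "A \<noteq> B" using 2[OF A(1) B(1)] that unfolding A(2) B(2) .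
    fix C assume "C \<in> (`) h ` S"
    then obtain C' where C: "C' \<in> S" "C = h ` C'" by blast
    show "A \<inter> B \<inter> C = {}" if "A \<noteq> B \<and> A \<noteq> C \<and> B \<noteq> C"
      using 3[OF A(1) B(1) C(1)] that unfolding A(2) B(2) C(2) by blast
  qed
qed

text \<open>Supplies a point of the circle that avoids finitely many base points; such a point can
  be sent to infinity.\<close>

lemma infinite_sphere:
  fixes x :: complex
  assumes "r > 0"
  shows "infinite (sphere x r)"
proof
  assume "finite (sphere x r)"
  moreover have "Topological_Spaces.connected (sphere x r)" by (simp add: connected_sphere)
  ultimately have "sphere x r = {} \<or> (\<exists>a. sphere x r = {a})" using connected_finite_iff_sing by blast
  moreover have "x + of_real r \<in> sphere x r" "x - of_real r \<in> sphere x r" using assms by (auto simp: dist_norm)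
  moreover have "x + of_real r \<noteq> x - of_real r"
    using assms by (auto simp: complex_eq_iff)
  ultimately show False by (metis empty_iff singletonD)
qed

lemma outer_string_sphere:
  assumes "outer_string x r A"
  shows "\<exists>b. A \<inter> sphere x r = {b}" "A \<subseteq> cball x r"
proof -
  obtain g where g: "A = path_image g" "pathstart g \<in> sphere x r" "A - {pathstart g} \<subseteq> ball x r"
    using assms unfolding outer_string_def by blast
  then have "pathstart g \<in> A" using pathstart_in_path_image by blast
  then show "\<exists>b. A \<inter> sphere x r = {b}" using g by (intro exI[of _ "pathstart g"]) auto
  show "A \<subseteq> cball x r" using g(2,3) by (auto simp: less_imp_le)
qed

lemma outer_1_string_graphs_subset_grounded_1_string_graphs:
  "outer_1_string_graphs \<subseteq> grounded_1_string_graphs"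
  unfolding outer_1_string_graphs_def grounded_1_string_graphs_def
proof (rule intersection_graph_class_mono)
  fix S assume fin: "finite S" and *: "one_strings S \<and> (\<exists>x r. r > 0 \<and> (\<forall>A\<in>S. outer_string x r A))"
  then obtain x r where S: "one_strings S" and r: "r > 0" and out: "\<And>A. A \<in> S \<Longrightarrow> outer_string x r A" by blast
  have "finite (\<Union>A\<in>S. A \<inter> sphere x r)"
    using fin out outer_string_sphere by (metis finite_UN_I finite.emptyI finite.insertI)
  moreover have "infinite (sphere x r)"
    using infinite_sphere r by blast
  \<comment> \<open>Strings touch the circle only in their bases, so a point \<open>q\<close> of the
    circle off all bases is off all strings, and the chart is defined on them.\<close>
  ultimately obtain q where q: "q \<in> sphere x r" "q \<notin> (\<Union>A\<in>S. A \<inter> sphere x r)"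
    by (meson finite_subset subsetI)
  then have qA: "q \<notin> A" if "A \<in> S" for A using that by blast
  define U where "U = - {q}"
  have AU: "A \<subseteq> U" if "A \<in> S" for A using qA[OF that] by (auto simp: U_def)
  have qx: "q \<noteq> x" using q(1) r by auto
  have h: "continuous_on U (chart x q)" "inj_on (chart x q) U"
    using qx by (auto simp: U_def intro!: continuous_on_chart inj_on_chart)
  let ?h = "(`) (chart x q)"
  have gr: "grounded_string 0 0 (?h A)" if A: "A \<in> S" for A
  proof -
    obtain g where g: "arc g" "A = path_image g" "pathstart g \<in> sphere x r" "A - {pathstart g} \<subseteq> ball x r"
      using out[OF A] unfolding outer_string_def by blast
    have "arc (chart x q \<circ> g)" using arc_injective_image[OF g(1) h] AU[OF A] g(2) by simp
    moreover have "?h A = path_image (chart x q \<circ> g)" by (simp add: g(2) path_image_compose)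
    moreover have ps: "pathstart g \<in> A" unfolding g(2) by (rule pathstart_in_path_image)
    have nq: "z \<noteq> q" if "z \<in> A" for z using that qA[OF A] by blast
    have "Im (chart x q (pathstart g)) = 0" using Im_chart_pos_iff(2)[OF nq[OF ps] q(1)] g(3) by simp
    then have "pathstart (chart x q \<circ> g) \<in> ground_line 0 0"
      by (simp add: ground_line_def pathstart_compose)
    moreover have "?h A - {pathstart (chart x q \<circ> g)} \<subseteq> above_line 0 0"
    proof
      fix z assume "z \<in> ?h A - {pathstart (chart x q \<circ> g)}"
      then obtain y where y: "y \<in> A" "z = chart x q y" "y \<noteq> pathstart g" by (auto simp: pathstart_compose)
      then have "y \<in> ball x r" using g(4) by blast
      then show "z \<in> above_line 0 0"
        using Im_chart_pos_iff(1)[OF nq[OF y(1)] q(1)] y(2) by (simp add: above_line_def)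
    qed
    ultimately show ?thesis unfolding grounded_string_def by blast
  qed
  show "\<exists>h. inj_on h S \<and> (one_strings (h ` S) \<and> (\<exists>m c. \<forall>A\<in>h ` S. grounded_string m c A)) \<and>
      (\<forall>A\<in>S. \<forall>B\<in>S. A \<noteq> B \<longrightarrow> (h A \<inter> h B \<noteq> {} \<longleftrightarrow> A \<inter> B \<noteq> {}))"
  proof (intro exI[of _ ?h] conjI ballI impI)
    show "inj_on ?h S"
      by (rule inj_onI) (use inj_on_image_eq_iff[OF h(2)] AU in blast)
    show "one_strings (?h ` S)" using one_strings_image[OF S h AU] .
    show "\<exists>m c. \<forall>A\<in>?h ` S. grounded_string m c A" using gr by blast
    fix A B assume "A \<in> S" "B \<in> S"
    then show "?h A \<inter> ?h B \<noteq> {} \<longleftrightarrow> A \<inter> B \<noteq> {}"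
      using inj_on_image_Int[OF h(2) AU AU, of A B] by auto
  qed
qed

lemma grounded_1_string_graphs_subset_outer_1_string_graphs:
  "grounded_1_string_graphs \<subseteq> outer_1_string_graphs"
  unfolding outer_1_string_graphs_def grounded_1_string_graphs_def
proof (rule intersection_graph_class_mono)
  fix S assume fin: "finite S" and *: "one_strings S \<and> (\<exists>m c. \<forall>A\<in>S. grounded_string m c A)"
  then obtain m c where S: "one_strings S" and out: "\<And>A. A \<in> S \<Longrightarrow> grounded_string m c A" by blast
  \<comment> \<open>A shear first turns the grounding line into the real axis; then the half-plane
    goes to the unit disc and the axis to the unit circle without the point 1.\<close>
  define k where "k z = unchart 0 1 (Complex (Re z) (Im z - m * Re z - c))" for z
  define U where "U = {z. Im z \<ge> m * Re z + c}"
  have AU: "A \<subseteq> U" if A: "A \<in> S" for A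
    using out[OF A] unfolding grounded_string_def ground_line_def above_line_def U_def by fastforce
  have "continuous_on U (unchart 0 1 \<circ> (\<lambda>z. Complex (Re z) (Im z - m * Re z - c)))"
    by (intro continuous_on_compose continuous_on_unchart)
      (auto simp: U_def Complex_eq intro!: continuous_intros)
  moreover have "inj_on (unchart 0 1 \<circ> (\<lambda>z. Complex (Re z) (Im z - m * Re z - c))) U"
    by (intro comp_inj_on inj_on_unchart) (auto simp: U_def inj_on_def complex_eq_iff)
  ultimately have h: "continuous_on U k" "inj_on k U" by (simp_all add: k_def[abs_def] comp_def)
  let ?h = "(`) k"
  have gr: "outer_string 0 1 (?h A)" if A: "A \<in> S" for A
  proof -
    obtain g where g: "arc g" "A = path_image g" "pathstart g \<in> ground_line m c" "A - {pathstart g} \<subseteq> above_line m c"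
      using out[OF A] unfolding grounded_string_def by blast
    have "arc (k \<circ> g)" using arc_injective_image[OF g(1) h] AU[OF A] g(2) by simp
    moreover have "?h A = path_image (k \<circ> g)" by (simp add: g(2) path_image_compose)
    moreover have "pathstart (k \<circ> g) \<in> sphere 0 1"
      unfolding pathstart_compose k_def using g(3) by (subst unchart_mem) (auto simp: ground_line_def)
    moreover have "?h A - {pathstart (k \<circ> g)} \<subseteq> ball 0 1"
    proof
      fix z assume "z \<in> ?h A - {pathstart (k \<circ> g)}"
      then obtain y where y: "y \<in> A" "z = k y" "y \<noteq> pathstart g" by (auto simp: pathstart_compose)
      then have "y \<in> above_line m c" using g(4) by blast
      then show "z \<in> ball 0 1"
        unfolding y(2) k_def by (subst unchart_mem) (auto simp: above_line_def)
    qed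
    ultimately show ?thesis unfolding outer_string_def by blast
  qed
  show "\<exists>h. inj_on h S \<and> (one_strings (h ` S) \<and> (\<exists>x r. r > 0 \<and> (\<forall>A\<in>h ` S. outer_string x r A))) \<and>
      (\<forall>A\<in>S. \<forall>B\<in>S. A \<noteq> B \<longrightarrow> (h A \<inter> h B \<noteq> {} \<longleftrightarrow> A \<inter> B \<noteq> {}))"
  proof (intro exI[of _ ?h] conjI ballI impI)
    show "inj_on ?h S"
      by (rule inj_onI) (use inj_on_image_eq_iff[OF h(2)] AU in blast)
    show "one_strings (?h ` S)" using one_strings_image[OF S h AU] .
    show "\<exists>x r. r > 0 \<and> (\<forall>A\<in>?h ` S. outer_string x r A)"
      using gr by (intro exI[of _ 0] exI[of _ 1]) auto
    fix A B assume "A \<in> S" "B \<in> S"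
    then show "?h A \<inter> ?h B \<noteq> {} \<longleftrightarrow> A \<inter> B \<noteq> {}"
      using inj_on_image_Int[OF h(2) AU AU, of A B] by auto
  qed
qed

subsection \<open>Circle coordinates\<close>

definition cross :: "complex \<Rightarrow> complex \<Rightarrow> real" where
  "cross u v = Re u * Im v - Im u * Re v"

definition orient :: "complex \<Rightarrow> complex \<Rightarrow> complex \<Rightarrow> real" where
  "orient a b c = cross (b - a) (c - a)"

lemma cross_eq_Im: "cross u v = Im (cnj u * v)"
  by (simp add: cross_def)

text \<open>On the reals \<open>unchart\<close> is a rational parametrization of the circle, and the
  difference of two values contains the difference of the parameters as a factor. The orientation of
  three circle points is therefore a Vandermonde product up to a nonnegative factor, positive for
  \<open>q \<noteq> x\<close>, and can be read off from the order of three reals.\<close>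

lemma orient_unchart:
  fixes s t u :: real
  shows "orient (unchart x q s) (unchart x q t) (unchart x q u) =
    4 * (cmod (q - x))\<^sup>2 * ((t - s) * (u - s) * (u - t)) / ((1 + s\<^sup>2) * (1 + t\<^sup>2) * (1 + u\<^sup>2))"
proof -
  have nz: "complex_of_real a + \<i> \<noteq> 0" "complex_of_real a - \<i> \<noteq> 0" for a
    by (auto simp: complex_eq_iff)
  have dif: "unchart x q b - unchart x q a = (q - x) * (2 * \<i> * of_real (b - a)) / ((of_real b + \<i>) * (of_real a + \<i>))"
    for a b :: real
    using nz[of a] nz[of b] by (simp add: unchart_def field_simps)
  have sq: "(of_real a + \<i>) * (of_real a - \<i>) = of_real (1 + a\<^sup>2)" for a
    by (simp add: complex_eq_iff power2_eq_square)
  have pos: "1 + a\<^sup>2 > 0" for a :: real by (simp add: add_pos_nonneg)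
  define E where "E = (cmod (q - x))\<^sup>2"
  have E: "(q - x) * cnj (q - x) = of_real E" unfolding E_def by (rule complex_norm_square[symmetric])
  \<comment> \<open>Conjugate factors are inserted so that every denominator becomes a product of
    the positive reals \<open>1 + a\<^sup>2\<close>.\<close>
  have *: "F * (4 * X * Y) / ((T' * S') * (V * W)) = (4 * F * X * Y) * (T * V') / ((T * T') * (W * S') * (V * V'))"
    if "T \<noteq> 0" "T' \<noteq> 0" "S' \<noteq> 0" "V \<noteq> 0" "V' \<noteq> 0" "W \<noteq> 0" for F X Y T T' S' V V' W :: complex
    using that by (simp add: field_simps)
  have "cnj (unchart x q t - unchart x q s) * (unchart x q u - unchart x q s) =
     ((q - x) * cnj (q - x)) * (4 * of_real (t - s) * of_real (u - s)) /
     (((of_real t - \<i>) * (of_real s - \<i>)) * ((of_real u + \<i>) * (of_real s + \<i>)))"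
    unfolding dif by (simp add: mult_ac) (simp add: algebra_simps)
  also have "\<dots> = of_real (4 * E * (t - s) * (u - s)) * ((of_real t + \<i>) * (of_real u - \<i>)) /
     (((of_real t + \<i>) * (of_real t - \<i>)) * ((of_real s + \<i>) * (of_real s - \<i>)) * ((of_real u + \<i>) * (of_real u - \<i>)))"
    unfolding E of_real_mult of_real_numeral by (intro *) (use nz in auto)
  also have "\<dots> = of_real (4 * E * (t - s) * (u - s) / ((1 + t\<^sup>2) * (1 + s\<^sup>2) * (1 + u\<^sup>2))) * ((of_real t + \<i>) * (of_real u - \<i>))"
    unfolding sq by simp
  finally have "Im (cnj (unchart x q t - unchart x q s) * (unchart x q u - unchart x q s)) =
     4 * E * (t - s) * (u - s) / ((1 + t\<^sup>2) * (1 + s\<^sup>2) * (1 + u\<^sup>2)) * (u - t)"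
    by simp
  then show ?thesis unfolding orient_def cross_eq_Im E_def by (simp add: mult_ac)
qed

text \<open>The factor \<open>1 + s * t\<close> vanishes exactly for antipodal points. For
  \<open>s < t\<close> it is negative when the arc over the interval from \<open>s\<close> to
  \<open>t\<close> exceeds a half turn, and positive when this arc is shorter.\<close>

lemma cross_unchart:
  fixes s t :: real
  shows "cross (unchart x q s - x) (unchart x q t - x) =
    2 * (cmod (q - x))\<^sup>2 * ((1 + s * t) * (t - s)) / ((1 + s\<^sup>2) * (1 + t\<^sup>2))"
proof -
  have nz: "complex_of_real a + \<i> \<noteq> 0" "complex_of_real a - \<i> \<noteq> 0" for a
    by (auto simp: complex_eq_iff)
  have sq: "(of_real a + \<i>) * (of_real a - \<i>) = of_real (1 + a\<^sup>2)" for a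
    by (simp add: complex_eq_iff power2_eq_square)
  define E where "E = (cmod (q - x))\<^sup>2"
  have E: "(q - x) * cnj (q - x) = of_real E" unfolding E_def by (rule complex_norm_square[symmetric])
  have *: "F * (A * B) / (A' * B') = F * (A * B)\<^sup>2 / ((A * A') * (B' * B))"
    if "A \<noteq> 0" "B \<noteq> 0" "A' \<noteq> 0" "B' \<noteq> 0" for F A B A' B' :: complex
    using that by (simp add: field_simps power2_eq_square)
  have "cnj (unchart x q s - x) * (unchart x q t - x) =
     ((q - x) * cnj (q - x)) * ((of_real s + \<i>) * (of_real t - \<i>)) / ((of_real s - \<i>) * (of_real t + \<i>))"
    unfolding unchart_def by (simp add: mult_ac)
  also have "\<dots> = of_real E * ((of_real s + \<i>) * (of_real t - \<i>))\<^sup>2 /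
     (((of_real s + \<i>) * (of_real s - \<i>)) * ((of_real t + \<i>) * (of_real t - \<i>)))"
    unfolding E by (intro *) (use nz in auto)
  also have "\<dots> = of_real (E / ((1 + s\<^sup>2) * (1 + t\<^sup>2))) * ((of_real s + \<i>) * (of_real t - \<i>))\<^sup>2"
    unfolding sq by simp
  finally have "Im (cnj (unchart x q s - x) * (unchart x q t - x)) =
      E / ((1 + s\<^sup>2) * (1 + t\<^sup>2)) * Im (((of_real s + \<i>) * (of_real t - \<i>))\<^sup>2)"
    by simp
  also have "Im (((of_real s + \<i>) * (of_real t - \<i>))\<^sup>2) = 2 * ((1 + s * t) * (t - s))"
    by (simp add: power2_eq_square algebra_simps)
  finally show ?thesis unfolding cross_eq_Im E_def by simp
qed

text \<open>The only topological input of the non-representability proofs.\<close>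

lemma half_plane_interlace:
  fixes U W :: "complex set" and t1 t2 t3 t4 :: real
  assumes U: "path_connected U" "U \<subseteq> {z. Im z \<ge> 0}" "of_real t1 \<in> U" "of_real t3 \<in> U"
    and W: "path_connected W" "W \<subseteq> {z. Im z \<ge> 0}" "of_real t2 \<in> W" "of_real t4 \<in> W"
    and t: "t1 < t2" "t2 < t3" "t3 < t4"
  shows "U \<inter> W \<noteq> {}"
proof -
  obtain f where f: "path f" "path_image f \<subseteq> U" "pathstart f = of_real t1" "pathfinish f = of_real t3"
    using U unfolding path_connected_def by blast
  obtain g where g: "path g" "path_image g \<subseteq> W" "pathstart g = of_real t2" "pathfinish g = of_real t4"
    using W unfolding path_connected_def by blast
  have "bounded (path_image f \<union> path_image g)"
    using f(1) g(1) by (simp add: bounded_path_image)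
  then obtain M where M: "\<And>z. z \<in> path_image f \<union> path_image g \<Longrightarrow> cmod z \<le> M"
    unfolding bounded_iff by blast
  \<comment> \<open>The interlacing theorem for paths in a rectangle is stated for
    \<open>real^2\<close>. Here the bottom edge of the rectangle lies on the real axis and carries
    the four ends.\<close>
  define \<psi> :: "complex \<Rightarrow> real^2" where "\<psi> z = (\<chi> i. if i = 1 then Re z else Im z)" for z
  have \<psi>: "\<psi> z $ 1 = Re z" "\<psi> z $ 2 = Im z" for z by (simp_all add: \<psi>_def)
  have "continuous_on X (\<lambda>z. if i = (1::2) then Re z else Im z)" for X i
    by (cases "i = 1") (auto intro!: continuous_intros)
  then have cont: "continuous_on X \<psi>" for X
    unfolding \<psi>_def by (intro continuous_on_vec_lambda)
  have box: "\<psi> z \<in> cbox (vector [- M, 0]) (vector [M, M])"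
    if "z \<in> path_image f \<union> path_image g" for z
  proof -
    have "Im z \<ge> 0" using that f(2) g(2) U(2) W(2) by blast
    then show ?thesis
      using M[OF that] abs_Re_le_cmod[of z] abs_Im_le_cmod[of z]
      by (auto simp: mem_box_cart forall_2 \<psi>)
  qed
  obtain z where "z \<in> path_image (\<psi> \<circ> f)" "z \<in> path_image (\<psi> \<circ> g)"
  proof (rule fashoda_interlace[of "\<psi> \<circ> f" "\<psi> \<circ> g" "vector [- M, 0]" "vector [M, M]"])
    show "path (\<psi> \<circ> f)" "path (\<psi> \<circ> g)" using f(1) g(1) cont by (auto intro: path_continuous_image)
    show "path_image (\<psi> \<circ> f) \<subseteq> cbox (vector [- M, 0]) (vector [M, M])"
      "path_image (\<psi> \<circ> g) \<subseteq> cbox (vector [- M, 0]) (vector [M, M])"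
      using box by (auto simp: path_image_compose)
  qed (use f(3,4) g(3,4) t in \<open>auto simp: pathstart_compose pathfinish_compose \<psi>\<close>)
  then obtain z1 z2 where z: "z1 \<in> path_image f" "z2 \<in> path_image g" "\<psi> z1 = \<psi> z2"
    by (auto simp: path_image_compose)
  then have "z1 = z2" using \<psi> by (metis complex_eqI)
  then show ?thesis using z f(2) g(2) by blast
qed

lemma circle_interlace:
  fixes t1 t2 t3 t4 :: real
  assumes q: "q \<in> sphere x r" "r > 0"
    and U: "path_connected U" "U \<subseteq> cball x r - {q}" "unchart x q t1 \<in> U" "unchart x q t3 \<in> U"
    and W: "path_connected W" "W \<subseteq> cball x r - {q}" "unchart x q t2 \<in> W" "unchart x q t4 \<in> W"
    and t: "t1 < t2" "t2 < t3" "t3 < t4"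
  shows "U \<inter> W \<noteq> {}"
proof -
  have qx: "q \<noteq> x" using q by auto
  have c: "path_connected (chart x q ` V) \<and> chart x q ` V \<subseteq> {z. Im z \<ge> 0}"
    if "path_connected V" "V \<subseteq> cball x r - {q}" for V
  proof
    show "path_connected (chart x q ` V)"
      using that by (intro path_connected_continuous_image continuous_on_chart) auto
    show "chart x q ` V \<subseteq> {z. Im z \<ge> 0}"
    proof clarsimp
      fix z assume z: "z \<in> V"
      then have "z \<noteq> q" "z \<in> ball x r \<or> z \<in> sphere x r" using that(2) by (auto simp: order_le_less)
      then show "Im (chart x q z) \<ge> 0"
        using Im_chart_pos_iff[of z q x r] q(1) by auto
    qed
  qed
  have m: "of_real t \<in> chart x q ` V" if "unchart x q t \<in> V" for t :: real and V
  proof -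
    have "chart x q (unchart x q t) = t" by (rule chart_unchart) (use qx in auto)
    then show ?thesis using that by (metis image_eqI)
  qed
  have "chart x q ` U \<inter> chart x q ` W \<noteq> {}"
    by (rule half_plane_interlace[of _ t1 t3 _ t2 t4]) (use c U W m t in auto)
  moreover have "chart x q ` U \<inter> chart x q ` W = chart x q ` (U \<inter> W)"
    using inj_on_image_Int[OF inj_on_chart[of q "- {q}" x], of U W] qx U(2) W(2) by auto
  ultimately show ?thesis by auto
qed

subsection \<open>Crossings of outer segments\<close>

text \<open>In barycentric coordinates with respect to \<open>b1\<close>, \<open>b2\<close>,
  \<open>p\<close>, strict convexity gives \<open>bX\<close> positive weights at \<open>b1\<close>
  and \<open>b2\<close> and a negative one at \<open>p\<close>. At \<open>x\<close> the weight of
  \<open>b1\<close> is \<open>1 - \<xi> < 0\<close>, so the segment from \<open>bX\<close> to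
  \<open>x\<close> crosses the line through \<open>b2\<close> and \<open>p\<close>; convexity again
  keeps the crossing point between these two.\<close>

lemma segment_beyond_crossing:
  assumes b: "b1 \<in> sphere c r" "b2 \<in> sphere c r" "bX \<in> sphere c r" "b1 \<noteq> b2" and p: "p \<in> ball c r"
    and x: "x = b1 + \<xi> *\<^sub>R (p - b1)" "\<xi> > 1" "x \<in> cball c r"
    and side: "orient b1 b2 p * orient b1 b2 bX \<le> 0" "orient b1 b2 bX \<noteq> 0"
  shows "closed_segment bX x \<inter> closed_segment b2 p \<noteq> {}"
proof (cases "orient b1 b2 p = 0")
  case True
  \<comment> \<open>If \<open>p\<close> lies on the line through the bases, the endpoint
    \<open>x\<close> itself lies between \<open>p\<close> and \<open>b2\<close>.\<close>
  define \<kappa> where "\<kappa> = Re ((p - b1) / (b2 - b1))"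
  have "Im ((p - b1) / (b2 - b1)) = 0"
    using True by (simp add: orient_def cross_def Im_divide algebra_simps)
  then have "(p - b1) / (b2 - b1) = of_real \<kappa>" by (simp add: \<kappa>_def complex_eq_iff)
  then have "p - b1 = \<kappa> *\<^sub>R (b2 - b1)" using b(4) by (simp add: field_simps scaleR_conv_of_real)
  then have p_eq: "p = b1 + \<kappa> *\<^sub>R (b2 - b1)" by (simp add: algebra_simps)
  have pos: "\<kappa> > 0"
  proof (rule ccontr)
    assume "\<not> \<kappa> > 0"
    define k where "k = 1 - \<kappa>"
    have k: "k \<ge> 1" using \<open>\<not> \<kappa> > 0\<close> by (simp add: k_def)
    have "b1 = ((k - 1) / k) *\<^sub>R b2 + 0 *\<^sub>R b2 + (1 / k) *\<^sub>R p"
    proof -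
      have "k *\<^sub>R b1 = (k - 1) *\<^sub>R b2 + p" unfolding p_eq k_def by (simp add: algebra_simps)
      then have "(1 / k) *\<^sub>R (k *\<^sub>R b1) = (1 / k) *\<^sub>R ((k - 1) *\<^sub>R b2 + p)" by simp
      then show ?thesis using k by (simp add: scaleR_right_distrib)
    qed
    also have "\<dots> \<in> ball c r"
      using k b p by (intro convex_combination_in_ball) (auto simp: field_simps)
    finally show False using b(1) by simp
  qed
  have x_eq: "x = b1 + (\<xi> * \<kappa>) *\<^sub>R (b2 - b1)" unfolding x(1) p_eq by simp
  \<comment> \<open>If \<open>x\<close> lay beyond \<open>b2\<close>, then \<open>b2\<close> would
    lie between \<open>b1\<close> and \<open>p\<close> or between \<open>p\<close> and
    \<open>x\<close>, hence inside the disc.\<close>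
  have le: "\<xi> * \<kappa> \<le> 1"
  proof (rule ccontr)
    define k where "k = \<xi> * \<kappa>"
    assume "\<not> \<xi> * \<kappa> \<le> 1"
    then have k: "k > 1" by (simp add: k_def)
    have ll: "\<kappa> < k" using pos x(2) by (simp add: k_def)
    show False
    proof (cases "\<kappa> \<ge> 1")
      case True
      then have "b2 = ((\<kappa> - 1) / \<kappa>) *\<^sub>R b1 + 0 *\<^sub>R b1 + (1 / \<kappa>) *\<^sub>R p"
        unfolding p_eq by (simp add: complex_eq_iff field_simps)
      also have "\<dots> \<in> ball c r"
        using True b p by (intro convex_combination_in_ball) (auto simp: field_simps)
      finally show False using b(2) by simp
    next
      case False
      have "b2 = ((1 - \<kappa>) / (k - \<kappa>)) *\<^sub>R x + 0 *\<^sub>R x + ((k - 1) / (k - \<kappa>)) *\<^sub>R p"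
      proof -
        have "(k - \<kappa>) *\<^sub>R b2 = (1 - \<kappa>) *\<^sub>R x + (k - 1) *\<^sub>R p"
          unfolding p_eq x_eq k_def[symmetric] by (simp add: complex_eq_iff algebra_simps)
        then have "(1 / (k - \<kappa>)) *\<^sub>R ((k - \<kappa>) *\<^sub>R b2) = (1 / (k - \<kappa>)) *\<^sub>R ((1 - \<kappa>) *\<^sub>R x + (k - 1) *\<^sub>R p)"
          by simp
        then show ?thesis using ll by (simp add: scaleR_right_distrib)
      qed
      also have "\<dots> \<in> ball c r"
      proof (rule convex_combination_in_ball)
        show "(1 - \<kappa>) / (k - \<kappa>) + 0 + (k - 1) / (k - \<kappa>) = 1" using ll by (simp flip: add_divide_distrib)
      qed (use False k ll p x(3) in auto)
      finally show False using b(2) by simp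
    qed
  qed
  have "x \<in> closed_segment b2 p"
  proof -
    have l1: "\<kappa> < 1" using le x(2) pos by (metis less_le_not_le less_le_trans mult.left_neutral mult_less_cancel_right not_le)
    define s where "s = (1 - \<xi> * \<kappa>) / (1 - \<kappa>)"
    have s: "s * (1 - \<kappa>) = 1 - \<xi> * \<kappa>" using l1 by (simp add: s_def)
    have "\<xi> * \<kappa> \<ge> \<kappa>" using x(2) pos by simp
    then have "0 \<le> s" "s \<le> 1" using l1 le by (auto simp: s_def)
    moreover have "x = (1 - s) *\<^sub>R b2 + s *\<^sub>R p"
    proof -
      have "(1 - s) *\<^sub>R b2 + s *\<^sub>R p = b2 + (s * (1 - \<kappa>)) *\<^sub>R (b1 - b2)"
        unfolding p_eq by (simp add: complex_eq_iff algebra_simps)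
      then show ?thesis unfolding s x_eq by (simp add: complex_eq_iff algebra_simps)
    qed
    ultimately show ?thesis unfolding in_segment by blast
  qed
  then show ?thesis by auto
next
  case False
  define D where "D = orient b1 b2 p"
  have D: "D \<noteq> 0" using False by (simp add: D_def)
  \<comment> \<open>The barycentric coordinates of \<open>bX\<close> by Cramer's rule;
    \<open>side\<close> makes the weight at \<open>p\<close> negative.\<close>
  define w1 w2 wp where "w1 = orient bX b2 p / D" and "w2 = orient b1 bX p / D" and "wp = orient b1 b2 bX / D"
  have sum: "w1 + w2 + wp = 1"
  proof -
    have "orient bX b2 p + orient b1 bX p + orient b1 b2 bX = D"
      by (simp add: D_def orient_def cross_def algebra_simps)
    then show ?thesis using D by (simp add: w1_def w2_def wp_def flip: add_divide_distrib)
  qed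
  have comb: "bX = w1 *\<^sub>R b1 + w2 *\<^sub>R b2 + wp *\<^sub>R p"
  proof -
    have "D *\<^sub>R bX = orient bX b2 p *\<^sub>R b1 + orient b1 bX p *\<^sub>R b2 + orient b1 b2 bX *\<^sub>R p"
      by (simp add: D_def orient_def cross_def complex_eq_iff algebra_simps)
    then have "(1 / D) *\<^sub>R (D *\<^sub>R bX) = (1 / D) *\<^sub>R (orient bX b2 p *\<^sub>R b1 + orient b1 bX p *\<^sub>R b2 + orient b1 b2 bX *\<^sub>R p)"
      by simp
    then show ?thesis using D by (simp add: scaleR_right_distrib w1_def w2_def wp_def)
  qed
  have wp: "wp < 0"
    using side False unfolding wp_def D_def by (simp add: divide_less_0_iff mult_le_0_iff) linarith
  have w1: "w1 > 0"
  proof (rule ccontr)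
    assume n: "\<not> w1 > 0"
    then have w2: "w2 > 0" using sum wp by linarith
    have "w2 *\<^sub>R b2 = 1 *\<^sub>R bX + (- w1) *\<^sub>R b1 + (- wp) *\<^sub>R p" unfolding comb by simp
    then have "(1 / w2) *\<^sub>R (w2 *\<^sub>R b2) = (1 / w2) *\<^sub>R (1 *\<^sub>R bX + (- w1) *\<^sub>R b1 + (- wp) *\<^sub>R p)" by simp
    then have "b2 = (1 / w2) *\<^sub>R bX + (- w1 / w2) *\<^sub>R b1 + (- wp / w2) *\<^sub>R p"
      using w2 by (simp add: scaleR_right_distrib scaleR_right_diff_distrib)
    also have "\<dots> \<in> ball c r"
    proof (rule convex_combination_in_ball)
      have "1 - w1 - wp = w2" using sum by simp
      then show "1 / w2 + (- w1 / w2) + (- wp / w2) = 1" using w2 by (simp flip: add_divide_distrib diff_divide_distrib)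
    qed (use n w2 wp b p in \<open>auto simp: divide_nonpos_pos divide_neg_pos\<close>)
    finally show False using b(2) by simp
  qed
  have w2: "w2 > 0"
  proof (rule ccontr)
    assume n: "\<not> w2 > 0"
    have "w1 *\<^sub>R b1 = 1 *\<^sub>R bX + (- w2) *\<^sub>R b2 + (- wp) *\<^sub>R p" unfolding comb by simp
    then have "(1 / w1) *\<^sub>R (w1 *\<^sub>R b1) = (1 / w1) *\<^sub>R (1 *\<^sub>R bX + (- w2) *\<^sub>R b2 + (- wp) *\<^sub>R p)" by simp
    then have "b1 = (1 / w1) *\<^sub>R bX + (- w2 / w1) *\<^sub>R b2 + (- wp / w1) *\<^sub>R p"
      using w1 by (simp add: scaleR_right_distrib scaleR_right_diff_distrib)
    also have "\<dots> \<in> ball c r"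
    proof (rule convex_combination_in_ball)
      have "1 - w2 - wp = w1" using sum by simp
      then show "1 / w1 + (- w2 / w1) + (- wp / w1) = 1" using w1 by (simp flip: add_divide_distrib diff_divide_distrib)
    qed (use n w1 wp b p in \<open>auto simp: divide_nonpos_pos divide_neg_pos\<close>)
    finally show False using b(1) by simp
  qed
  \<comment> \<open>Along the segment the weight of \<open>b1\<close> runs linearly from
    \<open>w1\<close> at \<open>bX\<close> to \<open>1 - \<xi>\<close> at \<open>x\<close>; this
    \<open>\<mu>\<close> is its zero.\<close>
  define \<mu> where "\<mu> = w1 / (w1 + \<xi> - 1)"
  have \<mu>: "0 < \<mu>" "\<mu> < 1" using w1 x(2) by (auto simp: \<mu>_def field_simps)
  define z where "z = (1 - \<mu>) *\<^sub>R bX + \<mu> *\<^sub>R x"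
  have z: "z \<in> closed_segment bX x" using \<mu> unfolding in_segment z_def by (intro exI[of _ \<mu>]) auto
  define Z where "Z = 1 - (1 - \<mu>) * w2"
  have 0: "(1 - \<mu>) * w1 + \<mu> * (1 - \<xi>) = 0"
  proof -
    have "\<mu> * (w1 + \<xi> - 1) = w1" using w1 x(2) by (simp add: \<mu>_def)
    then show ?thesis by (simp add: algebra_simps)
  qed
  have zeq: "z = b2 + Z *\<^sub>R (p - b2)"
  proof -
    have "z = ((1 - \<mu>) * w1 + \<mu> * (1 - \<xi>)) *\<^sub>R b1 + ((1 - \<mu>) * w2) *\<^sub>R b2 + ((1 - \<mu>) * wp + \<mu> * \<xi>) *\<^sub>R p"
      unfolding z_def x(1) comb by (simp add: complex_eq_iff algebra_simps)
    moreover have "(1 - \<mu>) * wp + \<mu> * \<xi> = Z"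
    proof -
      have "(1 - \<mu>) * (w1 + w2 + wp) = 1 - \<mu>" using sum by simp
      then have "(1 - \<mu>) * w1 + (1 - \<mu>) * w2 + (1 - \<mu>) * wp = 1 - \<mu>" by (simp add: distrib_left)
      moreover have "\<mu> * (1 - \<xi>) = \<mu> - \<mu> * \<xi>" by (simp add: algebra_simps)
      ultimately show ?thesis using 0 unfolding Z_def by linarith
    qed
    moreover have "(1 - \<mu>) * w2 = 1 - Z" by (simp add: Z_def)
    ultimately have "z = 0 *\<^sub>R b1 + (1 - Z) *\<^sub>R b2 + Z *\<^sub>R p" by (simp only: 0)
    then show ?thesis by (simp add: algebra_simps)
  qed
  have "bX \<in> cball c r" using b by auto
  then have zc: "z \<in> cball c r" using z x(3) convex_cball closed_segment_subset by blast
  have "Z < 1" using \<mu> w2 by (simp add: Z_def)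
  moreover have "Z \<ge> 0"
  proof (rule ccontr)
    assume n: "\<not> Z \<ge> 0"
    have "(1 - Z) *\<^sub>R b2 = z + (- Z) *\<^sub>R p" unfolding zeq by (simp add: algebra_simps)
    then have "(1 / (1 - Z)) *\<^sub>R ((1 - Z) *\<^sub>R b2) = (1 / (1 - Z)) *\<^sub>R (z + (- Z) *\<^sub>R p)" by simp
    then have "b2 = (1 / (1 - Z)) *\<^sub>R z + 0 *\<^sub>R z + (- Z / (1 - Z)) *\<^sub>R p"
      using n by (simp add: scaleR_right_distrib scaleR_right_diff_distrib)
    also have "\<dots> \<in> ball c r"
      using n zc p by (intro convex_combination_in_ball) (auto simp: field_simps)
    finally show False using b(2) by simp
  qed
  ultimately have "z \<in> closed_segment b2 p"
    unfolding in_segment zeq by (intro exI[of _ Z]) (auto simp: algebra_simps)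
  then show ?thesis using z by blast
qed


section \<open>Interlacing pairs of circle points\<close>

definition btw :: "real \<Rightarrow> real \<Rightarrow> real \<Rightarrow> bool" where
  "btw p q z \<longleftrightarrow> p < z \<and> z < q \<or> q < z \<and> z < p"

text \<open>For \<open>p = q\<close> this only says that \<open>y\<close> and \<open>z\<close>
  differ from \<open>p\<close>; \<open>ring_order\<close> uses that case to obtain distinct
  parameters.\<close>

definition same_side :: "real \<Rightarrow> real \<Rightarrow> real \<Rightarrow> real \<Rightarrow> bool" where
  "same_side p q y z \<longleftrightarrow> y \<noteq> p \<and> y \<noteq> q \<and> z \<noteq> p \<and> z \<noteq> q \<and> btw p q y = btw p q z"

text \<open>The two pairs interlace on the circle. Although \<open>btw\<close> refers to the linear
  order of the parameters, this relation does not depend on which point of the circle is sent to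
  infinity.\<close>

definition separate :: "real \<Rightarrow> real \<Rightarrow> real \<Rightarrow> real \<Rightarrow> bool" where
  "separate p q y z \<longleftrightarrow> y \<noteq> p \<and> y \<noteq> q \<and> z \<noteq> p \<and> z \<noteq> q \<and> btw p q y \<noteq> btw p q z"

lemma separate_commute:
  "separate p q y z \<longleftrightarrow> separate q p y z" "separate p q y z \<longleftrightarrow> separate p q z y"
  "separate p q y z \<longleftrightarrow> separate y z p q"
  unfolding separate_def btw_def by auto

lemma same_side_sym:
  "same_side p q y z \<longleftrightarrow> same_side p q z y" "same_side p q y z \<longleftrightarrow> same_side q p y z"
  unfolding same_side_def btw_def by auto

lemma same_side_trans: "same_side p q x y \<Longrightarrow> same_side p q y z \<Longrightarrow> same_side p q x z"
  unfolding same_side_def by auto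

lemma not_separate_imp_same_side:
  "\<not> separate p q y z \<Longrightarrow> y \<noteq> p \<Longrightarrow> y \<noteq> q \<Longrightarrow> z \<noteq> p \<Longrightarrow> z \<noteq> q \<Longrightarrow> same_side p q y z"
  unfolding same_side_def separate_def by auto

text \<open>Of the three ways to split four distinct points of a circle into two pairs, exactly one
  interlaces, and the hypotheses exclude two.\<close>

lemma separate_if_same_sides:
  assumes "same_side a b c d" "same_side b c d a" "a \<noteq> b" "c \<noteq> d"
  shows "separate a c b d"
  using assms unfolding same_side_def separate_def btw_def by argo

text \<open>The hypotheses put \<open>q\<close>, \<open>y\<close>, \<open>z\<close> on one side of
  the chord from \<open>p\<close> to \<open>p'\<close>, so \<open>p\<close> and \<open>p'\<close>
  lie in the same arc cut out by these points. This is how a cycle base is exchanged for the base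
  attached to it.\<close>

lemma separate_replace:
  assumes "separate p q y z" "same_side p p' q y" "same_side p p' q z"
  shows "separate p' q y z"
  using assms unfolding same_side_def separate_def btw_def by argo

text \<open>The points \<open>y\<close> and \<open>z\<close> cut the circle into two arcs;
  \<open>p\<close>, \<open>p'\<close> lie in one of them and \<open>q\<close>, \<open>q'\<close> in
  the other.\<close>

lemma same_side_if_fenced:
  assumes "separate p q y z" "same_side p p' y z" "same_side q q' y z"
  shows "same_side p p' q q'"
  using assms unfolding same_side_def separate_def btw_def by argo

text \<open>Both orientations refer to one chord, so the factor \<open>c - a\<close> occurs squared
  and the sign depends only on how \<open>b\<close> and \<open>d\<close> lie relative to
  \<open>a\<close> and \<open>c\<close>.\<close>

lemma orient_unchart_mult:
  assumes "a \<noteq> c" "q \<noteq> x"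
  shows "\<exists>K>0. orient (unchart x q a) (unchart x q c) (unchart x q b) * orient (unchart x q a) (unchart x q c) (unchart x q d)
    = K * (((b - a) * (b - c)) * ((d - a) * (d - c)))"
proof -
  have pos: "1 + t\<^sup>2 > 0" for t :: real by (simp add: add_pos_nonneg)
  define P where "P b = 4 * (cmod (q - x))\<^sup>2 / ((1 + a\<^sup>2) * (1 + c\<^sup>2) * (1 + b\<^sup>2))" for b
  have P: "P b > 0" for b using assms(2) pos by (simp add: P_def)
  have o: "orient (unchart x q a) (unchart x q c) (unchart x q b) = P b * ((c - a) * ((b - a) * (b - c)))" for b
    unfolding orient_unchart P_def by (simp add: mult_ac)
  have "P b * P d * (c - a)\<^sup>2 > 0" using P[of b] P[of d] assms(1) by simp
  moreover have "P b * ((c - a) * ((b - a) * (b - c))) * (P d * ((c - a) * ((d - a) * (d - c)))) =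
      (P b * P d * (c - a)\<^sup>2) * (((b - a) * (b - c)) * ((d - a) * (d - c)))"
    by (simp add: power2_eq_square mult_ac)
  ultimately show ?thesis unfolding o by blast
qed

lemma btw_iff: "(b - a) * (b - c) < 0 \<longleftrightarrow> btw a c b"
  unfolding mult_less_0_iff btw_def by auto

lemma not_btw_imp: "b \<noteq> a \<Longrightarrow> b \<noteq> c \<Longrightarrow> \<not> btw a c b \<Longrightarrow> (b - a) * (b - c) > 0"
  unfolding btw_iff[symmetric] by (meson diff_eq_diff_eq linorder_neqE_linordered_idom mult_eq_0_iff right_minus_eq)

lemma orient_unchart_separate:
  assumes "separate a c b d" "q \<noteq> x"
  shows "orient (unchart x q a) (unchart x q c) (unchart x q b) * orient (unchart x q a) (unchart x q c) (unchart x q d) < 0"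
proof -
  have "((b - a) * (b - c)) * ((d - a) * (d - c)) < 0"
    using assms(1) btw_iff not_btw_imp unfolding separate_def by (metis mult_neg_pos mult_pos_neg)
  moreover have "a \<noteq> c" using assms(1) by (auto simp: separate_def btw_def)
  ultimately show ?thesis using orient_unchart_mult[OF _ assms(2), of a c b d] by (metis mult_pos_neg)
qed

lemma orient_unchart_same_side:
  assumes "same_side a c b d" "a \<noteq> c" "q \<noteq> x"
  shows "orient (unchart x q a) (unchart x q c) (unchart x q b) * orient (unchart x q a) (unchart x q c) (unchart x q d) > 0"
proof -
  have "((b - a) * (b - c)) * ((d - a) * (d - c)) > 0"
    using assms(1) btw_iff not_btw_imp unfolding same_side_def by (metis mult_neg_neg mult_pos_pos)
  then show ?thesis using orient_unchart_mult[OF assms(2,3), of b d] by (metis mult_pos_pos)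
qed

text \<open>The cyclic form of \<open>circle_interlace\<close>; all statements about the order of
  bases are derived from it.\<close>

lemma circle_not_separate:
  assumes q: "q \<in> sphere x r" "r > 0"
    and U: "path_connected U" "U \<subseteq> cball x r - {q}" "unchart x q p1 \<in> U" "unchart x q p2 \<in> U"
    and W: "path_connected W" "W \<subseteq> cball x r - {q}" "unchart x q p3 \<in> W" "unchart x q p4 \<in> W"
    and disj: "U \<inter> W = {}"
  shows "same_side p1 p2 p3 p4"
proof (rule not_separate_imp_same_side)
  show "p3 \<noteq> p1" "p3 \<noteq> p2" "p4 \<noteq> p1" "p4 \<noteq> p2" using U W disj by auto
  note * = circle_interlace[OF q]
  show "\<not> separate p1 p2 p3 p4"
  proof
    assume "separate p1 p2 p3 p4"
    \<comment> \<open>The eight linear orders of two interlacing pairs: either pair may start, and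
      each may be listed either way.\<close>
    then have "p1 < p3 \<and> p3 < p2 \<and> p2 < p4 \<or> p1 < p4 \<and> p4 < p2 \<and> p2 < p3
      \<or> p2 < p3 \<and> p3 < p1 \<and> p1 < p4 \<or> p2 < p4 \<and> p4 < p1 \<and> p1 < p3
      \<or> p3 < p1 \<and> p1 < p4 \<and> p4 < p2 \<or> p4 < p1 \<and> p1 < p3 \<and> p3 < p2
      \<or> p3 < p2 \<and> p2 < p4 \<and> p4 < p1 \<or> p4 < p2 \<and> p2 < p3 \<and> p3 < p1"
      unfolding separate_def btw_def by argo
    then consider "p1 < p3" "p3 < p2" "p2 < p4" | "p1 < p4" "p4 < p2" "p2 < p3"
      | "p2 < p3" "p3 < p1" "p1 < p4" | "p2 < p4" "p4 < p1" "p1 < p3"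
      | "p3 < p1" "p1 < p4" "p4 < p2" | "p4 < p1" "p1 < p3" "p3 < p2"
      | "p3 < p2" "p2 < p4" "p4 < p1" | "p4 < p2" "p2 < p3" "p3 < p1"
      by blast
    then show False
    proof cases
      case 1 then show ?thesis using *[OF U W] disj by blast
    next
      case 2 then show ?thesis using *[OF U W(1,2,4,3)] disj by blast
    next
      case 3 then show ?thesis using *[OF U(1,2,4,3) W] disj by blast
    next
      case 4 then show ?thesis using *[OF U(1,2,4,3) W(1,2,4,3)] disj by blast
    next
      case 5 then show ?thesis using *[OF W U] disj by blast
    next
      case 6 then show ?thesis using *[OF W(1,2,4,3) U] disj by blast
    next
      case 7 then show ?thesis using *[OF W U(1,2,4,3)] disj by blast
    next
      case 8 then show ?thesis using *[OF W(1,2,4,3) U(1,2,4,3)] disj by blast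
    qed
  qed
qed

text \<open>
  Otherwise \<open>X\<close> and \<open>Y\<close> would reach \<open>s1\<close> and \<open>s2\<close> before \<open>p\<close>. Together with the initial parts of
  \<open>s1\<close> and \<open>s2\<close> they would form two disjoint connected sets whose bases interlace.
\<close>

lemma crossing_orientation:
  assumes q: "q \<in> sphere x r" "r > 0"
    and s1: "s1 = closed_segment b1 t1" "b1 = unchart x q \<tau>1" "t1 \<in> ball x r"
    and s2: "s2 = closed_segment b2 t2" "b2 = unchart x q \<tau>2" "t2 \<in> ball x r"
    and X: "X = closed_segment bX tX" "bX = unchart x q \<tau>X" "tX \<in> ball x r"
    and Y: "Y = closed_segment bY tY" "bY = unchart x q \<tau>Y" "tY \<in> ball x r"
    and sep: "separate \<tau>1 \<tau>X \<tau>Y \<tau>2"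
    and p: "p \<in> s1" "p \<in> s2"
    and meet: "X \<inter> s1 \<noteq> {}" "Y \<inter> s2 \<noteq> {}" "X \<inter> s2 = {}" "Y \<inter> s1 = {}" "X \<inter> Y = {}"
  shows "orient b1 b2 p * orient b1 b2 bX > 0"
proof (rule ccontr)
  assume neg: "\<not> orient b1 b2 p * orient b1 b2 bX > 0"
  have qx: "q \<noteq> x" using q by auto
  have on: "unchart x q \<tau> \<in> sphere x r" "unchart x q \<tau> \<noteq> q" for \<tau> :: real
    using unchart_mem(2)[of \<tau> q x r] unchart_neq[of \<tau> q x] q qx by auto
  have seg: "closed_segment (unchart x q \<tau>) t \<subseteq> insert (unchart x q \<tau>) (ball x r)" if "t \<in> ball x r" for \<tau> :: real and t
    using segment_in_ball[OF on(1) that] by blast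
  have sub: "s1 \<subseteq> insert b1 (ball x r)" "s2 \<subseteq> insert b2 (ball x r)" "X \<subseteq> insert bX (ball x r)" "Y \<subseteq> insert bY (ball x r)"
    using seg s1 s2 X Y by auto
  have b: "b1 \<in> sphere x r" "b2 \<in> sphere x r" "bX \<in> sphere x r" "bY \<in> sphere x r"
    "b1 \<noteq> q" "b2 \<noteq> q" "bX \<noteq> q" "bY \<noteq> q"
    using on s1(2) s2(2) X(2) Y(2) by auto
  have un: "unchart x q s = unchart x q t \<longleftrightarrow> s = t" for s t :: real
    by (metis Im_complex_of_real chart_unchart of_real_eq_iff order_refl qx)
  have t12: "\<tau>1 \<noteq> \<tau>2" using sep by (auto simp: separate_def)
  then have b12: "b1 \<noteq> b2" using un s1 s2 by auto
  have pb: "p \<in> ball x r"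
  proof -
    have "b1 \<notin> ball x r" "b2 \<notin> ball x r" using b by auto
    then show ?thesis using p sub b12 by blast
  qed
  have same: "same_side \<tau>1 \<tau>2 \<tau>X \<tau>Y" using sep unfolding separate_def same_side_def btw_def by argo
  have oXY: "orient b1 b2 bX * orient b1 b2 bY > 0"
    unfolding s1 s2 X Y using orient_unchart_same_side[OF same t12 qx] .
  have flip: "orient b2 b1 z = - orient b1 b2 z" for z
    by (simp add: orient_def cross_def algebra_simps)
  \<comment> \<open>Stated for both roles at once: for \<open>X\<close> meeting \<open>s1\<close>
    and, with the indices exchanged, for \<open>Y\<close> meeting \<open>s2\<close>. A meeting point
    at \<open>p\<close> or beyond it would give a point on the segment that has to be
    missed.\<close>
  have before: "\<exists>\<xi>. 0 \<le> \<xi> \<and> \<xi> < 1 \<and> y = a1 + \<xi> *\<^sub>R (p - a1)"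
    if a: "a1 \<in> sphere x r" "a2 \<in> sphere x r" "aZ \<in> sphere x r" "a1 \<noteq> a2"
      and S: "S1 = closed_segment a1 e1" "p \<in> S1" "S1 \<subseteq> insert a1 (ball x r)" "closed_segment a2 p \<subseteq> S2" 
      and Z: "closed_segment aZ y \<inter> S2 = {}" "y \<in> S1" 
      and side: "orient a1 a2 p * orient a1 a2 aZ \<le> 0" "orient a1 a2 aZ \<noteq> 0"
    for a1 a2 aZ y e1 S1 S2
  proof -
    have pa: "p \<noteq> a1" using pb a(1) by auto
    obtain u where u: "0 \<le> u" "u \<le> 1" "p = (1 - u) *\<^sub>R a1 + u *\<^sub>R e1"
      using S(2)[unfolded S(1) in_segment] by blast
    obtain v where v: "0 \<le> v" "v \<le> 1" "y = (1 - v) *\<^sub>R a1 + v *\<^sub>R e1"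
      using Z(2)[unfolded S(1) in_segment] by blast
    have u0: "u > 0" using u pa by (cases "u = 0") auto
    have pu: "p - a1 = u *\<^sub>R (e1 - a1)" unfolding u(3) by (simp add: algebra_simps)
    define \<xi> where "\<xi> = v / u"
    have y: "y = a1 + \<xi> *\<^sub>R (p - a1)" unfolding pu \<xi>_def v(3) using u0 by (simp add: algebra_simps)
    have "y \<in> cball x r" using S(3) Z(2) a(1) by (auto simp: less_imp_le)
    have "\<not> \<xi> > 1"
    proof
      assume "\<xi> > 1"
      then have "closed_segment aZ y \<inter> closed_segment a2 p \<noteq> {}"
        using segment_beyond_crossing[OF a pb y _ \<open>y \<in> cball x r\<close> side] by blast
      then show False using Z(1) S(4) by blast
    qed
    moreover have "\<xi> \<noteq> 1"
    proof
      assume "\<xi> = 1"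
      then have "y = p" using y by simp
      then show False using Z(1) S(4) ends_in_segment by blast
    qed
    ultimately show ?thesis using y u0 v(1) by (intro exI[of _ \<xi>]) (auto simp: \<xi>_def)
  qed
  obtain y1 where y1: "y1 \<in> X" "y1 \<in> s1" using meet by blast
  obtain y2 where y2: "y2 \<in> Y" "y2 \<in> s2" using meet by blast
  have cs: "closed_segment b1 p \<subseteq> s1" "closed_segment b2 p \<subseteq> s2"
    using p s1(1) s2(1) by (auto simp: subset_closed_segment)
  have Xy: "closed_segment bX y1 \<subseteq> X" and Yy: "closed_segment bY y2 \<subseteq> Y"
    using y1(1) y2(1) X(1) Y(1) by (auto simp: subset_closed_segment)
  have "\<exists>\<xi>. 0 \<le> \<xi> \<and> \<xi> < 1 \<and> y1 = b1 + \<xi> *\<^sub>R (p - b1)"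
    by (rule before[of b1 b2 bX s1 t1 s2 y1])
      (use b b12 s1(1) p(1) sub(1) cs(2) Xy meet(3) y1(2) neg oXY in auto)
  then obtain \<xi> where \<xi>: "0 \<le> \<xi>" "\<xi> < 1" "y1 = b1 + \<xi> *\<^sub>R (p - b1)" by blast
  have negY: "orient b1 b2 p * orient b1 b2 bY \<le> 0"
    using neg oXY by (simp add: zero_less_mult_iff mult_le_0_iff) linarith
  have "\<exists>\<eta>. 0 \<le> \<eta> \<and> \<eta> < 1 \<and> y2 = b2 + \<eta> *\<^sub>R (p - b2)"
    by (rule before[of b2 b1 bY s2 t2 s1 y2])
      (use b b12 s2(1) p(2) sub(2) cs(1) Yy meet(4) y2(2) negY oXY in \<open>auto simp: flip\<close>)
  then obtain \<eta> where \<eta>: "0 \<le> \<eta>" "\<eta> < 1" "y2 = b2 + \<eta> *\<^sub>R (p - b2)" by blast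
  have disj: "closed_segment b1 y1 \<inter> closed_segment b2 y2 = {}"
  proof (rule ccontr)
    assume "closed_segment b1 y1 \<inter> closed_segment b2 y2 \<noteq> {}"
    then obtain u v where uv: "0 \<le> u" "u \<le> 1" "0 \<le> v" "v \<le> 1"
      "(1 - u) *\<^sub>R b1 + u *\<^sub>R y1 = (1 - v) *\<^sub>R b2 + v *\<^sub>R y2"
      unfolding in_segment by (auto simp: in_segment)
    define k l where "k = 1 - u * \<xi>" and "l = 1 - v * \<eta>"
    have "u * \<xi> \<le> \<xi>" "v * \<eta> \<le> \<eta>" using uv(1-4) \<xi>(1) \<eta>(1) by (simp_all add: mult_left_le_one_le)
    then have kl: "k > 0" "l > 0" using \<xi>(2) \<eta>(2) by (auto simp: k_def l_def)
    have eq: "k *\<^sub>R (b1 - p) = l *\<^sub>R (b2 - p)"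
      using uv(5) unfolding \<xi>(3) \<eta>(3) k_def l_def by (simp add: algebra_simps)
    \<comment> \<open>The equation puts both bases on one half-line from the inner point
      \<open>p\<close>, which leaves the disc only once.\<close>
    have no: False if "0 < k" "k < l" "k *\<^sub>R (a - p) = l *\<^sub>R (a' - p)" "a \<in> sphere x r" "a' \<in> sphere x r" for k l a a'
    proof -
      have "l *\<^sub>R a' = k *\<^sub>R a + (l - k) *\<^sub>R p" using that(3) by (simp add: algebra_simps)
      then have "(1 / l) *\<^sub>R (l *\<^sub>R a') = (1 / l) *\<^sub>R (k *\<^sub>R a + (l - k) *\<^sub>R p)" by simp
      then have "a' = (k / l) *\<^sub>R a + 0 *\<^sub>R a + ((l - k) / l) *\<^sub>R p" using that by (simp add: scaleR_right_distrib)
      also have "\<dots> \<in> ball x r"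
        using that pb by (intro convex_combination_in_ball) (auto simp: field_simps)
      finally show False using that(5) by simp
    qed
    show False
    proof (cases k l rule: linorder_cases)
      case less then show False using no[OF kl(1) less eq] b by blast
    next
      case greater then show False using no[OF kl(2) greater eq[symmetric]] b by blast
    next
      case equal then show False using eq kl b12 by simp
    qed
  qed
  have sy: "closed_segment b1 y1 \<subseteq> s1" "closed_segment b2 y2 \<subseteq> s2"
    using y1(2) y2(2) s1(1) s2(1) by (auto simp: subset_closed_segment)
  have "same_side \<tau>1 \<tau>X \<tau>Y \<tau>2"
  proof (rule circle_not_separate[OF q])
    show "path_connected (closed_segment b1 y1 \<union> X)" "path_connected (closed_segment b2 y2 \<union> Y)"
      using y1 y2 X(1) Y(1) by (auto intro!: path_connected_Un)
    show "closed_segment b1 y1 \<union> X \<subseteq> cball x r - {q}" "closed_segment b2 y2 \<union> Y \<subseteq> cball x r - {q}"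
      using sy sub b q(1) by (force simp: less_imp_le)+
    show "(closed_segment b1 y1 \<union> X) \<inter> (closed_segment b2 y2 \<union> Y) = {}"
      using disj sy meet(3-5) by blast
  qed (use s1(2) s2(2) X(1,2) Y(1,2) in auto)
  then show False using sep by (auto simp: same_side_def separate_def)
qed

subsection \<open>Forcing the order of the base points\<close>

text \<open>
  The induced cycle on \<open>0, \<dots>, 2 * N - 1\<close> forces the cyclic order of the vertices \<open>2 * N + x\<close>, which are
  attached to the cycle vertices \<open>2 * x\<close> and carry the edges \<open>E\<close>.
\<close>

definition ring_edge :: "nat \<Rightarrow> (nat \<times> nat) list \<Rightarrow> nat \<Rightarrow> nat \<Rightarrow> bool" where
  "ring_edge N E i j \<longleftrightarrow>
     i < 2 * N \<and> j < 2 * N \<and> (j = Suc i \<or> i = 0 \<and> Suc j = 2 * N) \<or>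
     i < 2 * N \<and> 2 * N \<le> j \<and> i = 2 * (j - 2 * N) \<or>
     2 * N \<le> i \<and> 2 * N \<le> j \<and> (i - 2 * N, j - 2 * N) \<in> set E"

definition ring_adj :: "nat \<Rightarrow> (nat \<times> nat) list \<Rightarrow> nat \<Rightarrow> nat \<Rightarrow> bool" where
  "ring_adj N E i j \<longleftrightarrow> ring_edge N E i j \<or> ring_edge N E j i"

lemma ring_adj_sym: "ring_adj N E i j \<longleftrightarrow> ring_adj N E j i"
  unfolding ring_adj_def by blast

text \<open>Only connectedness, bases and intersections are kept, so the order arguments do not
  depend on straightness. The condition on \<open>E\<close> says that joined attached vertices have
  cyclic distance at least two, which leaves a free position on each arc between them.\<close>

locale ring_family =
  fixes x :: complex and r :: real and q :: complex and f :: "nat \<Rightarrow> complex set" and \<tau> :: "nat \<Rightarrow> real"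
    and N m :: nat and E :: "(nat \<times> nat) list"
  assumes q: "q \<in> sphere x r" "r > 0"
    and conn: "\<And>i. i < 2 * N + m \<Longrightarrow> path_connected (f i)"
    and sub: "\<And>i. i < 2 * N + m \<Longrightarrow> f i \<subseteq> cball x r - {q}"
    and base: "\<And>i. i < 2 * N + m \<Longrightarrow> unchart x q (\<tau> i) \<in> f i"
    and adj: "\<And>i j. i < 2 * N + m \<Longrightarrow> j < 2 * N + m \<Longrightarrow> i \<noteq> j \<Longrightarrow> f i \<inter> f j \<noteq> {} \<longleftrightarrow> ring_adj N E i j"
    and N: "N \<ge> 4" and m: "m \<le> N"
    and E: "\<And>a b. (a, b) \<in> set E \<Longrightarrow> a + 2 \<le> b \<and> b + 2 \<le> a + N \<or> b + 2 \<le> a \<and> a + 2 \<le> b + N"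
begin

text \<open>Reduces an index below \<open>4 * N\<close> modulo \<open>2 * N\<close>, so that an arc
  of the cycle that runs past vertex \<open>0\<close> is still an interval of indices.\<close>

definition R :: "nat \<Rightarrow> nat" where "R i = (if i < 2 * N then i else i - 2 * N)"

lemma R_less: "i < 4 * N \<Longrightarrow> R i < 2 * N"
  by (auto simp: R_def)

lemma R_bound: "i < 4 * N \<Longrightarrow> R i < 2 * N + m"
  using R_less[of i] by linarith

lemma ring_meet:
  assumes "Suc i < 4 * N" shows "f (R i) \<inter> f (R (Suc i)) \<noteq> {}"
proof -
  have "R i < 2 * N" "R (Suc i) < 2 * N" using R_less assms by auto
  moreover have suc: "R (Suc i) = Suc (R i) \<or> R (Suc i) = 0 \<and> Suc (R i) = 2 * N"
    using assms by (auto simp: R_def)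
  ultimately have "ring_adj N E (R i) (R (Suc i))"
    unfolding ring_adj_def ring_edge_def by metis
  moreover have "R i \<noteq> R (Suc i)" using suc N by auto
  ultimately show ?thesis using adj[of "R i" "R (Suc i)"] R_bound[of i] R_bound[of "Suc i"] assms by simp
qed

lemma ring_disjoint:
  assumes "i + 2 \<le> j" "j + 2 \<le> i + 2 * N" "j < 4 * N" shows "f (R i) \<inter> f (R j) = {}"
proof -
  have "R i \<noteq> R j" using assms by (auto simp: R_def)
  moreover have "\<not> ring_adj N E (R i) (R j)"
    using assms N by (auto simp: ring_adj_def ring_edge_def R_def split: if_splits)
  moreover have "i < 4 * N" using assms by simp
  ultimately show ?thesis using adj[of "R i" "R j"] R_bound[of i] R_bound[of j] assms by blast
qed

lemma attached_disjoint:
  assumes "v < m" "2 * v + 1 \<le> j" "j + 1 \<le> 2 * v + 2 * N" "j < 4 * N"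
  shows "f (2 * N + v) \<inter> f (R j) = {}"
proof -
  have "2 * N + v \<noteq> R j" using R_less[of j] assms by simp
  moreover have "\<not> ring_adj N E (2 * N + v) (R j)"
    using assms R_less[of j] m by (auto simp: ring_adj_def ring_edge_def R_def split: if_splits)
  ultimately show ?thesis using adj[of "2 * N + v" "R j"] R_bound[of j] assms by auto
qed

lemma attached_meet:
  assumes "v < m" shows "f (2 * N + v) \<inter> f (2 * v) \<noteq> {}"
  using adj[of "2 * N + v" "2 * v"] assms m by (auto simp: ring_adj_def ring_edge_def)

definition block :: "nat \<Rightarrow> nat \<Rightarrow> complex set" where "block i j = (\<Union>k\<in>{i..j}. f (R k))"

lemma block_conn: "i \<le> j \<Longrightarrow> j < 4 * N \<Longrightarrow> path_connected (block i j)"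
proof (induction j)
  case 0
  then show ?case using conn[OF R_bound[of 0]] N by (simp add: block_def)
next
  case (Suc j)
  show ?case
  proof (cases "i = Suc j")
    case True then show ?thesis using conn[OF R_bound[of "Suc j"]] Suc.prems by (simp add: block_def)
  next
    case False
    then have "i \<le> j" using Suc.prems by simp
    then have *: "block i (Suc j) = block i j \<union> f (R (Suc j))"
      using Suc.prems by (auto simp: block_def atLeastAtMostSuc_conv)
    have "block i j \<inter> f (R (Suc j)) \<noteq> {}"
      using ring_meet[of j] \<open>i \<le> j\<close> Suc.prems by (force simp: block_def)
    then show ?thesis unfolding *
      using Suc \<open>i \<le> j\<close> conn R_bound by (intro path_connected_Un) auto
  qed
qed

lemma block_sub: "j < 4 * N \<Longrightarrow> block i j \<subseteq> cball x r - {q}"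
proof -
  assume j: "j < 4 * N"
  show ?thesis unfolding block_def
  proof (rule UN_least)
    fix k assume "k \<in> {i..j}"
    then show "f (R k) \<subseteq> cball x r - {q}" using sub[OF R_bound[of k]] j by simp
  qed
qed

lemma base_block: "i \<le> k \<Longrightarrow> k \<le> j \<Longrightarrow> j < 4 * N \<Longrightarrow> unchart x q (\<tau> (R k)) \<in> block i j"
  using base[OF R_bound[of k]] unfolding block_def by auto

lemma block_disjoint:
  assumes "i \<le> j" "j + 2 \<le> k" "k \<le> l" "l + 2 \<le> i + 2 * N" "l < 4 * N"
  shows "block i j \<inter> block k l = {}"
proof -
  have "f (R a) \<inter> f (R b) = {}" if "a \<in> {i..j}" "b \<in> {k..l}" for a b
    by (rule ring_disjoint) (use assms that in auto)
  then show ?thesis unfolding block_def by blast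
qed

lemma ring_same_side:
  assumes "i \<le> j" "j + 2 \<le> k" "k \<le> l" "l + 2 \<le> i + 2 * N" "l < 4 * N"
  shows "same_side (\<tau> (R i)) (\<tau> (R j)) (\<tau> (R k)) (\<tau> (R l))"
proof (rule circle_not_separate[OF q])
  show "block i j \<inter> block k l = {}" using block_disjoint assms by blast
qed (use block_conn block_sub base_block assms in auto)

text \<open>Even cycle vertices are pairwise nonadjacent, so the cycle arcs from \<open>a\<close> to
  \<open>b\<close> and from \<open>c\<close> to \<open>d\<close> are disjoint and connected, and so
  are those from \<open>b\<close> to \<open>c\<close> and from \<open>d\<close> to \<open>a\<close>.
  Hence the first two pairings do not interlace, and the third one must.\<close>

lemma ring_order:
  assumes "a < b" "b < c" "c < d" "d < N"
  shows "separate (\<tau> (2 * a)) (\<tau> (2 * c)) (\<tau> (2 * b)) (\<tau> (2 * d))"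
proof -
  have R: "R (2 * a) = 2 * a" "R (2 * b) = 2 * b" "R (2 * c) = 2 * c" "R (2 * d) = 2 * d" "R (2 * a + 2 * N) = 2 * a"
    using assms by (auto simp: R_def)
  have 1: "same_side (\<tau> (2 * a)) (\<tau> (2 * b)) (\<tau> (2 * c)) (\<tau> (2 * d))"
    using ring_same_side[of "2 * a" "2 * b" "2 * c" "2 * d"] assms unfolding R by simp
  have 2: "same_side (\<tau> (2 * b)) (\<tau> (2 * c)) (\<tau> (2 * d)) (\<tau> (2 * a))"
    using ring_same_side[of "2 * b" "2 * c" "2 * d" "2 * a + 2 * N"] assms unfolding R by simp
  \<comment> \<open>The degenerate arcs only supply that the bases of \<open>a\<close> and
    \<open>b\<close>, and those of \<open>c\<close> and \<open>d\<close>, are distinct.\<close>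
  have "same_side (\<tau> (2 * a)) (\<tau> (2 * a)) (\<tau> (2 * b)) (\<tau> (2 * d))"
    using ring_same_side[of "2 * a" "2 * a" "2 * b" "2 * d"] assms unfolding R by simp
  moreover have "same_side (\<tau> (2 * c)) (\<tau> (2 * c)) (\<tau> (2 * d)) (\<tau> (2 * a))"
    using ring_same_side[of "2 * c" "2 * c" "2 * d" "2 * a + 2 * N"] assms unfolding R by simp
  ultimately show ?thesis
    by (intro separate_if_same_sides 1 2) (auto simp: same_side_def)
qed

text \<open>An attached set together with its cycle vertex is connected. It avoids the arc that
  remains after deleting \<open>2 * v\<close> and its two neighbours from the cycle, and that arc
  contains all other even vertices.\<close>

lemma attached_ring_same_side:
  assumes "v < m" "y < N" "z < N" "y \<noteq> v" "z \<noteq> v"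
  shows "same_side (\<tau> (2 * N + v)) (\<tau> (2 * v)) (\<tau> (2 * y)) (\<tau> (2 * z))"
proof (rule circle_not_separate[OF q])
  let ?U = "f (2 * N + v) \<union> f (2 * v)" and ?W = "block (2 * v + 2) (2 * v + 2 * N - 2)"
  have v: "v < N" using assms m by simp
  show "path_connected ?U" using attached_meet[OF assms(1)] conn v assms(1) by (intro path_connected_Un) auto
  show "path_connected ?W" by (rule block_conn) (use N v in auto)
  show "?U \<subseteq> cball x r - {q}" using sub[of "2 * N + v"] sub[of "2 * v"] v assms(1) by auto
  show "?W \<subseteq> cball x r - {q}" by (rule block_sub) (use v N in auto)
  show "unchart x q (\<tau> (2 * N + v)) \<in> ?U" "unchart x q (\<tau> (2 * v)) \<in> ?U"
    using base[of "2 * N + v"] base[of "2 * v"] v assms(1) by auto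
  have "unchart x q (\<tau> (2 * y)) \<in> ?W" if y: "y < N" "y \<noteq> v" for y
  proof (cases "y < v")
    case True
    \<comment> \<open>A position before \<open>v\<close> is reached only after wrapping around,
      hence the shift by \<open>2 * N\<close>.\<close>
    then have "unchart x q (\<tau> (R (2 * y + 2 * N))) \<in> ?W" by (intro base_block) (use N v in auto)
    then show ?thesis by (simp add: R_def)
  next
    case False
    then have "unchart x q (\<tau> (R (2 * y))) \<in> ?W" by (intro base_block) (use N v y in auto)
    then show ?thesis using y by (simp add: R_def)
  qed
  then show "unchart x q (\<tau> (2 * y)) \<in> ?W" "unchart x q (\<tau> (2 * z)) \<in> ?W" using assms by auto
  have "f (2 * N + v) \<inter> f (R j) = {} \<and> f (2 * v) \<inter> f (R j) = {}" if "j \<in> {2 * v + 2..2 * v + 2 * N - 2}" for j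
  proof
    show "f (2 * N + v) \<inter> f (R j) = {}" by (rule attached_disjoint) (use that assms v N in auto)
    have "f (R (2 * v)) \<inter> f (R j) = {}" by (rule ring_disjoint) (use that v N in auto)
    then show "f (2 * v) \<inter> f (R j) = {}" using v by (simp add: R_def)
  qed
  then show "?U \<inter> ?W = {}" unfolding block_def by blast
qed

text \<open>For disjoint attached sets, each is joined to its cycle vertex and the two unions are
  disjoint. For joined ones this fails, but then a cycle position is free on either side, and these
  two positions fence the pair at \<open>v\<close> off from the pair at \<open>w\<close>.\<close>

lemma attached_attached_same_side:
  assumes "v < w" "w < m"
  shows "same_side (\<tau> (2 * N + v)) (\<tau> (2 * v)) (\<tau> (2 * N + w)) (\<tau> (2 * w))"
proof (cases "f (2 * N + v) \<inter> f (2 * N + w) = {}")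
  case True
  have vw: "v < m" "v < N" "w < N" using assms m by auto
  show ?thesis
  proof (rule circle_not_separate[OF q])
    show "path_connected (f (2 * N + v) \<union> f (2 * v))" "path_connected (f (2 * N + w) \<union> f (2 * w))"
      using attached_meet[of v] attached_meet[of w] conn vw assms(2) by (auto intro!: path_connected_Un)
    show "f (2 * N + v) \<union> f (2 * v) \<subseteq> cball x r - {q}" "f (2 * N + w) \<union> f (2 * w) \<subseteq> cball x r - {q}"
      using sub[of "2 * N + v"] sub[of "2 * v"] sub[of "2 * N + w"] sub[of "2 * w"] vw assms(2) by auto
    have R: "R (2 * v) = 2 * v" "R (2 * w) = 2 * w" "R (2 * v + 2 * N) = 2 * v" using vw by (auto simp: R_def)
    have "f (R (2 * v)) \<inter> f (R (2 * w)) = {}" by (rule ring_disjoint) (use assms vw in auto)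
    moreover have "f (2 * N + v) \<inter> f (R (2 * w)) = {}" by (rule attached_disjoint) (use assms vw in auto)
    moreover have "f (2 * N + w) \<inter> f (R (2 * v + 2 * N)) = {}" by (rule attached_disjoint) (use assms vw in auto)
    ultimately show "(f (2 * N + v) \<union> f (2 * v)) \<inter> (f (2 * N + w) \<union> f (2 * w)) = {}"
      using True unfolding R by blast
  qed (use base[of "2 * N + v"] base[of "2 * v"] base[of "2 * N + w"] base[of "2 * w"] vw assms(2) in auto)
next
  case False
  have vw: "v < m" "v < N" "w < N" using assms m by auto
  have "ring_adj N E (2 * N + v) (2 * N + w)" using adj False assms by simp
  then have "(v, w) \<in> set E \<or> (w, v) \<in> set E" using vw by (auto simp: ring_adj_def ring_edge_def)
  then have far: "v + 2 \<le> w" "w + 2 \<le> v + N" using E assms(1) by fastforce+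
  \<comment> \<open>The position after \<open>w\<close>, with wrap-around; together with
    \<open>v + 1\<close> it separates \<open>v\<close> from \<open>w\<close>.\<close>
  define u where "u = (if w + 1 < N then w + 1 else 0)"
  have u: "u < N" "u < v \<or> w < u" using far vw by (auto simp: u_def)
  have sep: "separate (\<tau> (2 * v)) (\<tau> (2 * w)) (\<tau> (2 * (v + 1))) (\<tau> (2 * u))"
  proof (cases "w < u")
    case True then show ?thesis using ring_order[of v "v + 1" w u] far u by simp
  next
    case False
    then have "separate (\<tau> (2 * u)) (\<tau> (2 * (v + 1))) (\<tau> (2 * v)) (\<tau> (2 * w))"
      using ring_order[of u v "v + 1" w] far u vw by simp
    then show ?thesis using separate_commute by blast
  qed
  have 1: "same_side (\<tau> (2 * v)) (\<tau> (2 * N + v)) (\<tau> (2 * (v + 1))) (\<tau> (2 * u))"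
    using attached_ring_same_side[of v "v + 1" u] vw far u same_side_sym by auto
  have 2: "same_side (\<tau> (2 * w)) (\<tau> (2 * N + w)) (\<tau> (2 * (v + 1))) (\<tau> (2 * u))"
    using attached_ring_same_side[of w "v + 1" u] vw far u assms same_side_sym by auto
  have "same_side (\<tau> (2 * v)) (\<tau> (2 * N + v)) (\<tau> (2 * w)) (\<tau> (2 * N + w))"
    by (rule same_side_if_fenced[OF sep 1 2])
  then show ?thesis using same_side_sym by blast
qed

text \<open>The four cycle bases of \<open>ring_order\<close> are exchanged for attached bases one
  after the other. The facts \<open>cc\<close>, \<open>vc\<close>, \<open>cv\<close>,
  \<open>vv\<close> supply the side conditions for mixtures of cycle bases (\<open>c\<close>) and
  attached bases (\<open>v\<close>).\<close>

lemma attached_order: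
  assumes "a < b" "b < c" "c < d" "d < m"
  shows "separate (\<tau> (2 * N + a)) (\<tau> (2 * N + c)) (\<tau> (2 * N + b)) (\<tau> (2 * N + d))"
proof -
  let ?c = "\<lambda>i. \<tau> (2 * i)" and ?v = "\<lambda>i. \<tau> (2 * N + i)"
  have cc: "same_side (?c i) (?v i) (?c y) (?c z)" if "i < m" "y < m" "z < m" "y \<noteq> i" "z \<noteq> i" for i y z
    using attached_ring_same_side[of i y z] that m same_side_sym by auto
  have vc: "same_side (?c i) (?v i) (?v y) (?c y)" if "i < m" "y < m" "y \<noteq> i" for i y
  proof (cases "i < y")
    case True then show ?thesis using attached_attached_same_side[of i y] that same_side_sym by blast
  next
    case False
    then have "same_side (?v y) (?c y) (?v i) (?c i)" using attached_attached_same_side[of y i] that by simp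
    then show ?thesis unfolding same_side_def btw_def by argo
  qed
  have cv: "same_side (?c i) (?v i) (?v y) (?c z)" if "i < m" "y < m" "z < m" "y \<noteq> i" "z \<noteq> i" for i y z
    using same_side_trans[OF vc cc] that by blast
  have vv: "same_side (?c i) (?v i) (?v y) (?v z)" if "i < m" "y < m" "z < m" "y \<noteq> i" "z \<noteq> i" for i y z
    using same_side_trans[OF cv[OF that]] vc[of i z] that same_side_sym(1) by blast
  have s0: "separate (?c a) (?c c) (?c b) (?c d)" using ring_order assms m by simp
  have s1: "separate (?v a) (?c c) (?c b) (?c d)"
    by (rule separate_replace[OF s0]) (use cc assms in auto)
  then have "separate (?c c) (?v a) (?c b) (?c d)" using separate_commute by blast
  then have "separate (?v c) (?v a) (?c b) (?c d)"
    by (rule separate_replace) (use cc cv assms in auto)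
  then have "separate (?c b) (?c d) (?v c) (?v a)" using separate_commute by blast
  then have "separate (?v b) (?c d) (?v c) (?v a)"
  proof (rule separate_replace)
    show "same_side (?c b) (?v b) (?c d) (?v c)" "same_side (?c b) (?v b) (?c d) (?v a)"
      using cv[of b c d] cv[of b a d] assms same_side_sym(1) by auto
  qed
  then have "separate (?c d) (?v b) (?v c) (?v a)" using separate_commute by blast
  then have "separate (?v d) (?v b) (?v c) (?v a)"
    by (rule separate_replace) (use vv assms in auto)
  then show ?thesis using separate_commute by blast
qed

end

subsection \<open>Graphs that are not representable\<close>

text \<open>The tip is a limit of inner points, so it lies in the closed disc, and it is off the
  circle by definition.\<close>

lemma outer_segment_ends:
  assumes "outer_segment x r A"
  shows "\<exists>a b. A = closed_segment a b \<and> a \<in> sphere x r \<and> b \<in> ball x r"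
proof -
  obtain a b where ab: "A = closed_segment a b" "a \<in> sphere x r" "b \<notin> sphere x r" "open_segment a b \<subseteq> ball x r"
    using assms unfolding outer_segment_def by blast
  have "a \<noteq> b" using ab by auto
  then have "b \<in> closure (open_segment a b)" by (simp add: closure_open_segment)
  also have "\<dots> \<subseteq> closure (ball x r)" by (rule closure_mono[OF ab(4)])
  also have "\<dots> \<subseteq> cball x r" by (simp add: closure_minimal ball_subset_cball)
  finally have "b \<in> ball x r" using ab(3) by auto
  then show ?thesis using ab by blast
qed

text \<open>Choosing \<open>q\<close> off all bases gives every base a finite coordinate
  \<open>\<tau> i\<close>, which is real because the chart maps the circle to the real axis.\<close>

lemma ring_family_of_segments:
  assumes r: "r > 0"
    and seg: "\<And>i. i < 2 * N + m \<Longrightarrow> f i = closed_segment (b i) (t i) \<and> b i \<in> sphere x r \<and> t i \<in> ball x r"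
    and adj: "\<And>i j. i < 2 * N + m \<Longrightarrow> j < 2 * N + m \<Longrightarrow> i \<noteq> j \<Longrightarrow> f i \<inter> f j \<noteq> {} \<longleftrightarrow> ring_adj N E i j"
    and N: "N \<ge> 4" and m: "m \<le> N"
    and E: "\<And>a b. (a, b) \<in> set E \<Longrightarrow> a + 2 \<le> b \<and> b + 2 \<le> a + N \<or> b + 2 \<le> a \<and> a + 2 \<le> b + N"
  obtains q \<tau> where "ring_family x r q f \<tau> N m E" "\<And>i. i < 2 * N + m \<Longrightarrow> unchart x q (\<tau> i) = b i"
proof -
  have "infinite (sphere x r)" using infinite_sphere r by blast
  then have "infinite (sphere x r - b ` {..<2 * N + m})" by simp
  then obtain q where q: "q \<in> sphere x r" "\<And>i. i < 2 * N + m \<Longrightarrow> b i \<noteq> q"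
    by (metis DiffE finite.emptyI image_eqI lessThan_iff subsetI subset_empty)
  have qx: "q \<noteq> x" using q r by auto
  define \<tau> where "\<tau> i = Re (chart x q (b i))" for i
  have b: "unchart x q (\<tau> i) = b i" if i: "i < 2 * N + m" for i
  proof -
    have "Im (chart x q (b i)) = 0" using Im_chart_pos_iff(2)[of "b i" q x r] q i seg by auto
    then have "complex_of_real (\<tau> i) = chart x q (b i)" by (simp add: \<tau>_def complex_eq_iff)
    then show ?thesis using unchart_chart[of "b i" q x] q(2)[OF i] qx by simp
  qed
  have "ring_family x r q f \<tau> N m E"
  proof
    fix i assume i: "i < 2 * N + m"
    show "path_connected (f i)" using seg[OF i] by simp
    show "unchart x q (\<tau> i) \<in> f i" using seg[OF i] b[OF i] by simp
    show "f i \<subseteq> cball x r - {q}"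
    proof
      fix z assume "z \<in> f i"
      then have "z = b i \<or> z \<in> ball x r" using segment_in_ball seg[OF i] by blast
      then show "z \<in> cball x r - {q}" using seg[OF i] q(1) q(2)[OF i] by auto
    qed
  qed (use q r adj N m E in auto)
  then show ?thesis using b that by blast
qed

lemma separate_imp_same_side:
  assumes "separate p q y z"
  shows "same_side p y q z" "same_side p z q y" "same_side q y p z" "same_side q z p y"
  using assms unfolding separate_def same_side_def btw_def by argo+

context ring_family
begin

abbreviation base_point :: "nat \<Rightarrow> complex" ("\<beta>") where "\<beta> v \<equiv> unchart x q (\<tau> (2 * N + v))"

lemma center: "q \<noteq> x"
  using q by auto

lemma attached_adj:
  assumes "a < m" "b < m" "a \<noteq> b"
  shows "f (2 * N + a) \<inter> f (2 * N + b) \<noteq> {} \<longleftrightarrow> (a, b) \<in> set E \<or> (b, a) \<in> set E"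
  using adj[of "2 * N + a" "2 * N + b"] assms by (auto simp: ring_adj_def ring_edge_def)

text \<open>The signs for the six chords of four points in cyclic order: the two diagonals separate
  the other two points, the four sides of the quadrilateral do not.\<close>

lemma attached_orient:
  assumes "a < b" "b < c" "c < d" "d < m"
  shows "orient (\<beta> a) (\<beta> c) (\<beta> b) * orient (\<beta> a) (\<beta> c) (\<beta> d) < 0"
    "orient (\<beta> b) (\<beta> d) (\<beta> a) * orient (\<beta> b) (\<beta> d) (\<beta> c) < 0"
    "orient (\<beta> a) (\<beta> d) (\<beta> b) * orient (\<beta> a) (\<beta> d) (\<beta> c) > 0"
    "orient (\<beta> b) (\<beta> c) (\<beta> a) * orient (\<beta> b) (\<beta> c) (\<beta> d) > 0"
    "orient (\<beta> a) (\<beta> b) (\<beta> c) * orient (\<beta> a) (\<beta> b) (\<beta> d) > 0"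
    "orient (\<beta> c) (\<beta> d) (\<beta> a) * orient (\<beta> c) (\<beta> d) (\<beta> b) > 0"
proof -
  have s: "separate (\<tau> (2 * N + a)) (\<tau> (2 * N + c)) (\<tau> (2 * N + b)) (\<tau> (2 * N + d))"
    using attached_order assms by blast
  have s': "separate (\<tau> (2 * N + b)) (\<tau> (2 * N + d)) (\<tau> (2 * N + a)) (\<tau> (2 * N + c))"
    using s separate_commute by blast
  show "orient (\<beta> a) (\<beta> c) (\<beta> b) * orient (\<beta> a) (\<beta> c) (\<beta> d) < 0"
    using orient_unchart_separate[OF s center] .
  show "orient (\<beta> b) (\<beta> d) (\<beta> a) * orient (\<beta> b) (\<beta> d) (\<beta> c) < 0"
    using orient_unchart_separate[OF s' center] .
  show "orient (\<beta> a) (\<beta> d) (\<beta> b) * orient (\<beta> a) (\<beta> d) (\<beta> c) > 0"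
    using orient_unchart_same_side[OF separate_imp_same_side(2)[OF s] _ center] s
    by (auto simp: separate_def mult.commute)
  show "orient (\<beta> b) (\<beta> c) (\<beta> a) * orient (\<beta> b) (\<beta> c) (\<beta> d) > 0"
    using orient_unchart_same_side[OF separate_imp_same_side(3)[OF s, unfolded same_side_sym(2)[of "\<tau> (2 * N + c)"]] _ center] s
    by (auto simp: separate_def)
  show "orient (\<beta> a) (\<beta> b) (\<beta> c) * orient (\<beta> a) (\<beta> b) (\<beta> d) > 0"
    using orient_unchart_same_side[OF separate_imp_same_side(1)[OF s] _ center] s
    by (auto simp: separate_def)
  show "orient (\<beta> c) (\<beta> d) (\<beta> a) * orient (\<beta> c) (\<beta> d) (\<beta> b) > 0"
    using orient_unchart_same_side[OF separate_imp_same_side(4)[OF s] _ center] s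
    by (auto simp: separate_def)
qed

text \<open>The listed edges and nonedges make \<open>X - s1 - s2 - Y\<close> an induced path with
  bases in the order \<open>s1, Y, X, s2\<close>, which is the situation of
  \<open>crossing_orientation\<close>.\<close>

lemma attached_crossing:
  assumes seg: "\<And>i. i < 2 * N + m \<Longrightarrow> f i = closed_segment (unchart x q (\<tau> i)) (t i) \<and> t i \<in> ball x r"
    and v: "s1 < m" "Y < m" "X < m" "s2 < m" "s1 \<noteq> s2" "s1 \<noteq> X" "s1 \<noteq> Y" "s2 \<noteq> X" "s2 \<noteq> Y" "X \<noteq> Y"
    and sep: "separate (\<tau> (2 * N + s1)) (\<tau> (2 * N + X)) (\<tau> (2 * N + Y)) (\<tau> (2 * N + s2))"
    and edges: "(s1, s2) \<in> set E \<or> (s2, s1) \<in> set E" "(X, s1) \<in> set E \<or> (s1, X) \<in> set E" "(Y, s2) \<in> set E \<or> (s2, Y) \<in> set E"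
    and nonedges: "(X, s2) \<notin> set E" "(s2, X) \<notin> set E" "(Y, s1) \<notin> set E" "(s1, Y) \<notin> set E" "(X, Y) \<notin> set E" "(Y, X) \<notin> set E"
  obtains p where "p \<in> f (2 * N + s1)" "p \<in> f (2 * N + s2)"
    "orient (\<beta> s1) (\<beta> s2) p * orient (\<beta> s1) (\<beta> s2) (\<beta> X) > 0"
proof -
  obtain p where p: "p \<in> f (2 * N + s1)" "p \<in> f (2 * N + s2)"
    using attached_adj[OF v(1,4,5)] edges(1) by blast
  have "orient (\<beta> s1) (\<beta> s2) p * orient (\<beta> s1) (\<beta> s2) (\<beta> X) > 0"
  proof (rule crossing_orientation[OF q _ refl _ _ refl _ _ refl _ _ refl _ sep p])
    show "f (2 * N + X) \<inter> f (2 * N + s1) \<noteq> {}" using attached_adj[of X s1] v edges(2) by blast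
    show "f (2 * N + Y) \<inter> f (2 * N + s2) \<noteq> {}" using attached_adj[of Y s2] v edges(3) by blast
    show "f (2 * N + X) \<inter> f (2 * N + s2) = {}" using attached_adj[of X s2] v nonedges by blast
    show "f (2 * N + Y) \<inter> f (2 * N + s1) = {}" using attached_adj[of Y s1] v nonedges by blast
    show "f (2 * N + X) \<inter> f (2 * N + Y) = {}" using attached_adj[of X Y] v nonedges by blast
  qed (use seg v in auto)
  then show ?thesis using that p by blast
qed

end

section \<open>The three separating graphs and their obstructions\<close>

text \<open>The triangle \<open>0, 2, 4\<close> with pendant vertices \<open>3, 5, 1\<close>, each
  opposite to its neighbour in the cyclic order. The induced paths used are
  \<open>3 - 0 - 4 - 1\<close>, \<open>5 - 2 - 0 - 3\<close> and
  \<open>1 - 4 - 2 - 5\<close>.\<close>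

definition net_edges :: "(nat \<times> nat) list" where
  "net_edges = [(0, 2), (2, 4), (0, 4), (1, 4), (3, 0), (5, 2)]"

text \<open>The path \<open>2 - 0 - 3 - 1\<close> and its copy shifted by four, on disjoint arcs of
  the cyclic order.\<close>

definition two_paths_edges :: "(nat \<times> nat) list" where
  "two_paths_edges = [(0, 3), (2, 0), (1, 3), (4, 7), (6, 4), (5, 7)]"

text \<open>The induced paths \<open>2 - 0 - 3 - 1\<close> and \<open>5 - 3 - 6 - 4\<close> share
  the vertex \<open>3\<close>. In \<open>fan_strings\<close> the string of \<open>6\<close> comes
  back from the left across the strings of \<open>0\<close> to \<open>4\<close>, which is the origin
  of its edges to \<open>0\<close>, \<open>1\<close> and \<open>2\<close>.\<close>

definition fan_edges :: "(nat \<times> nat) list" where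
  "fan_edges = [(0, 3), (3, 6), (0, 6), (2, 0), (2, 6), (1, 3), (1, 6), (5, 3), (4, 6)]"

text \<open>Far out on two rays the cross product of a point of each has the sign of the cross
  product of the directions, because the mixed term dominates when both \<open>S\<close> and
  \<open>T\<close> are large.\<close>

lemma cross_bilinear_dominant:
  fixes c0 c1 c2 k :: real
  assumes "k \<noteq> 0"
  shows "\<exists>K>0. \<forall>S\<ge>K. \<forall>T\<ge>K. (c0 + T * c1 + S * c2 + S * T * k) * k > 0"
proof -
  define B where "B = \<bar>c0\<bar> + \<bar>c1\<bar> + \<bar>c2\<bar> + 1"
  define K where "K = B / \<bar>k\<bar> + 1"
  have B: "B > 0" by (simp add: B_def add_nonneg_pos)
  have K: "K \<ge> 1" using B assms by (simp add: K_def)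
  have Kk: "K * \<bar>k\<bar> > B" using assms by (simp add: K_def distrib_right)
  have main: "\<bar>c0 + T * c1 + S * c2\<bar> < S * T * \<bar>k\<bar>" if "S \<ge> K" "T \<ge> K" for S T
  proof -
    \<comment> \<open>With \<open>M\<close> the larger parameter, the lower terms are at most
      \<open>M * B\<close>, while \<open>S * T\<close> is at least \<open>M * K\<close>.\<close>
    define M where "M = max S T"
    have M: "M \<ge> 1" "S \<le> M" "T \<le> M" using that K by (auto simp: M_def)
    have "\<bar>c0 + T * c1 + S * c2\<bar> \<le> \<bar>c0\<bar> + T * \<bar>c1\<bar> + S * \<bar>c2\<bar>"
      using that K abs_triangle_ineq[of "c0 + T * c1" "S * c2"] abs_triangle_ineq[of c0 "T * c1"]
      by (simp add: abs_mult)
    also have "\<dots> \<le> M * \<bar>c0\<bar> + M * \<bar>c1\<bar> + M * \<bar>c2\<bar>"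
      using M by (intro add_mono mult_right_mono) (auto simp: mult_right_mono[of 1 M "\<bar>c0\<bar>", simplified])
    also have "\<dots> \<le> M * B" using M by (simp add: B_def algebra_simps)
    also have "\<dots> < M * (K * \<bar>k\<bar>)" using Kk M by simp
    also have "\<dots> \<le> (S * T) * \<bar>k\<bar>"
    proof -
      have "M * K \<le> S * T"
        using that K by (cases "S \<le> T") (auto simp: M_def max_def mult.commute[of S T] intro!: mult_mono)
      then show ?thesis by (simp add: mult_right_mono flip: mult.assoc)
    qed
    finally show ?thesis .
  qed
  have "(c0 + T * c1 + S * c2 + S * T * k) * k > 0" if "S \<ge> K" "T \<ge> K" for S T
  proof (cases "k > 0")
    case True
    then have "c0 + T * c1 + S * c2 + S * T * k > 0" using main[OF that] by (simp add: abs_less_iff)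
    then show ?thesis using True by simp
  next
    case False
    then have "c0 + T * c1 + S * c2 + S * T * k < 0" using main[OF that] assms by (simp add: abs_less_iff)
    then show ?thesis using False assms by (simp add: mult_neg_neg)
  qed
  then show ?thesis using K by (intro exI[of _ K]) auto
qed

text \<open>
  The crossing sign of two rays depends only on their directions, and the truncation points on a
  large circle turn around its center as the directions do.
\<close>

lemma ray_ring_family:
  assumes rays: "\<And>i. i < 2 * N + m \<Longrightarrow> f i = ray_from (a i) (v i) \<and> v i \<noteq> 0"
    and adj: "\<And>i j. i < 2 * N + m \<Longrightarrow> j < 2 * N + m \<Longrightarrow> i \<noteq> j \<Longrightarrow> f i \<inter> f j \<noteq> {} \<longleftrightarrow> ring_adj N E i j"
    and N: "N \<ge> 4" and m: "m \<le> N"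
    and E: "\<And>a b. (a, b) \<in> set E \<Longrightarrow> a + 2 \<le> b \<and> b + 2 \<le> a + N \<or> b + 2 \<le> a \<and> a + 2 \<le> b + N"
  obtains R q g \<tau> where "ring_family 0 R q g \<tau> N m E"
    "\<And>i. i < 2 * N + m \<Longrightarrow> g i = closed_segment (unchart 0 q (\<tau> i)) (a i) \<and> a i \<in> ball 0 R"
    "\<And>i j p. i < 2 * N + m \<Longrightarrow> j < 2 * N + m \<Longrightarrow> p \<in> g i \<Longrightarrow> p \<in> g j \<Longrightarrow>
       \<exists>c\<ge>0. orient (unchart 0 q (\<tau> i)) (unchart 0 q (\<tau> j)) p = c * cross (v i) (v j)"
    "\<And>i j. i < 2 * N + m \<Longrightarrow> j < 2 * N + m \<Longrightarrow> cross (v i) (v j) \<noteq> 0 \<Longrightarrow>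
       cross (unchart 0 q (\<tau> i)) (unchart 0 q (\<tau> j)) * cross (v i) (v j) > 0"
proof -
  let ?n = "2 * N + m"
  \<comment> \<open>The expansion of
    \<open>cross (a i + S *\<^sub>R v i) (a j + T *\<^sub>R v j)\<close>.\<close>
  define C where "C i j S T = cross (a i) (a j) + T * cross (a i) (v j) + S * cross (v i) (a j) + S * T * cross (v i) (v j)" for i j S T
  \<comment> \<open>The inequalities between \<open>R\<close> and \<open>K\<close> will force the
    truncation parameters of both rays to be at least \<open>K\<close>.\<close>
  have ev: "\<forall>\<^sub>F R in at_top. norm (a i) < R \<and> (f i \<inter> f j \<noteq> {} \<longrightarrow> f i \<inter> f j \<inter> cball 0 R \<noteq> {})
     \<and> (cross (v i) (v j) \<noteq> 0 \<longrightarrow> (\<exists>K. R \<ge> norm (a i) + K * norm (v i) \<and> R \<ge> norm (a j) + K * norm (v j) \<and> 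
       (\<forall>S\<ge>K. \<forall>T\<ge>K. C i j S T * cross (v i) (v j) > 0)))" for i j
  proof (intro eventually_conj)
    show "\<forall>\<^sub>F R in at_top. norm (a i) < R" by (rule eventually_gt_at_top)
    show "\<forall>\<^sub>F R in at_top. f i \<inter> f j \<noteq> {} \<longrightarrow> f i \<inter> f j \<inter> cball 0 R \<noteq> {}"
    proof (cases "f i \<inter> f j = {}")
      case False
      then obtain p where p: "p \<in> f i \<inter> f j" by blast
      show ?thesis using eventually_ge_at_top[of "norm p"]
        by eventually_elim (use p in \<open>force\<close>)
    qed simp
    show "\<forall>\<^sub>F R in at_top. cross (v i) (v j) \<noteq> 0 \<longrightarrow> (\<exists>K. R \<ge> norm (a i) + K * norm (v i) \<and> R \<ge> norm (a j) + K * norm (v j) \<and> 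
       (\<forall>S\<ge>K. \<forall>T\<ge>K. C i j S T * cross (v i) (v j) > 0))"
    proof (cases "cross (v i) (v j) = 0")
      case False
      obtain K where K: "\<forall>S\<ge>K. \<forall>T\<ge>K. C i j S T * cross (v i) (v j) > 0"
        using cross_bilinear_dominant[OF False] unfolding C_def by blast
      show ?thesis
        using eventually_ge_at_top[of "norm (a i) + K * norm (v i)"] eventually_ge_at_top[of "norm (a j) + K * norm (v j)"]
        by eventually_elim (use K in blast)
    qed simp
  qed
  have "\<forall>\<^sub>F R in at_top. \<forall>i\<in>{..<?n}. \<forall>j\<in>{..<?n}. norm (a i) < R \<and> (f i \<inter> f j \<noteq> {} \<longrightarrow> f i \<inter> f j \<inter> cball 0 R \<noteq> {})
     \<and> (cross (v i) (v j) \<noteq> 0 \<longrightarrow> (\<exists>K. R \<ge> norm (a i) + K * norm (v i) \<and> R \<ge> norm (a j) + K * norm (v j) \<and> 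
       (\<forall>S\<ge>K. \<forall>T\<ge>K. C i j S T * cross (v i) (v j) > 0)))"
    by (intro eventually_ball_finite ballI ev finite_lessThan)
  from eventually_happens'[OF trivial_limit_at_top_linorder eventually_conj[OF this eventually_gt_at_top[of 0]]]
  obtain R where R: "R > 0" and "\<forall>i\<in>{..<?n}. \<forall>j\<in>{..<?n}. norm (a i) < R \<and> (f i \<inter> f j \<noteq> {} \<longrightarrow> f i \<inter> f j \<inter> cball 0 R \<noteq> {})
     \<and> (cross (v i) (v j) \<noteq> 0 \<longrightarrow> (\<exists>K. R \<ge> norm (a i) + K * norm (v i) \<and> R \<ge> norm (a j) + K * norm (v j) \<and> 
       (\<forall>S\<ge>K. \<forall>T\<ge>K. C i j S T * cross (v i) (v j) > 0)))"
    by (elim exE conjE) (rule that)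
  note Rall = this(2)
  have Ra: "norm (a i) < R" if "i < ?n" for i using Rall that by blast
  have RK: "\<exists>K. R \<ge> norm (a i) + K * norm (v i) \<and> R \<ge> norm (a j) + K * norm (v j) \<and> 
       (\<forall>S\<ge>K. \<forall>T\<ge>K. C i j S T * cross (v i) (v j) > 0)" if "i < ?n" "j < ?n" "cross (v i) (v j) \<noteq> 0" for i j
    using bspec[OF bspec[OF Rall], of i j] that by simp
  have Radj: "f i \<inter> f j \<noteq> {} \<longrightarrow> f i \<inter> f j \<inter> cball 0 R \<noteq> {}" if "i < ?n" "j < ?n" for i j
    using bspec[OF bspec[OF Rall], of i j] that by simp
  have "\<forall>i\<in>{..<?n}. \<exists>T>0. norm (a i + T *\<^sub>R v i) = R \<and> ray_from (a i) (v i) \<inter> cball 0 R = closed_segment (a i + T *\<^sub>R v i) (a i)"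
    using truncated_ray rays Ra by blast
  then obtain T where T: "\<forall>i\<in>{..<?n}. T i > 0 \<and> norm (a i + T i *\<^sub>R v i) = R \<and> ray_from (a i) (v i) \<inter> cball 0 R = closed_segment (a i + T i *\<^sub>R v i) (a i)"
    unfolding bchoice_iff by (elim exE)
  define b where "b i = a i + T i *\<^sub>R v i" for i
  define g where "g i = f i \<inter> cball 0 R" for i
  have g: "g i = closed_segment (b i) (a i) \<and> b i \<in> sphere 0 R \<and> a i \<in> ball 0 R" if i: "i < ?n" for i
    using bspec[OF T, of i] rays[OF i] Ra[OF i] i by (simp add: g_def b_def)
  have gadj: "g i \<inter> g j \<noteq> {} \<longleftrightarrow> ring_adj N E i j" if "i < ?n" "j < ?n" "i \<noteq> j" for i j
  proof -
    have "g i \<inter> g j = f i \<inter> f j \<inter> cball 0 R" by (auto simp: g_def)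
    then show ?thesis using Radj[OF that(1,2)] adj[OF that] by blast
  qed
  obtain q \<tau> where fam: "ring_family 0 R q g \<tau> N m E" and \<tau>: "\<And>i. i < ?n \<Longrightarrow> unchart 0 q (\<tau> i) = b i"
    using ring_family_of_segments[OF R g gadj N m E] by blast
  show ?thesis
  proof (rule that[OF fam])
    show "g i = closed_segment (unchart 0 q (\<tau> i)) (a i) \<and> a i \<in> ball 0 R" if "i < ?n" for i
      using g[OF that] \<tau>[OF that] by simp
    show "\<exists>c\<ge>0. orient (unchart 0 q (\<tau> i)) (unchart 0 q (\<tau> j)) p = c * cross (v i) (v j)"
      if ij: "i < ?n" "j < ?n" and p: "p \<in> g i" "p \<in> g j" for i j p
    proof -
      \<comment> \<open>Seen from the base \<open>b k\<close> on the circle, the points of a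
        truncated ray lie backwards along \<open>v k\<close>.\<close>
      have "\<exists>c\<ge>0. p = b k - c *\<^sub>R v k" if k: "k < ?n" "p \<in> g k" for k
      proof -
        have "p \<in> closed_segment (b k) (a k)" using k(2) g[OF k(1)] by simp
        then obtain u where u: "0 \<le> u" "u \<le> 1" "p = (1 - u) *\<^sub>R b k + u *\<^sub>R a k"
          unfolding in_segment by blast
        then have "p = b k - (u * T k) *\<^sub>R v k" by (simp add: b_def algebra_simps)
        moreover have "u * T k \<ge> 0" using u bspec[OF T, of k] k by simp
        ultimately show ?thesis by blast
      qed
      then obtain c d where cd: "c \<ge> 0" "p = b i - c *\<^sub>R v i" "d \<ge> 0" "p = b j - d *\<^sub>R v j" using ij p by metis
      have bj: "b j = b i - c *\<^sub>R v i + d *\<^sub>R v j" using cd by (metis diff_add_cancel)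
      have "orient (b i) (b j) p = (c * d) * cross (v i) (v j)"
        unfolding orient_def cd(2) bj by (simp add: cross_def algebra_simps)
      then show ?thesis using cd \<tau> ij by (intro exI[of _ "c * d"]) simp
    qed
    show "cross (unchart 0 q (\<tau> i)) (unchart 0 q (\<tau> j)) * cross (v i) (v j) > 0"
      if ij: "i < ?n" "j < ?n" and ne: "cross (v i) (v j) \<noteq> 0" for i j
    proof -
      obtain K where K: "R \<ge> norm (a i) + K * norm (v i)" "R \<ge> norm (a j) + K * norm (v j)"
        "\<And>S T. S \<ge> K \<Longrightarrow> T \<ge> K \<Longrightarrow> C i j S T * cross (v i) (v j) > 0"
        using RK[OF ij ne] by blast
      have "T k \<ge> K" if k: "k < ?n" "R \<ge> norm (a k) + K * norm (v k)" for k
      proof -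
        have Tk: "T k > 0" "R = norm (a k + T k *\<^sub>R v k)" using bspec[OF T, of k] k by auto
        then have "R \<le> norm (a k) + T k * norm (v k)"
          using norm_triangle_ineq[of "a k" "T k *\<^sub>R v k"] by simp
        then have "K * norm (v k) \<le> T k * norm (v k)" using k(2) by linarith
        then show ?thesis using rays[OF k(1)] by simp
      qed
      then have "C i j (T i) (T j) * cross (v i) (v j) > 0" using K ij by blast
      moreover have "C i j (T i) (T j) = cross (b i) (b j)"
        by (simp add: C_def b_def cross_def algebra_simps)
      ultimately show ?thesis using \<tau> ij by simp
    qed
  qed
qed

text \<open>Segment \<open>3\<close> must cross segment \<open>0\<close> on the side of the line
  \<open>0 3\<close> away from base \<open>6\<close>, and segment \<open>6\<close> on the side of
  the line \<open>3 6\<close> away from base \<open>0\<close>. Its direction then balances the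
  directions to the bases \<open>0\<close> and \<open>6\<close>, so base \<open>3\<close> is a
  convex combination of these bases and the inner tip, impossible for a point of the circle.\<close>

lemma outer_segments_not_fan:
  assumes "\<And>i. i < 23 \<Longrightarrow> outer_segment x r (f i)" and r: "r > 0"
    and adj: "\<And>i j. i < 23 \<Longrightarrow> j < 23 \<Longrightarrow> i \<noteq> j \<Longrightarrow> f i \<inter> f j \<noteq> {} \<longleftrightarrow> ring_adj 8 fan_edges i j"
  shows False
proof -
  have "\<forall>i\<in>{..<23}. \<exists>c. f i = closed_segment (fst c) (snd c) \<and> fst c \<in> sphere x r \<and> snd c \<in> ball x r"
    using outer_segment_ends assms(1) by fastforce
  then obtain c where c: "\<forall>i\<in>{..<23}. f i = closed_segment (fst (c i)) (snd (c i)) \<and> fst (c i) \<in> sphere x r \<and> snd (c i) \<in> ball x r"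
    unfolding bchoice_iff by (elim exE)
  obtain q \<tau> where fam: "ring_family x r q f \<tau> 8 7 fan_edges" and \<tau>: "\<And>i. i < 2 * 8 + 7 \<Longrightarrow> unchart x q (\<tau> i) = fst (c i)"
  proof (rule ring_family_of_segments[of r 8 7 f "\<lambda>i. fst (c i)" "\<lambda>i. snd (c i)" x fan_edges])
    show "a + 2 \<le> b \<and> b + 2 \<le> a + 8 \<or> b + 2 \<le> a \<and> a + 2 \<le> b + 8" if "(a, b) \<in> set fan_edges" for a b
      using that by (auto simp: fan_edges_def)
  qed (use r c adj in auto)
  interpret ring_family x r q f \<tau> 8 7 fan_edges by (rule fam)
  let ?\<beta> = "\<lambda>v. unchart x q (\<tau> (2 * 8 + v))"
  have seg: "f i = closed_segment (unchart x q (\<tau> i)) (snd (c i)) \<and> snd (c i) \<in> ball x r" if "i < 2 * 8 + 7" for i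
    using c that \<tau>[OF that] by simp
  have sep: "separate (\<tau> (2 * 8 + a)) (\<tau> (2 * 8 + c)) (\<tau> (2 * 8 + b)) (\<tau> (2 * 8 + d))"
    if "a < b" "b < c" "c < d" "d < 7" for a b c d
    using attached_order that by blast
  \<comment> \<open>The vertices are passed in the order \<open>s1, Y, X, s2\<close>, so this is the
    path \<open>2 - 0 - 3 - 1\<close>; the next step is for \<open>5 - 3 - 6 - 4\<close>.\<close>
  obtain p where p: "p \<in> f (2 * 8 + 0)" "p \<in> f (2 * 8 + 3)" "orient (?\<beta> 0) (?\<beta> 3) p * orient (?\<beta> 0) (?\<beta> 3) (?\<beta> 2) > 0"
    by (rule attached_crossing[OF seg, of 0 1 2 3, OF _ _ _ _ _ _ _ _ _ _ _ sep[of 0 1 2 3]]) (auto simp: fan_edges_def)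
  obtain p' where p': "p' \<in> f (2 * 8 + 3)" "p' \<in> f (2 * 8 + 6)" "orient (?\<beta> 3) (?\<beta> 6) p' * orient (?\<beta> 3) (?\<beta> 6) (?\<beta> 5) > 0"
    by (rule attached_crossing[OF seg, of 3 4 5 6, OF _ _ _ _ _ _ _ _ _ _ _ sep[of 3 4 5 6]]) (auto simp: fan_edges_def)
  have o1: "orient (?\<beta> 0) (?\<beta> 3) (?\<beta> 2) * orient (?\<beta> 0) (?\<beta> 3) (?\<beta> 6) < 0" using attached_orient(1)[of 0 2 3 6] by simp
  have o2: "orient (?\<beta> 3) (?\<beta> 6) (?\<beta> 0) * orient (?\<beta> 3) (?\<beta> 6) (?\<beta> 5) < 0" using attached_orient(2)[of 0 3 5 6] by simp
  define t where "t = snd (c (2 * 8 + 3))"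
  have t: "f (2 * 8 + 3) = closed_segment (?\<beta> 3) t" "t \<in> ball x r" using seg[of "2 * 8 + 3"] by (auto simp: t_def)
  have on: "z = ?\<beta> 3 + l *\<^sub>R (t - ?\<beta> 3)" if "z = (1 - l) *\<^sub>R ?\<beta> 3 + l *\<^sub>R t" for z l
    using that by (simp add: algebra_simps)
  \<comment> \<open>Both crossing points lie on one half-line from base \<open>3\<close>, so both
    signs are statements about the same direction \<open>t - \<beta> 3\<close>.\<close>
  obtain l where l: "l \<ge> 0" "p = ?\<beta> 3 + l *\<^sub>R (t - ?\<beta> 3)" using p(2) on unfolding t(1) in_segment by blast
  obtain l' where l': "l' \<ge> 0" "p' = ?\<beta> 3 + l' *\<^sub>R (t - ?\<beta> 3)" using p'(1) on unfolding t(1) in_segment by blast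
  define u v w where "u = ?\<beta> 0 - ?\<beta> 3" and "v = t - ?\<beta> 3" and "w = ?\<beta> 6 - ?\<beta> 3"
  have e1: "orient (?\<beta> 0) (?\<beta> 3) p = - l * cross u v" "orient (?\<beta> 0) (?\<beta> 3) (?\<beta> 6) = cross w u"
    unfolding l(2) by (simp_all add: orient_def cross_def u_def v_def w_def algebra_simps)
  have e2: "orient (?\<beta> 3) (?\<beta> 6) p' = l' * cross w v" "orient (?\<beta> 3) (?\<beta> 6) (?\<beta> 0) = cross w u"
    unfolding l'(2) by (simp_all add: orient_def cross_def u_def v_def w_def algebra_simps)
  have neg: "x * z < 0" if "x * y > 0" "y * z < 0" for x y z :: real
    using that by (auto simp: zero_less_mult_iff mult_less_0_iff)
  have "(- l * cross u v) * cross w u < 0" using neg[OF p(3) o1] unfolding e1 .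
  then have "l * (cross u v * cross w u) > 0" by simp
  then have A: "cross u v * cross w u > 0" using l(1) by (simp add: zero_less_mult_iff)
  have "orient (?\<beta> 3) (?\<beta> 6) (?\<beta> 5) * orient (?\<beta> 3) (?\<beta> 6) (?\<beta> 0) < 0" using o2 by (simp add: mult.commute)
  then have "(l' * cross w v) * cross w u < 0" using neg[OF p'(3)] unfolding e2 by blast
  then have "l' * (cross w v * cross w u) < 0" by simp
  then have "cross w v * cross w u < 0" using l'(1) by (simp add: mult_less_0_iff)
  then have B: "cross v w * cross w u > 0" by (simp add: cross_def algebra_simps)
  \<comment> \<open>The coefficients of the linear dependence of three plane vectors, multiplied by
    \<open>cross w u\<close> so that all become positive.\<close>
  define \<alpha> \<gamma> \<delta> where "\<alpha> = cross v w * cross w u" and "\<gamma> = cross u v * cross w u" and "\<delta> = (cross w u)\<^sup>2"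
  have pos: "\<alpha> > 0" "\<gamma> > 0" "\<delta> > 0" using A B by (auto simp: \<alpha>_def \<gamma>_def \<delta>_def zero_less_mult_iff)
  define \<sigma> where "\<sigma> = \<alpha> + \<gamma> + \<delta>"
  have \<sigma>: "\<sigma> > 0" using pos by (simp add: \<sigma>_def)
  have "\<alpha> *\<^sub>R u + \<gamma> *\<^sub>R w + \<delta> *\<^sub>R v = 0"
    by (simp add: \<alpha>_def \<gamma>_def \<delta>_def cross_def complex_eq_iff power2_eq_square algebra_simps)
  then have "\<sigma> *\<^sub>R ?\<beta> 3 = \<alpha> *\<^sub>R ?\<beta> 0 + \<gamma> *\<^sub>R ?\<beta> 6 + \<delta> *\<^sub>R t"
    by (simp add: u_def v_def w_def \<sigma>_def algebra_simps)
  then have "(1 / \<sigma>) *\<^sub>R (\<sigma> *\<^sub>R ?\<beta> 3) = (1 / \<sigma>) *\<^sub>R (\<alpha> *\<^sub>R ?\<beta> 0 + \<gamma> *\<^sub>R ?\<beta> 6 + \<delta> *\<^sub>R t)" by simp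
  then have "?\<beta> 3 = (\<alpha> / \<sigma>) *\<^sub>R ?\<beta> 0 + (\<gamma> / \<sigma>) *\<^sub>R ?\<beta> 6 + (\<delta> / \<sigma>) *\<^sub>R t"
    using \<sigma> by (simp add: scaleR_right_distrib)
  also have "\<dots> \<in> ball x r"
  proof (rule convex_combination_in_ball)
    show "\<alpha> / \<sigma> + \<gamma> / \<sigma> + \<delta> / \<sigma> = 1" using \<sigma> by (simp add: \<sigma>_def flip: add_divide_distrib)
    have "?\<beta> v \<in> sphere x r" for v using unchart_mem(2)[of "\<tau> (2 * 8 + v)" q x r] q by simp
    then show "?\<beta> 0 \<in> cball x r" "?\<beta> 6 \<in> cball x r" using sphere_cball by blast+
  qed (use t pos \<sigma> in auto)
  finally have "?\<beta> 3 \<in> ball x r" .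
  moreover have "?\<beta> 3 \<in> sphere x r" using unchart_mem(2)[of "\<tau> (2 * 8 + 3)" q x r] q by simp
  ultimately show False by simp
qed

text \<open>Each of the three induced paths of the net fixes the sign of the cross product of two of
  the directions at \<open>0\<close>, \<open>2\<close>, \<open>4\<close>. The signs agree with the
  orientation of the triangle of bases, so the directions positively span the plane and cannot all
  point downward.\<close>

lemma downward_rays_not_net:
  assumes rays: "\<And>i. i < 18 \<Longrightarrow> is_downward_ray (f i)"
    and adj: "\<And>i j. i < 18 \<Longrightarrow> j < 18 \<Longrightarrow> i \<noteq> j \<Longrightarrow> f i \<inter> f j \<noteq> {} \<longleftrightarrow> ring_adj 6 net_edges i j"
  shows False
proof -
  have down: "\<exists>c. f i = ray_from (fst c) (snd c) \<and> Im (snd c) < 0" if i: "i < 18" for i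
  proof -
    obtain a v where av: "v \<noteq> 0" "f i = ray_from a v" "\<forall>z \<in> f i - {a}. Im z < Im a"
      using rays[OF i] unfolding is_downward_ray_def by blast
    have "a + 1 *\<^sub>R v \<in> f i" unfolding av(2) ray_from_def by (intro CollectI exI[of _ 1]) simp
    then have "a + 1 *\<^sub>R v \<in> f i - {a}" using av(1) by simp
    then have "Im (a + 1 *\<^sub>R v) < Im a" using av(3) by blast
    then show ?thesis using av(2) by (intro exI[of _ "(a, v)"]) simp
  qed
  then have "\<forall>i\<in>{..<18}. \<exists>c. f i = ray_from (fst c) (snd c) \<and> Im (snd c) < 0" by blast
  then obtain c where c: "\<forall>i\<in>{..<18}. f i = ray_from (fst (c i)) (snd (c i)) \<and> Im (snd (c i)) < 0"
    unfolding bchoice_iff by (elim exE)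
  define v where "v i = snd (c i)" for i
  have rays': "f i = ray_from (fst (c i)) (v i) \<and> v i \<noteq> 0" if "i < 2 * 6 + 6" for i
    using bspec[OF c, of i] that by (auto simp: v_def)
  have adj': "f i \<inter> f j \<noteq> {} \<longleftrightarrow> ring_adj 6 net_edges i j" if "i < 2 * 6 + 6" "j < 2 * 6 + 6" "i \<noteq> j" for i j
    using adj that by simp
  have E': "a + 2 \<le> b \<and> b + 2 \<le> a + 6 \<or> b + 2 \<le> a \<and> a + 2 \<le> b + 6" if "(a, b) \<in> set net_edges" for a b
    using that by (auto simp: net_edges_def)
  obtain R q g \<tau> where fam: "ring_family 0 R q g \<tau> 6 6 net_edges"
    and seg: "\<And>i. i < 2 * 6 + 6 \<Longrightarrow> g i = closed_segment (unchart 0 q (\<tau> i)) (fst (c i)) \<and> fst (c i) \<in> ball 0 R"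
    and sgn: "\<And>i j p. i < 2 * 6 + 6 \<Longrightarrow> j < 2 * 6 + 6 \<Longrightarrow> p \<in> g i \<Longrightarrow> p \<in> g j \<Longrightarrow>
       \<exists>c\<ge>0. orient (unchart 0 q (\<tau> i)) (unchart 0 q (\<tau> j)) p = c * cross (v i) (v j)"
    by (rule ray_ring_family[of 6 6 f "\<lambda>i. fst (c i)" v net_edges, OF rays' adj' _ _ E']) auto
  interpret ring_family 0 R q g \<tau> 6 6 net_edges by (rule fam)
  let ?\<beta> = "\<lambda>v. unchart 0 q (\<tau> (2 * 6 + v))"
  \<comment> \<open>Three rotations of the cyclic order, one for each path, so that
    \<open>s1\<close> comes first.\<close>
  have sep: "separate (\<tau> (2 * 6 + a)) (\<tau> (2 * 6 + c)) (\<tau> (2 * 6 + b)) (\<tau> (2 * 6 + d))"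
    "separate (\<tau> (2 * 6 + b)) (\<tau> (2 * 6 + d)) (\<tau> (2 * 6 + c)) (\<tau> (2 * 6 + a))"
    "separate (\<tau> (2 * 6 + c)) (\<tau> (2 * 6 + a)) (\<tau> (2 * 6 + d)) (\<tau> (2 * 6 + b))"
    if "a < b" "b < c" "c < d" "d < 6" for a b c d
    using attached_order[OF that] separate_commute by blast+
  obtain p1 where p1: "p1 \<in> g (2 * 6 + 0)" "p1 \<in> g (2 * 6 + 4)" "orient (?\<beta> 0) (?\<beta> 4) p1 * orient (?\<beta> 0) (?\<beta> 4) (?\<beta> 3) > 0"
    by (rule attached_crossing[OF seg, of 0 1 3 4, OF _ _ _ _ _ _ _ _ _ _ _ sep(1)[of 0 1 3 4]]) (auto simp: net_edges_def)
  obtain p2 where p2: "p2 \<in> g (2 * 6 + 2)" "p2 \<in> g (2 * 6 + 0)" "orient (?\<beta> 2) (?\<beta> 0) p2 * orient (?\<beta> 2) (?\<beta> 0) (?\<beta> 5) > 0"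
    by (rule attached_crossing[OF seg, of 2 3 5 0, OF _ _ _ _ _ _ _ _ _ _ _ sep(2)[of 0 2 3 5]]) (auto simp: net_edges_def)
  obtain p3 where p3: "p3 \<in> g (2 * 6 + 4)" "p3 \<in> g (2 * 6 + 2)" "orient (?\<beta> 4) (?\<beta> 2) p3 * orient (?\<beta> 4) (?\<beta> 2) (?\<beta> 1) > 0"
    by (rule attached_crossing[OF seg, of 4 5 1 2, OF _ _ _ _ _ _ _ _ _ _ _ sep(3)[of 1 2 4 5]]) (auto simp: net_edges_def)
  have flip: "orient b a z = - orient a b z" "orient b z a = orient a b z" for a b z
    by (simp_all add: orient_def cross_def algebra_simps)
  define D where "D = orient (?\<beta> 0) (?\<beta> 4) (?\<beta> 2)"
  have D: "orient (?\<beta> 2) (?\<beta> 0) (?\<beta> 4) = D" "orient (?\<beta> 4) (?\<beta> 2) (?\<beta> 0) = D"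
    by (simp_all add: D_def orient_def cross_def algebra_simps)
  have pos: "x * z > 0" if "x * y > 0" "y * z > 0" for x y z :: real
    using that by (auto simp: zero_less_mult_iff)
  \<comment> \<open>Passes from the side of the crossing point to the directions: the factor
    \<open>c\<close> is nonnegative, and a zero product is excluded by strictness.\<close>
  have dir: "cross (v i) (v j) * d > 0" if "c \<ge> 0" "s = c * cross (v i) (v j)" "s * d > 0" for c s d i j
  proof (rule ccontr)
    assume "\<not> cross (v i) (v j) * d > 0"
    then have "c * (cross (v i) (v j) * d) \<le> 0" using mult_nonneg_nonpos[OF that(1), of "cross (v i) (v j) * d"] by simp
    then show False using that(2,3) by (simp add: mult.assoc)
  qed
  have "orient (?\<beta> 0) (?\<beta> 4) (?\<beta> 3) * D > 0"
    using attached_orient(3)[of 0 2 3 4] by (simp add: D_def mult.commute)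
  then have "orient (?\<beta> 0) (?\<beta> 4) p1 * D > 0" by (rule pos[OF p1(3)])
  then have 1: "cross (v (2 * 6 + 0)) (v (2 * 6 + 4)) * D > 0"
    using sgn[OF _ _ p1(1,2)] dir by auto
  have "orient (?\<beta> 0) (?\<beta> 2) (?\<beta> 4) * orient (?\<beta> 0) (?\<beta> 2) (?\<beta> 5) > 0"
    using attached_orient(5)[of 0 2 4 5] by simp
  then have "orient (?\<beta> 2) (?\<beta> 0) (?\<beta> 5) * D > 0"
    unfolding D(1)[symmetric] flip(1)[of "?\<beta> 0" "?\<beta> 2"] by (simp add: mult.commute)
  then have "orient (?\<beta> 2) (?\<beta> 0) p2 * D > 0" by (rule pos[OF p2(3)])
  then have 2: "cross (v (2 * 6 + 2)) (v (2 * 6 + 0)) * D > 0"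
    using sgn[OF _ _ p2(1,2)] dir by auto
  have "orient (?\<beta> 2) (?\<beta> 4) (?\<beta> 0) * orient (?\<beta> 2) (?\<beta> 4) (?\<beta> 1) > 0"
    using attached_orient(6)[of 0 1 2 4] by simp
  then have "orient (?\<beta> 4) (?\<beta> 2) (?\<beta> 1) * D > 0"
    unfolding D(2)[symmetric] flip(1)[of "?\<beta> 2" "?\<beta> 4"] by (simp add: mult.commute)
  then have "orient (?\<beta> 4) (?\<beta> 2) p3 * D > 0" by (rule pos[OF p3(3)])
  then have 3: "cross (v (2 * 6 + 4)) (v (2 * 6 + 2)) * D > 0"
    using sgn[OF _ _ p3(1,2)] dir by auto
  define a1 a2 a3 where "a1 = v (2 * 6 + 0)" and "a2 = v (2 * 6 + 2)" and "a3 = v (2 * 6 + 4)"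
  have im: "Im a1 < 0" "Im a2 < 0" "Im a3 < 0" using c by (auto simp: a1_def a2_def a3_def v_def)
  \<comment> \<open>The linear dependence of three plane vectors, read in the imaginary
    parts.\<close>
  have id: "cross a3 a2 * D * Im a1 + cross a1 a3 * D * Im a2 + cross a2 a1 * D * Im a3 = 0"
    by (simp add: cross_def algebra_simps)
  have "cross a3 a2 * D * Im a1 < 0" "cross a1 a3 * D * Im a2 < 0" "cross a2 a1 * D * Im a3 < 0"
    using 1 2 3 im by (auto simp: a1_def a2_def a3_def intro: mult_pos_neg)
  then show False using id by linarith
qed

text \<open>By \<open>cross_unchart\<close>, the sign of \<open>1 + a * b\<close> decides whether
  the arc of more than a half turn between the parameters \<open>a\<close> and \<open>b\<close> is
  the interval between them or its complement. The hypotheses put \<open>c\<close> and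
  \<open>d\<close> outside that arc, and \<open>a\<close> and \<open>b\<close> outside the wide arc
  of \<open>c\<close> and \<open>d\<close>; two disjoint arcs of more than a half turn do not fit on
  a circle.\<close>

lemma wide_arcs_not_disjoint:
  fixes a b c d :: real
  assumes "(1 + a * b) * ((c - a) * (c - b)) < 0" "(1 + a * b) * ((d - a) * (d - b)) < 0"
    "(1 + c * d) * ((a - c) * (a - d)) < 0" "(1 + c * d) * ((b - c) * (b - d)) < 0"
  shows False
proof -
  have main: False if "a < b" "c < d"
    "(1 + a * b) * ((c - a) * (c - b)) < 0" "(1 + a * b) * ((d - a) * (d - b)) < 0"
    "(1 + c * d) * ((a - c) * (a - d)) < 0" "(1 + c * d) * ((b - c) * (b - d)) < 0" for a b c d :: real
  proof -
    have ins: "(z - x) * (z - y) < 0 \<longleftrightarrow> x < z \<and> z < y" "(z - x) * (z - y) > 0 \<longleftrightarrow> z < x \<or> y < z" if "x < y" for x y z :: real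
      using that by (auto simp: mult_less_0_iff zero_less_mult_iff)
    \<comment> \<open>An interval around \<open>0\<close> that covers more than a half turn cannot
      lie in one that covers less.\<close>
    have mono: "s * t \<le> - 1" if "s \<le> y" "y < 0" "0 < z" "z \<le> t" "y * z < - 1" for s t y z :: real
    proof -
      have "(- y) * z \<le> (- s) * t" by (rule mult_mono) (use that in linarith)+
      then show ?thesis using that by simp
    qed
    have sign: "s < 0 \<and> 0 < t" if "1 + s * t < 0" "s < t" for s t :: real
    proof -
      have "s * t < 0" using that by simp
      then show ?thesis using that(2) by (auto simp: mult_less_0_iff)
    qed
    show False
    proof (cases "1 + a * b < 0")
      case True
      then have out: "c < a \<or> b < c" "d < a \<or> b < d"
        using that ins[OF that(1)] by (auto simp: mult_less_0_iff)
      have ab: "a < 0" "0 < b" using sign[OF True that(1)] by auto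
      show False
      proof (cases "1 + c * d < 0")
        case True
        then have "a < c \<or> d < a" "b < c \<or> d < b"
          using that ins[OF that(2)] by (auto simp: mult_less_0_iff)
        then show False using sign[OF True that(2)] ab out that by auto
      next
        case False
        then have "c < a \<and> a < d" "c < b \<and> b < d" "1 + c * d > 0"
          using that ins[OF that(2)] by (auto simp: mult_less_0_iff)
        then show False using mono[of c a b d] ab True by auto
      qed
    next
      case False
      then have inn: "a < c \<and> c < b" "a < d \<and> d < b" "1 + a * b > 0"
        using that ins[OF that(1)] by (auto simp: mult_less_0_iff)
      show False
      proof (cases "1 + c * d < 0")
        case True
        then show False using mono[of a c d b] sign[OF True that(2)] inn by auto
      next
        case False
        then have "c < a \<and> a < d" "c < b \<and> b < d"
          using that ins[OF that(2)] by (auto simp: mult_less_0_iff)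
        then show False using inn by auto
      qed
    qed
  qed
  have ne: "a \<noteq> b" "c \<noteq> d"
  proof -
    have sq: "(1 + s * s) * ((z - s) * (z - s)) \<ge> 0" for s z :: real
      by (rule mult_nonneg_nonneg) (auto simp: add_nonneg_nonneg)
    show "a \<noteq> b"
    proof
      assume "a = b"
      then have "b = a" ..
      show False using sq[of a c] assms(1) unfolding \<open>b = a\<close> by linarith
    qed
    show "c \<noteq> d"
    proof
      assume "c = d"
      then have "d = c" ..
      show False using sq[of c a] assms(3) unfolding \<open>d = c\<close> by linarith
    qed
  qed
  show False
  proof (cases "a < b")
    case True
    show False
    proof (cases "c < d")
      case True then show False using main[OF \<open>a < b\<close> True] assms by blast
    next
      case False
      then show False using main[OF \<open>a < b\<close>, of d c] assms ne by (simp add: mult_ac)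
    qed
  next
    case False
    then have ba: "b < a" using ne by simp
    show False
    proof (cases "c < d")
      case True then show False using main[OF ba True] assms by (simp add: mult_ac)
    next
      case False
      then show False using main[OF ba, of d c] assms ne by (simp add: mult_ac)
    qed
  qed
qed

text \<open>Each path makes the arc between the bases of its inner vertices, taken over the bases of
  its outer ones, exceed a half turn, and the bases of the other path avoid this arc.\<close>

lemma rays_not_two_paths:
  assumes rays: "\<And>i. i < 24 \<Longrightarrow> is_ray (f i)"
    and adj: "\<And>i j. i < 24 \<Longrightarrow> j < 24 \<Longrightarrow> i \<noteq> j \<Longrightarrow> f i \<inter> f j \<noteq> {} \<longleftrightarrow> ring_adj 8 two_paths_edges i j"
  shows False
proof -
  have "\<forall>i\<in>{..<24}. \<exists>c. f i = ray_from (fst c) (snd c) \<and> snd c \<noteq> 0"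
    using rays unfolding is_ray_def by fastforce
  then obtain c where c: "\<forall>i\<in>{..<24}. f i = ray_from (fst (c i)) (snd (c i)) \<and> snd (c i) \<noteq> 0"
    unfolding bchoice_iff by (elim exE)
  define v where "v i = snd (c i)" for i
  have rays': "f i = ray_from (fst (c i)) (v i) \<and> v i \<noteq> 0" if "i < 2 * 8 + 8" for i
    using c that by (auto simp: v_def)
  have adj': "f i \<inter> f j \<noteq> {} \<longleftrightarrow> ring_adj 8 two_paths_edges i j" if "i < 2 * 8 + 8" "j < 2 * 8 + 8" "i \<noteq> j" for i j
    using adj that by simp
  have E': "a + 2 \<le> b \<and> b + 2 \<le> a + 8 \<or> b + 2 \<le> a \<and> a + 2 \<le> b + 8" if "(a, b) \<in> set two_paths_edges" for a b
    using that by (auto simp: two_paths_edges_def)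
  obtain R q g \<tau> where fam: "ring_family 0 R q g \<tau> 8 8 two_paths_edges"
    and seg: "\<And>i. i < 2 * 8 + 8 \<Longrightarrow> g i = closed_segment (unchart 0 q (\<tau> i)) (fst (c i)) \<and> fst (c i) \<in> ball 0 R"
    and sgn: "\<And>i j p. i < 2 * 8 + 8 \<Longrightarrow> j < 2 * 8 + 8 \<Longrightarrow> p \<in> g i \<Longrightarrow> p \<in> g j \<Longrightarrow>
       \<exists>c\<ge>0. orient (unchart 0 q (\<tau> i)) (unchart 0 q (\<tau> j)) p = c * cross (v i) (v j)"
    and big: "\<And>i j. i < 2 * 8 + 8 \<Longrightarrow> j < 2 * 8 + 8 \<Longrightarrow> cross (v i) (v j) \<noteq> 0 \<Longrightarrow>
       cross (unchart 0 q (\<tau> i)) (unchart 0 q (\<tau> j)) * cross (v i) (v j) > 0"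
    by (rule ray_ring_family[of 8 8 f "\<lambda>i. fst (c i)" v two_paths_edges, OF rays' adj' _ _ E']) auto
  interpret ring_family 0 R q g \<tau> 8 8 two_paths_edges by (rule fam)
  let ?\<beta> = "\<lambda>v. unchart 0 q (\<tau> (2 * 8 + v))"
  have sep: "separate (\<tau> (2 * 8 + a)) (\<tau> (2 * 8 + c)) (\<tau> (2 * 8 + b)) (\<tau> (2 * 8 + d))"
    if "a < b" "b < c" "c < d" "d < 8" for a b c d
    using attached_order[OF that] .
  obtain p1 where p1: "p1 \<in> g (2 * 8 + 0)" "p1 \<in> g (2 * 8 + 3)" "orient (?\<beta> 0) (?\<beta> 3) p1 * orient (?\<beta> 0) (?\<beta> 3) (?\<beta> 2) > 0"
    by (rule attached_crossing[OF seg, of 0 1 2 3, OF _ _ _ _ _ _ _ _ _ _ _ sep[of 0 1 2 3]]) (auto simp: two_paths_edges_def)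
  obtain p2 where p2: "p2 \<in> g (2 * 8 + 4)" "p2 \<in> g (2 * 8 + 7)" "orient (?\<beta> 4) (?\<beta> 7) p2 * orient (?\<beta> 4) (?\<beta> 7) (?\<beta> 6) > 0"
    by (rule attached_crossing[OF seg, of 4 5 6 7, OF _ _ _ _ _ _ _ _ _ _ _ sep[of 4 5 6 7]]) (auto simp: two_paths_edges_def)
  have pos: "x * z > 0" if "x * y > 0" "y * z > 0" for x y z :: real
    using that by (auto simp: zero_less_mult_iff)
  have neg: "x * z < 0" if "x * y > 0" "y * z < 0" for x y z :: real
    using that by (auto simp: zero_less_mult_iff mult_less_0_iff)
  \<comment> \<open>The crossing gives the sign for the directions; on the large circle the bases
    have the same sign around the center.\<close>
  have wide: "cross (?\<beta> a) (?\<beta> b) * orient (?\<beta> a) (?\<beta> b) z > 0"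
    if w: "p \<in> g (2 * 8 + a)" "p \<in> g (2 * 8 + b)" "orient (?\<beta> a) (?\<beta> b) p * orient (?\<beta> a) (?\<beta> b) z > 0" "a < 8" "b < 8" for a b p z
  proof -
    obtain k where k: "k \<ge> 0" "orient (?\<beta> a) (?\<beta> b) p = k * cross (v (2 * 8 + a)) (v (2 * 8 + b))"
      using sgn[of "2 * 8 + a" "2 * 8 + b" p] w by auto
    have "cross (v (2 * 8 + a)) (v (2 * 8 + b)) * orient (?\<beta> a) (?\<beta> b) z > 0"
    proof (rule ccontr)
      assume "\<not> cross (v (2 * 8 + a)) (v (2 * 8 + b)) * orient (?\<beta> a) (?\<beta> b) z > 0"
      then have "k * (cross (v (2 * 8 + a)) (v (2 * 8 + b)) * orient (?\<beta> a) (?\<beta> b) z) \<le> 0"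
        using mult_nonneg_nonpos[OF k(1), of "cross (v (2 * 8 + a)) (v (2 * 8 + b)) * orient (?\<beta> a) (?\<beta> b) z"] by simp
      then show False using w(3) unfolding k(2) by (simp add: mult.assoc)
    qed
    moreover then have "cross (v (2 * 8 + a)) (v (2 * 8 + b)) \<noteq> 0" by auto
    then have "cross (?\<beta> a) (?\<beta> b) * cross (v (2 * 8 + a)) (v (2 * 8 + b)) > 0"
      using big[of "2 * 8 + a" "2 * 8 + b"] w(4,5) by simp
    ultimately show ?thesis using pos by blast
  qed
  \<comment> \<open>Rewrites the sign in real parameters; the positive factors and the square of
    \<open>\<tau> (2 * 8 + b) - \<tau> (2 * 8 + a)\<close> drop out.\<close>
  have red: "(1 + \<tau> (2 * 8 + a) * \<tau> (2 * 8 + b)) * ((\<tau> (2 * 8 + e) - \<tau> (2 * 8 + a)) * (\<tau> (2 * 8 + e) - \<tau> (2 * 8 + b))) < 0"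
    if "cross (?\<beta> a) (?\<beta> b) * orient (?\<beta> a) (?\<beta> b) (?\<beta> e) < 0" for a b e
  proof -
    have cr: "\<exists>K>0. cross (?\<beta> a) (?\<beta> b) = K * ((1 + \<tau> (2 * 8 + a) * \<tau> (2 * 8 + b)) * (\<tau> (2 * 8 + b) - \<tau> (2 * 8 + a)))"
      using cross_unchart[of 0 q "\<tau> (2 * 8 + a)" "\<tau> (2 * 8 + b)"] center
      by (intro exI[of _ "2 * (cmod (q - 0))\<^sup>2 / ((1 + (\<tau> (2 * 8 + a))\<^sup>2) * (1 + (\<tau> (2 * 8 + b))\<^sup>2))"])
        (simp add: add_pos_nonneg)
    have orr: "\<exists>K>0. orient (?\<beta> a) (?\<beta> b) (?\<beta> e) = K * ((\<tau> (2 * 8 + b) - \<tau> (2 * 8 + a)) * (\<tau> (2 * 8 + e) - \<tau> (2 * 8 + a)) * (\<tau> (2 * 8 + e) - \<tau> (2 * 8 + b)))"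
      using orient_unchart[of 0 q "\<tau> (2 * 8 + a)" "\<tau> (2 * 8 + b)" "\<tau> (2 * 8 + e)"] center
      by (intro exI[of _ "4 * (cmod (q - 0))\<^sup>2 / ((1 + (\<tau> (2 * 8 + a))\<^sup>2) * (1 + (\<tau> (2 * 8 + b))\<^sup>2) * (1 + (\<tau> (2 * 8 + e))\<^sup>2))"])
        (simp add: add_pos_nonneg)
    obtain K K' where K: "K > 0" "K' > 0"
      "cross (?\<beta> a) (?\<beta> b) = K * ((1 + \<tau> (2 * 8 + a) * \<tau> (2 * 8 + b)) * (\<tau> (2 * 8 + b) - \<tau> (2 * 8 + a)))"
      "orient (?\<beta> a) (?\<beta> b) (?\<beta> e) = K' * ((\<tau> (2 * 8 + b) - \<tau> (2 * 8 + a)) * (\<tau> (2 * 8 + e) - \<tau> (2 * 8 + a)) * (\<tau> (2 * 8 + e) - \<tau> (2 * 8 + b)))"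
      using cr orr by blast
    have "cross (?\<beta> a) (?\<beta> b) * orient (?\<beta> a) (?\<beta> b) (?\<beta> e) = (K * K' * (\<tau> (2 * 8 + b) - \<tau> (2 * 8 + a))\<^sup>2) *
       ((1 + \<tau> (2 * 8 + a) * \<tau> (2 * 8 + b)) * ((\<tau> (2 * 8 + e) - \<tau> (2 * 8 + a)) * (\<tau> (2 * 8 + e) - \<tau> (2 * 8 + b))))"
      unfolding K(3,4) by (simp add: power2_eq_square mult_ac)
    moreover have "K * K' * (\<tau> (2 * 8 + b) - \<tau> (2 * 8 + a))\<^sup>2 \<ge> 0" using K(1,2) by simp
    ultimately show ?thesis using that by (metis mult_less_0_iff not_less)
  qed
  have "cross (?\<beta> 0) (?\<beta> 3) * orient (?\<beta> 0) (?\<beta> 3) (?\<beta> 4) < 0"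
    by (rule neg[OF wide[OF p1]]) (use attached_orient(1)[of 0 2 3 4] in auto)
  moreover have "cross (?\<beta> 0) (?\<beta> 3) * orient (?\<beta> 0) (?\<beta> 3) (?\<beta> 7) < 0"
    by (rule neg[OF wide[OF p1]]) (use attached_orient(1)[of 0 2 3 7] in auto)
  moreover have "cross (?\<beta> 4) (?\<beta> 7) * orient (?\<beta> 4) (?\<beta> 7) (?\<beta> 0) < 0"
    by (rule neg[OF wide[OF p2]]) (use attached_orient(2)[of 0 4 6 7] in \<open>auto simp: mult.commute\<close>)
  moreover have "cross (?\<beta> 4) (?\<beta> 7) * orient (?\<beta> 4) (?\<beta> 7) (?\<beta> 3) < 0"
    by (rule neg[OF wide[OF p2]]) (use attached_orient(2)[of 3 4 6 7] in \<open>auto simp: mult.commute\<close>)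
  ultimately show False using wide_arcs_not_disjoint red by blast
qed

subsection \<open>Outer segments in general position\<close>

text \<open>Cramer's rule for two nonparallel lines.\<close>

lemma lines_meet_iff:
  assumes "cross v w \<noteq> 0"
  shows "a + s *\<^sub>R v = b + t *\<^sub>R w \<longleftrightarrow> s = cross (b - a) w / cross v w \<and> t = cross (b - a) v / cross v w"
proof
  assume eq: "a + s *\<^sub>R v = b + t *\<^sub>R w"
  then have d: "b - a = s *\<^sub>R v - t *\<^sub>R w" by (simp add: algebra_simps)
  have "cross (b - a) w = s * cross v w" "cross (b - a) v = t * cross v w"
    unfolding d by (simp_all add: cross_def algebra_simps)
  then show "s = cross (b - a) w / cross v w \<and> t = cross (b - a) v / cross v w" using assms by simp
next
  assume "s = cross (b - a) w / cross v w \<and> t = cross (b - a) v / cross v w"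
  then have st: "s * cross v w = cross (b - a) w" "t * cross v w = cross (b - a) v" using assms by simp_all
  have "cross v w *\<^sub>R (b - a) = cross (b - a) w *\<^sub>R v - cross (b - a) v *\<^sub>R w"
    by (simp add: cross_def complex_eq_iff algebra_simps)
  also have "\<dots> = cross v w *\<^sub>R (s *\<^sub>R v - t *\<^sub>R w)"
    unfolding st[symmetric] by (simp add: scaleR_right_diff_distrib mult.commute)
  finally have "b - a = s *\<^sub>R v - t *\<^sub>R w" using assms by simp
  then show "a + s *\<^sub>R v = b + t *\<^sub>R w" by (simp add: algebra_simps)
qed


text \<open>Unlike a mere intersection, this is stable under small perturbations.\<close>

definition proper_crossing :: "complex \<Rightarrow> real \<Rightarrow> complex \<times> complex \<Rightarrow> complex \<times> complex \<Rightarrow> bool" where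
  "proper_crossing x \<rho> P Q \<longleftrightarrow> cross (snd P - fst P) (snd Q - fst Q) \<noteq> 0 \<and>
     (\<exists>s t. 0 < s \<and> s < 1 \<and> 0 < t \<and> t < 1 \<and> fst P + s *\<^sub>R (snd P - fst P) = fst Q + t *\<^sub>R (snd Q - fst Q) \<and>
        fst P + s *\<^sub>R (snd P - fst P) \<in> ball x \<rho>)"

abbreviation seg :: "complex \<times> complex \<Rightarrow> complex set" where
  "seg P \<equiv> closed_segment (fst P) (snd P)"

lemma cross_commute: "cross v u = - cross u v"
  by (simp add: cross_def)

lemma proper_crossing_sym: "proper_crossing x \<rho> P Q \<Longrightarrow> proper_crossing x \<rho> Q P"
proof -
  assume P: "proper_crossing x \<rho> P Q"
  then obtain s t where "0 < s" "s < 1" "0 < t" "t < 1" "fst P + s *\<^sub>R (snd P - fst P) = fst Q + t *\<^sub>R (snd Q - fst Q)"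
      "fst P + s *\<^sub>R (snd P - fst P) \<in> ball x \<rho>"
    unfolding proper_crossing_def by blast
  then show ?thesis
    using P cross_commute[of "snd P - fst P"] unfolding proper_crossing_def
    by (intro conjI exI[of _ t] exI[of _ s]) auto
qed

lemma seg_param: "z \<in> seg P \<longleftrightarrow> (\<exists>s. 0 \<le> s \<and> s \<le> 1 \<and> z = fst P + s *\<^sub>R (snd P - fst P))"
proof -
  have "(1 - s) *\<^sub>R fst P + s *\<^sub>R snd P = fst P + s *\<^sub>R (snd P - fst P)" for s by (simp add: algebra_simps)
  then show ?thesis unfolding in_segment by simp
qed

lemma proper_crossing_meet:
  assumes "proper_crossing x \<rho> P Q"
  shows "\<exists>p. p \<in> ball x \<rho> \<and> seg P \<inter> seg Q = {p}"
proof -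
  obtain s t where st: "0 < s" "s < 1" "0 < t" "t < 1" "fst P + s *\<^sub>R (snd P - fst P) = fst Q + t *\<^sub>R (snd Q - fst Q)"
      "fst P + s *\<^sub>R (snd P - fst P) \<in> ball x \<rho>" and ne: "cross (snd P - fst P) (snd Q - fst Q) \<noteq> 0"
    using assms unfolding proper_crossing_def by blast
  let ?p = "fst P + s *\<^sub>R (snd P - fst P)"
  have "?p \<in> seg P" "?p \<in> seg Q" unfolding seg_param using st by (auto intro: exI[of _ s] exI[of _ t])
  moreover have "z = ?p" if z: "z \<in> seg P" "z \<in> seg Q" for z
  proof -
    obtain s' t' where "z = fst P + s' *\<^sub>R (snd P - fst P)" "z = fst Q + t' *\<^sub>R (snd Q - fst Q)"
      using z unfolding seg_param by blast
    then show ?thesis using lines_meet_iff[OF ne] st(5) by metis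
  qed
  ultimately show ?thesis using st(6) by (intro exI[of _ ?p]) blast
qed

lemma tendsto_cross [tendsto_intros]:
  "(f \<longlongrightarrow> u) F \<Longrightarrow> (g \<longlongrightarrow> v) F \<Longrightarrow> ((\<lambda>n. cross (f n) (g n)) \<longlongrightarrow> cross u v) F"
  unfolding cross_def by (intro tendsto_intros)

text \<open>The parameters of the crossing are given by Cramer's rule, hence continuous where the
  determinant is nonzero, and all conditions are strict.\<close>

lemma proper_crossing_stable:
  assumes P: "proper_crossing x \<rho> (a, b) Q" and a: "(f \<longlongrightarrow> a) F" and b: "(g \<longlongrightarrow> b) F"
  shows "\<forall>\<^sub>F n in F. proper_crossing x \<rho> (f n, g n) Q"
proof -
  obtain c d where Q: "Q = (c, d)" by (cases Q)
  define D S T where "D a b = cross (b - a) (d - c)" and "S a b = cross (c - a) (d - c) / cross (b - a) (d - c)"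
    and "T a b = cross (c - a) (b - a) / cross (b - a) (d - c)" for a b
  have D: "D a b \<noteq> 0" using P by (simp add: proper_crossing_def Q D_def)
  then have "0 < S a b" "S a b < 1" "0 < T a b" "T a b < 1" "dist x (a + S a b *\<^sub>R (b - a)) < \<rho>"
    using P lines_meet_iff[of "b - a" "d - c" a _ c] by (auto simp: proper_crossing_def Q D_def S_def T_def)
  moreover have "((\<lambda>n. D (f n) (g n)) \<longlongrightarrow> D a b) F" unfolding D_def by (intro tendsto_intros a b)
  moreover have S: "((\<lambda>n. S (f n) (g n)) \<longlongrightarrow> S a b) F" unfolding S_def by (intro tendsto_intros a b) (use D in \<open>simp add: D_def\<close>)
  moreover have "((\<lambda>n. T (f n) (g n)) \<longlongrightarrow> T a b) F" unfolding T_def by (intro tendsto_intros a b) (use D in \<open>simp add: D_def\<close>)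
  moreover have "((\<lambda>n. dist x (f n + S (f n) (g n) *\<^sub>R (g n - f n))) \<longlongrightarrow> dist x (a + S a b *\<^sub>R (b - a))) F"
    by (intro tendsto_intros a b S)
  ultimately have "\<forall>\<^sub>F n in F. D (f n) (g n) \<noteq> 0 \<and> 0 < S (f n) (g n) \<and> S (f n) (g n) < 1 \<and> 0 < T (f n) (g n) \<and> T (f n) (g n) < 1
      \<and> dist x (f n + S (f n) (g n) *\<^sub>R (g n - f n)) < \<rho>"
    using D by (intro eventually_conj) (auto intro: tendsto_imp_eventually_ne order_tendstoD)
  then show ?thesis
  proof eventually_elim
    case (elim n)
    then have "cross (g n - f n) (d - c) \<noteq> 0" by (simp add: D_def)
    then have "f n + S (f n) (g n) *\<^sub>R (g n - f n) = c + T (f n) (g n) *\<^sub>R (d - c)"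
      unfolding lines_meet_iff[OF \<open>cross (g n - f n) (d - c) \<noteq> 0\<close>] by (simp add: S_def T_def)
    then show ?case unfolding proper_crossing_def Q using elim \<open>cross (g n - f n) (d - c) \<noteq> 0\<close>
      by (intro conjI exI[of _ "S (f n) (g n)"] exI[of _ "T (f n) (g n)"]) (simp_all add: D_def)
  qed
qed

text \<open>Disjoint compact segments have a positive distance \<open>\<delta>\<close>, and moving
  the ends by less than \<open>\<delta> / 2\<close> moves every point by less than that.\<close>

lemma disjoint_segments_stable:
  fixes a b c d :: complex
  assumes disj: "closed_segment a b \<inter> closed_segment c d = {}"
    and t: "(f \<longlongrightarrow> a) F" "(g \<longlongrightarrow> b) F" "(h \<longlongrightarrow> c) F" "(k \<longlongrightarrow> d) F"
  shows "\<forall>\<^sub>F n in F. closed_segment (f n) (g n) \<inter> closed_segment (h n) (k n) = {}"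
proof -
  obtain \<delta> where \<delta>: "\<delta> > 0" "\<And>y z. y \<in> closed_segment a b \<Longrightarrow> z \<in> closed_segment c d \<Longrightarrow> \<delta> \<le> dist y z"
    using separate_compact_closed[OF compact_segment closed_segment disj] by blast
  have near: "\<exists>y'\<in>closed_segment a b. dist y' y < \<delta> / 2"
    if nr: "dist a' a < \<delta> / 2" "dist b' b < \<delta> / 2" "y \<in> closed_segment a' b'" for a' b' a b y :: complex
  proof -
    obtain u where u: "0 \<le> u" "u \<le> 1" "y = (1 - u) *\<^sub>R a' + u *\<^sub>R b'" using nr(3) unfolding in_segment by blast
    have "dist ((1 - u) *\<^sub>R a + u *\<^sub>R b) y = norm ((1 - u) *\<^sub>R (a - a') + u *\<^sub>R (b - b'))"
      unfolding u(3) dist_norm by (simp add: algebra_simps)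
    also have "\<dots> \<le> (1 - u) * dist a' a + u * dist b' b"
      using norm_triangle_ineq[of "(1 - u) *\<^sub>R (a - a')" "u *\<^sub>R (b - b')"] u by (simp add: dist_norm norm_minus_commute)
    also have "\<dots> < \<delta> / 2"
      by (rule convex_bound_lt[OF nr(1,2)]) (use u in auto)
    finally have "dist ((1 - u) *\<^sub>R a + u *\<^sub>R b) y < \<delta> / 2" .
    moreover have "(1 - u) *\<^sub>R a + u *\<^sub>R b \<in> closed_segment a b" unfolding in_segment using u(1,2) by blast
    ultimately show ?thesis by blast
  qed
  have "\<forall>\<^sub>F n in F. dist (f n) a < \<delta> / 2 \<and> dist (g n) b < \<delta> / 2 \<and> dist (h n) c < \<delta> / 2 \<and> dist (k n) d < \<delta> / 2"
    using t \<delta>(1) by (intro eventually_conj tendstoD) auto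
  then show ?thesis
  proof eventually_elim
    case (elim n)
    show ?case
    proof (rule ccontr)
      assume "closed_segment (f n) (g n) \<inter> closed_segment (h n) (k n) \<noteq> {}"
      then obtain y where y: "y \<in> closed_segment (f n) (g n)" "y \<in> closed_segment (h n) (k n)" by blast
      obtain y1 where y1: "y1 \<in> closed_segment a b" "dist y1 y < \<delta> / 2" using near[OF elim[THEN conjunct1] elim[THEN conjunct2, THEN conjunct1] y(1)] by blast
      obtain y2 where y2: "y2 \<in> closed_segment c d" "dist y2 y < \<delta> / 2" 
        using near[OF elim[THEN conjunct2, THEN conjunct2, THEN conjunct1] elim[THEN conjunct2, THEN conjunct2, THEN conjunct2] y(2)] by blast
      have "dist y1 y2 < \<delta>" using dist_triangle_half_l[of y1 y \<delta> y2] y1(2) y2(2) by (simp add: dist_commute)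
      then show False using \<delta>(2)[OF y1(1) y2(1)] by simp
    qed
  qed
qed

definition rotated :: "complex \<Rightarrow> complex \<times> complex \<Rightarrow> real \<Rightarrow> complex \<times> complex" where
  "rotated z P \<theta> = (z + (fst P - z) * cis \<theta>, z + (snd P - z) * cis \<theta>)"

lemma rotated_tendsto:
  "((\<lambda>\<theta>. fst (rotated z P \<theta>)) \<longlongrightarrow> fst P) (at_right 0)" "((\<lambda>\<theta>. snd (rotated z P \<theta>)) \<longlongrightarrow> snd P) (at_right 0)"
proof -
  have "(cis \<longlongrightarrow> cis 0) (at_right 0)"
    unfolding cis_conv_exp[abs_def] by (intro tendsto_intros)
  then have c: "(cis \<longlongrightarrow> 1) (at_right 0)" by simp
  have "((\<lambda>\<theta>. z + (w - z) * cis \<theta>) \<longlongrightarrow> z + (w - z) * 1) (at_right 0)" for w by (intro tendsto_intros c)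
  then have "((\<lambda>\<theta>. z + (w - z) * cis \<theta>) \<longlongrightarrow> w) (at_right 0)" for w by simp
  then show "((\<lambda>\<theta>. fst (rotated z P \<theta>)) \<longlongrightarrow> fst P) (at_right 0)" "((\<lambda>\<theta>. snd (rotated z P \<theta>)) \<longlongrightarrow> snd P) (at_right 0)"
    unfolding rotated_def by simp_all
qed

lemma eventually_sin_pos: "\<forall>\<^sub>F \<theta> in at_right 0. sin \<theta> > (0 :: real)"
proof -
  have "\<forall>\<^sub>F \<theta> in at_right 0. (\<theta> :: real) \<in> {0<..<pi}" by (rule eventually_at_right_real) simp
  then show ?thesis by eventually_elim (simp add: sin_gt_zero)
qed

text \<open>This resolves an overlap: \<open>z\<close> is interior to both parallel segments and
  stays fixed, so after a small rotation they cross exactly there.\<close>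

lemma rotated_proper_crossing:
  assumes z: "z = fst P + \<sigma> *\<^sub>R (snd P - fst P)" "0 < \<sigma>" "\<sigma> < 1" "z \<in> ball x \<rho>"
    and zQ: "z = fst Q + s *\<^sub>R (snd Q - fst Q)" "0 < s" "s < 1"
    and par: "cross (snd P - fst P) (snd Q - fst Q) = 0" "fst P \<noteq> snd P" "fst Q \<noteq> snd Q"
  shows "\<forall>\<^sub>F \<theta> in at_right 0. proper_crossing x \<rho> (rotated z P \<theta>) Q"
  using eventually_sin_pos
proof eventually_elim
  case (elim \<theta>)
  define v w where "v = snd P - fst P" and "w = snd Q - fst Q"
  have ne: "v \<noteq> 0" "w \<noteq> 0" using par by (auto simp: v_def w_def)
  have dir: "snd (rotated z P \<theta>) - fst (rotated z P \<theta>) = v * cis \<theta>"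
    by (simp add: rotated_def v_def algebra_simps)
  \<comment> \<open>Lagrange's identity: parallel nonzero vectors have a nonzero inner product,
    which up to sign is the coefficient of \<open>sin \<theta>\<close> in the rotated
    determinant.\<close>
  have "(Re v * Re w + Im v * Im w)\<^sup>2 + (cross v w)\<^sup>2 = (cmod v)\<^sup>2 * (cmod w)\<^sup>2"
    unfolding cmod_power2 by (simp add: cross_def power2_eq_square algebra_simps)
  moreover have "cross v w = 0" using par(1) by (simp add: v_def w_def)
  ultimately have inner: "Re v * Re w + Im v * Im w \<noteq> 0" using ne by auto
  have "cross (v * cis \<theta>) w = cross v w * cos \<theta> - (Re v * Re w + Im v * Im w) * sin \<theta>"
    by (simp add: cross_def algebra_simps)
  then have "cross (v * cis \<theta>) w \<noteq> 0" using \<open>cross v w = 0\<close> inner elim by simp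
  moreover have "fst (rotated z P \<theta>) + \<sigma> *\<^sub>R (v * cis \<theta>) = z"
  proof -
    have 0: "fst P - z + \<sigma> *\<^sub>R v = 0" unfolding z(1) v_def by simp
    have eq: "fst (rotated z P \<theta>) + \<sigma> *\<^sub>R (v * cis \<theta>) = z + (fst P - z + \<sigma> *\<^sub>R v) * cis \<theta>"
      by (simp add: rotated_def scaleR_conv_of_real algebra_simps)
    show ?thesis unfolding eq 0 by simp
  qed
  ultimately show ?case
    unfolding proper_crossing_def dir w_def[symmetric] using z(2-4) zQ
    by (intro conjI exI[of _ \<sigma>] exI[of _ s]) (simp_all add: w_def)
qed

text \<open>A point off the segment keeps its distance under small rotations; a point on it is left
  at once, since the rotated line meets the old one only in \<open>z\<close>.\<close>

lemma rotated_avoids: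
  assumes z: "z = fst P + \<sigma> *\<^sub>R (snd P - fst P)" and p: "p \<noteq> z"
  shows "\<forall>\<^sub>F \<theta> in at_right 0. p \<notin> seg (rotated z P \<theta>)"
proof (cases "p \<in> seg P")
  case False
  then have "seg P \<inter> closed_segment p p = {}" by simp
  from disjoint_segments_stable[OF this rotated_tendsto tendsto_const tendsto_const]
  show ?thesis by eventually_elim simp
next
  case True
  define v where "v = snd P - fst P"
  obtain s where s: "p = fst P + s *\<^sub>R v" using True unfolding seg_param v_def by blast
  have pz: "p = z + (s - \<sigma>) *\<^sub>R v" unfolding s z v_def by (simp add: algebra_simps)
  have ne: "s - \<sigma> \<noteq> 0" "v \<noteq> 0" using p pz by auto
  show ?thesis
    using eventually_sin_pos
  proof eventually_elim
    case (elim \<theta>)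
    show ?case
    proof
      assume "p \<in> seg (rotated z P \<theta>)"
      then obtain t where t: "p = fst (rotated z P \<theta>) + t *\<^sub>R (snd (rotated z P \<theta>) - fst (rotated z P \<theta>))"
        unfolding seg_param by blast
      have 1: "fst P - z = (- \<sigma>) *\<^sub>R v" and 2: "snd P - z = (1 - \<sigma>) *\<^sub>R v"
        unfolding z v_def by (simp_all add: algebra_simps)
      have "p = z + ((t - \<sigma>) *\<^sub>R v) * cis \<theta>"
        unfolding t rotated_def fst_conv snd_conv 1 2 by (simp add: scaleR_conv_of_real algebra_simps)
      then have "v * ((t - \<sigma>) *\<^sub>R cis \<theta>) = v * of_real (s - \<sigma>)" unfolding pz by (auto simp: scaleR_conv_of_real mult_ac)
      then have eq: "(t - \<sigma>) *\<^sub>R cis \<theta> = of_real (s - \<sigma>)" using ne(2) mult_left_cancel by blast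
      then have "(t - \<sigma>) * sin \<theta> = 0" by (auto simp: complex_eq_iff)
      then have "t - \<sigma> = 0" using elim by simp
      then show False using eq ne(1) by simp
    qed
  qed
qed


lemma sphere_line_param:
  fixes a b :: complex
  assumes a: "a \<in> sphere x r" and b: "b \<in> ball x r"
  shows "a + \<gamma> *\<^sub>R (b - a) \<in> cball x r \<Longrightarrow> \<gamma> \<ge> 0" "0 < \<gamma> \<Longrightarrow> \<gamma> \<le> 1 \<Longrightarrow> a + \<gamma> *\<^sub>R (b - a) \<in> ball x r"
proof -
  assume c: "a + \<gamma> *\<^sub>R (b - a) \<in> cball x r"
  show "\<gamma> \<ge> 0"
  proof (rule ccontr)
    define k where "k = 1 - \<gamma>"
    assume "\<not> \<gamma> \<ge> 0"
    then have k: "k > 1" by (simp add: k_def)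
    have "k *\<^sub>R a = (a + \<gamma> *\<^sub>R (b - a)) + (k - 1) *\<^sub>R b" by (simp add: k_def algebra_simps)
    then have "(1 / k) *\<^sub>R (k *\<^sub>R a) = (1 / k) *\<^sub>R ((a + \<gamma> *\<^sub>R (b - a)) + (k - 1) *\<^sub>R b)" by simp
    then have "a = (1 / k) *\<^sub>R (a + \<gamma> *\<^sub>R (b - a)) + 0 *\<^sub>R a + ((k - 1) / k) *\<^sub>R b"
      using k by (simp only: scaleR_right_distrib[of "1 / k" "a + \<gamma> *\<^sub>R (b - a)"]) simp
    also have "\<dots> \<in> ball x r"
      using k a b c by (intro convex_combination_in_ball) (auto simp: field_simps)
    finally show False using a by simp
  qed
next
  assume g: "0 < \<gamma>" "\<gamma> \<le> 1"
  have "a + \<gamma> *\<^sub>R (b - a) = (1 - \<gamma>) *\<^sub>R a + 0 *\<^sub>R a + \<gamma> *\<^sub>R b" by (simp add: algebra_simps)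
  also have "\<dots> \<in> ball x r" using a b g by (intro convex_combination_in_ball) auto
  finally show "a + \<gamma> *\<^sub>R (b - a) \<in> ball x r" .
qed

lemma parallel_multiple:
  assumes "cross v w = 0" "v \<noteq> 0"
  shows "\<exists>k. w = k *\<^sub>R v"
proof -
  have "((cmod v)\<^sup>2) *\<^sub>R w = (Re v * Re w + Im v * Im w) *\<^sub>R v"
    using assms(1) unfolding cmod_power2
    by (simp add: complex_eq_iff cross_def power2_eq_square algebra_simps)
  then have "(1 / (cmod v)\<^sup>2) *\<^sub>R (((cmod v)\<^sup>2) *\<^sub>R w) = (1 / (cmod v)\<^sup>2) *\<^sub>R ((Re v * Re w + Im v * Im w) *\<^sub>R v)" by simp
  then show ?thesis using assms(2) by auto
qed

text \<open>This is why the segments are perturbed in order of increasing length.\<close>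

lemma tip_in_collinear:
  assumes a: "a \<in> sphere x r" "b \<in> ball x r" and c: "c \<in> sphere x r" "d \<in> ball x r"
    and meet: "closed_segment a b \<inter> closed_segment c d \<noteq> {}"
    and par: "cross (b - a) (d - c) = 0" and len: "norm (b - a) \<le> norm (d - c)"
  shows "\<exists>t k. 0 \<le> t \<and> t \<le> 1 \<and> b = c + t *\<^sub>R (d - c) \<and> b - a = k *\<^sub>R (d - c)"
proof -
  define v where "v = b - a"
  have v: "v \<noteq> 0" using a by (auto simp: v_def)
  obtain l where l: "d - c = l *\<^sub>R v" using parallel_multiple[OF par] v by (auto simp: v_def)
  have l1: "\<bar>l\<bar> \<ge> 1" using len v unfolding l v_def[symmetric] by simp
  then have l0: "l \<noteq> 0" by auto
  obtain p where p: "p \<in> closed_segment a b" "p \<in> closed_segment c d" using meet by blast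
  obtain s where s: "0 \<le> s" "s \<le> 1" "p = a + s *\<^sub>R (b - a)"
    using p(1) seg_param[of p "(a, b)"] by auto
  obtain t where t: "0 \<le> t" "t \<le> 1" "p = c + t *\<^sub>R (d - c)"
    using p(2) seg_param[of p "(c, d)"] by auto
  have st: "0 \<le> s" "s \<le> 1" "0 \<le> t" "t \<le> 1" "a + s *\<^sub>R (b - a) = c + t *\<^sub>R (d - c)"
    using s t by auto
  \<comment> \<open>On the line through \<open>a\<close> with direction \<open>v\<close> the other
    segment runs from \<open>\<alpha>\<close> to \<open>\<alpha> + l\<close>. As \<open>c\<close> is
    on the circle, it is \<open>a\<close> itself or lies beyond \<open>b\<close>.\<close>
  define \<alpha> where "\<alpha> = s - t * l"
  have ca: "c = a + \<alpha> *\<^sub>R v" using st(5) unfolding l v_def[symmetric] \<alpha>_def by (simp add: algebra_simps)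
  have da: "d = a + (\<alpha> + l) *\<^sub>R v" using l unfolding ca by (simp add: algebra_simps)
  have "c \<in> cball x r" "d \<in> cball x r" "c \<notin> ball x r" using c by auto
  then have al: "\<alpha> \<ge> 0" "\<alpha> + l \<ge> 0" "\<not> (0 < \<alpha> \<and> \<alpha> \<le> 1)"
    using sphere_line_param[OF a, folded v_def] ca da by auto
  have ba: "b = a + v" by (simp add: v_def)
  have vk: "b - a = (1 / l) *\<^sub>R (d - c)" unfolding l v_def[symmetric] using l0 by simp
  define \<tau> where "\<tau> = (1 - \<alpha>) / l"
  have b_eq: "b = c + \<tau> *\<^sub>R (d - c)"
  proof -
    have "\<tau> *\<^sub>R (d - c) = (1 - \<alpha>) *\<^sub>R v" unfolding l \<tau>_def using l0 by simp
    then show ?thesis using ca ba by (simp add: scaleR_left_diff_distrib)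
  qed
  have "0 \<le> \<tau> \<and> \<tau> \<le> 1"
  proof (cases "\<alpha> = 0")
    case True
    then have "l \<ge> 1" using al l1 by auto
    then show ?thesis unfolding \<tau>_def True by auto
  next
    case False
    then have a1: "\<alpha> > 1" using al by auto
    have "t * l < 0" using a1 st(2) unfolding \<alpha>_def by simp
    then have ln: "l < 0" using st(3) by (auto simp: mult_less_0_iff)
    then have "t * l \<ge> l" using st(4) by (simp add: mult_le_cancel_right1)
    then have "\<alpha> + l \<le> 1" using st(2) unfolding \<alpha>_def by simp
    then show ?thesis using a1 ln unfolding \<tau>_def by (simp add: divide_nonpos_neg neg_divide_le_eq)
  qed
  then show ?thesis using b_eq vk by blast
qed

text \<open>Prolonging both ends pushes the base outside the circle and makes a contact at an end an
  inner point of both segments.\<close>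

definition extended :: "real \<Rightarrow> complex \<Rightarrow> complex \<Rightarrow> complex \<times> complex" where
  "extended \<epsilon> a b = (a - \<epsilon> *\<^sub>R (b - a), b + \<epsilon> *\<^sub>R (b - a))"

lemma extended_direction: "snd (extended \<epsilon> a b) - fst (extended \<epsilon> a b) = (1 + 2 * \<epsilon>) *\<^sub>R (b - a)"
  by (simp add: extended_def complex_eq_iff algebra_simps)

lemma extended_param:
  assumes "\<epsilon> > 0"
  shows "a + s *\<^sub>R (b - a) = fst (extended \<epsilon> a b) + ((s + \<epsilon>) / (1 + 2 * \<epsilon>)) *\<^sub>R (snd (extended \<epsilon> a b) - fst (extended \<epsilon> a b))"
    "- \<epsilon> < s \<Longrightarrow> 0 < (s + \<epsilon>) / (1 + 2 * \<epsilon>)" "s < 1 + \<epsilon> \<Longrightarrow> (s + \<epsilon>) / (1 + 2 * \<epsilon>) < 1"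
proof -
  define k where "k = (s + \<epsilon>) / (1 + 2 * \<epsilon>)"
  have "k * (1 + 2 * \<epsilon>) = s + \<epsilon>" using assms by (simp add: k_def)
  then have "k *\<^sub>R (snd (extended \<epsilon> a b) - fst (extended \<epsilon> a b)) = (s + \<epsilon>) *\<^sub>R (b - a)"
    unfolding extended_direction by simp
  then show "a + s *\<^sub>R (b - a) = fst (extended \<epsilon> a b) + ((s + \<epsilon>) / (1 + 2 * \<epsilon>)) *\<^sub>R (snd (extended \<epsilon> a b) - fst (extended \<epsilon> a b))"
    unfolding k_def[symmetric] by (simp add: extended_def algebra_simps)
qed (use assms in \<open>simp_all add: field_simps\<close>)

lemma extended_outside:
  assumes "a \<in> sphere x r" "b \<in> ball x r" "\<epsilon> > 0"
  shows "dist x (fst (extended \<epsilon> a b)) > r"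
proof (rule ccontr)
  assume "\<not> dist x (fst (extended \<epsilon> a b)) > r"
  then have "a + (- \<epsilon>) *\<^sub>R (b - a) \<in> cball x r" by (simp add: extended_def)
  from sphere_line_param(1)[OF assms(1,2) this] show False using assms(3) by simp
qed

lemma extended_proper_crossing:
  assumes "a \<in> sphere x r" "b \<in> ball x r" "\<epsilon> > 0" "\<rho> > r"
    and meet: "closed_segment a b \<inter> closed_segment c d \<noteq> {}" and ne: "cross (b - a) (d - c) \<noteq> 0"
  shows "proper_crossing x \<rho> (extended \<epsilon> a b) (extended \<epsilon> c d)"
proof -
  obtain p where p: "p \<in> closed_segment a b" "p \<in> closed_segment c d" using meet by blast
  obtain s where s: "0 \<le> s" "s \<le> 1" "p = a + s *\<^sub>R (b - a)"
    using p(1) seg_param[of p "(a, b)"] by auto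
  obtain t where t: "0 \<le> t" "t \<le> 1" "p = c + t *\<^sub>R (d - c)"
    using p(2) seg_param[of p "(c, d)"] by auto
  note st = s(1,2) t(1,2) s(3) t(3)
  have "p \<in> ball x \<rho>"
  proof (cases "s = 0")
    case False
    then have "p \<in> ball x r" unfolding st(5) using st(1,2) by (intro sphere_line_param(2)[OF assms(1,2)]) auto
    then show ?thesis using assms(4) by simp
  qed (use assms st in auto)
  moreover have "cross ((1 + 2 * \<epsilon>) *\<^sub>R (b - a)) ((1 + 2 * \<epsilon>) *\<^sub>R (d - c)) = (1 + 2 * \<epsilon>)\<^sup>2 * cross (b - a) (d - c)"
    by (simp add: cross_def power2_eq_square algebra_simps)
  moreover have "(1 + 2 * \<epsilon>)\<^sup>2 \<noteq> 0" using assms(3) by simp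
  ultimately show ?thesis
    unfolding proper_crossing_def extended_direction
    using st extended_param(1)[OF assms(3), of a s b, unfolded extended_direction] extended_param(1)[OF assms(3), of c t d, unfolded extended_direction]
      extended_param(2,3)[OF assms(3), of s] extended_param(2,3)[OF assms(3), of t]
      assms(3) ne
    by (intro conjI exI[of _ "(s + \<epsilon>) / (1 + 2 * \<epsilon>)"] exI[of _ "(t + \<epsilon>) / (1 + 2 * \<epsilon>)"]) (simp_all only: mult_eq_0_iff, auto)
qed

text \<open>Prolonging by \<open>\<epsilon>\<close> turns contacts of nonparallel segments into
  proper crossings. Then the segments are rotated one at a time, by increasing length, about a point
  just beyond the original tip. This point lies on every untreated prolonged segment that overlaps
  the current one, so overlaps become crossings there, while a small angle preserves what is already
  achieved and avoids triple points.\<close>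

lemma outer_segments_general_position:
  assumes fin: "finite S" and r: "r > 0"
    and S: "\<And>A. A \<in> S \<Longrightarrow> A = closed_segment (a A) (b A) \<and> a A \<in> sphere x r \<and> b A \<in> ball x r"
  shows "\<exists>\<rho> P. \<rho> > 0 \<and> (\<forall>A\<in>S. \<rho> < dist x (fst (P A)) \<and> dist x (snd (P A)) < \<rho>) \<and>
    (\<forall>A\<in>S. \<forall>B\<in>S. A \<noteq> B \<longrightarrow> (if A \<inter> B = {} then seg (P A) \<inter> seg (P B) = {} else proper_crossing x \<rho> (P A) (P B))) \<and>
    (\<forall>A\<in>S. \<forall>B\<in>S. \<forall>C\<in>S. A \<noteq> B \<and> A \<noteq> C \<and> B \<noteq> C \<longrightarrow> seg (P A) \<inter> seg (P B) \<inter> seg (P C) = {})"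
proof -
  define E where "E \<epsilon> A = extended \<epsilon> (a A) (b A)" for \<epsilon> A
  have lim: "((\<lambda>\<epsilon>. fst (E \<epsilon> A)) \<longlongrightarrow> a A) (at_right 0)" "((\<lambda>\<epsilon>. snd (E \<epsilon> A)) \<longlongrightarrow> b A) (at_right 0)" for A
  proof -
    have "((\<lambda>\<epsilon>. a A - \<epsilon> *\<^sub>R (b A - a A)) \<longlongrightarrow> a A - 0 *\<^sub>R (b A - a A)) (at_right 0)"
      "((\<lambda>\<epsilon>. b A + \<epsilon> *\<^sub>R (b A - a A)) \<longlongrightarrow> b A + 0 *\<^sub>R (b A - a A)) (at_right 0)"
      by (intro tendsto_intros)+
    then show "((\<lambda>\<epsilon>. fst (E \<epsilon> A)) \<longlongrightarrow> a A) (at_right 0)" "((\<lambda>\<epsilon>. snd (E \<epsilon> A)) \<longlongrightarrow> b A) (at_right 0)"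
      by (simp_all add: E_def extended_def)
  qed
  have evS: "\<forall>\<^sub>F \<epsilon> in at_right 0. \<forall>A\<in>S. dist x (snd (E \<epsilon> A)) < r"
  proof (intro eventually_ball_finite fin ballI)
    fix A assume "A \<in> S"
    then have "dist x (b A) < r" using S by auto
    then show "\<forall>\<^sub>F \<epsilon> in at_right 0. dist x (snd (E \<epsilon> A)) < r"
      by (intro order_tendstoD(2)[of "\<lambda>\<epsilon>. dist x (snd (E \<epsilon> A))" "dist x (b A)"] tendsto_intros lim)
  qed
  have evD: "\<forall>\<^sub>F \<epsilon> in at_right 0. \<forall>A\<in>S. \<forall>B\<in>S. A \<inter> B = {} \<longrightarrow> seg (E \<epsilon> A) \<inter> seg (E \<epsilon> B) = {}"
  proof (intro eventually_ball_finite fin ballI)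
    fix A B assume AB: "A \<in> S" "B \<in> S"
    show "\<forall>\<^sub>F \<epsilon> in at_right 0. A \<inter> B = {} \<longrightarrow> seg (E \<epsilon> A) \<inter> seg (E \<epsilon> B) = {}"
    proof (cases "A \<inter> B = {}")
      case True
      then have "closed_segment (a A) (b A) \<inter> closed_segment (a B) (b B) = {}" using S[OF AB(1)] S[OF AB(2)] by simp
      from disjoint_segments_stable[OF this lim lim] show ?thesis by eventually_elim blast
    qed simp
  qed
  from eventually_happens'[OF trivial_limit_at_right_real eventually_conj[OF evS eventually_conj[OF evD eventually_at_right_less]]]
  obtain \<epsilon> :: real where \<epsilon>0: "\<forall>A\<in>S. dist x (snd (E \<epsilon> A)) < r"
    "\<forall>A\<in>S. \<forall>B\<in>S. A \<inter> B = {} \<longrightarrow> seg (E \<epsilon> A) \<inter> seg (E \<epsilon> B) = {}" "0 < \<epsilon>"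
    by (elim exE conjE) (rule that)
  define Q where "Q A = E \<epsilon> A" for A
  have out: "r < dist x (fst (Q A))" if "A \<in> S" for A
    unfolding Q_def E_def using S[OF that] \<epsilon>0(3) by (intro extended_outside) auto
  \<comment> \<open>A slightly larger circle still separates the prolonged bases from the tips, and
    contacts on the old circle become inner points of the new disc.\<close>
  have "\<forall>\<^sub>F \<rho> in at_right r. \<forall>A\<in>S. \<rho> < dist x (fst (Q A))"
    using out by (intro eventually_ball_finite fin ballI order_tendstoD(2)[OF tendsto_ident_at]) auto
  from eventually_happens'[OF trivial_limit_at_right_real eventually_conj[OF this eventually_at_right_less]]
  obtain \<rho> where \<rho>: "\<forall>A\<in>S. \<rho> < dist x (fst (Q A))" "r < \<rho>"
    by (elim exE conjE) (rule that)
  define len where "len A = norm (b A - a A)" for A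
  define good where "good P A B \<longleftrightarrow> (if A \<inter> B = {} then seg (P A) \<inter> seg (P B) = {} else proper_crossing x \<rho> (P A) (P B))"
    for P and A B :: "complex set"
  \<comment> \<open>\<open>J\<close> collects the treated segments. Every pair with a treated member
    is in order; overlaps remain only among the untreated ones, which are still in the prolonged
    position \<open>Q\<close>.\<close>
  define Inv where "Inv J P \<longleftrightarrow> (\<forall>A\<in>S. \<rho> < dist x (fst (P A)) \<and> dist x (snd (P A)) < \<rho>) \<and>
     (\<forall>A\<in>J. \<forall>B\<in>S. A \<noteq> B \<longrightarrow> good P A B) \<and> (\<forall>A\<in>S - J. P A = Q A) \<and>
     (\<forall>A\<in>J. \<forall>B\<in>J. \<forall>C\<in>J. A \<noteq> B \<and> A \<noteq> C \<and> B \<noteq> C \<longrightarrow> seg (P A) \<inter> seg (P B) \<inter> seg (P C) = {})" for J P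
  have good_sym: "good P A B \<longleftrightarrow> good P B A" for P A B
  proof -
    have "proper_crossing x \<rho> (P A) (P B) \<longleftrightarrow> proper_crossing x \<rho> (P B) (P A)"
      by (rule iffI; rule proper_crossing_sym)
    then show ?thesis
      unfolding good_def Int_commute[of A] Int_commute[of "seg (P A)"] by simp
  qed
  have "\<exists>J P. J \<subseteq> S \<and> card J = n \<and> Inv J P" if "n \<le> card S" for n
    using that
  proof (induction n)
    case 0
    have "Inv {} Q" unfolding Inv_def using \<epsilon>0(1) \<rho> by (force simp: Q_def)
    then show ?case by (intro exI[of _ "{}"]) auto
  next
    case (Suc n)
    then obtain J P where J: "J \<subseteq> S" "card J = n" and inv: "Inv J P" by auto
    have finJ: "finite J" using J fin finite_subset by blast
    have "S - J \<noteq> {}" using Suc.prems J(1,2) by (metis Diff_eq_empty_iff card_mono finJ not_less_eq_eq)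
    then have "Min (len ` (S - J)) \<in> len ` (S - J)" using fin by (intro Min_in) auto
    then obtain A where A: "A \<in> S" "A \<notin> J" "len A = Min (len ` (S - J))" by auto
    have minA: "len A \<le> len B" if "B \<in> S - J" for B unfolding A(3) using that fin by (intro Min_le) auto
    note inv1 = inv[unfolded Inv_def, THEN conjunct1]
    note inv2 = inv[unfolded Inv_def, THEN conjunct2, THEN conjunct1]
    note inv3 = inv[unfolded Inv_def, THEN conjunct2, THEN conjunct2, THEN conjunct1]
    note inv4 = inv[unfolded Inv_def, THEN conjunct2, THEN conjunct2, THEN conjunct2]
    have PA: "P A = Q A" using inv3 A by blast
    have sA: "A = closed_segment (a A) (b A)" "a A \<in> sphere x r" "b A \<in> ball x r" using S[OF A(1)] by blast+
    \<comment> \<open>The untreated segments that overlap \<open>A\<close> on its line. They are not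
      shorter than \<open>A\<close>, so \<open>tip_in_collinear\<close> puts the tip of
      \<open>A\<close> on each of them.\<close>
    define K where "K = {B \<in> S - J. B \<noteq> A \<and> A \<inter> B \<noteq> {} \<and> cross (b A - a A) (b B - a B) = 0}"
    \<comment> \<open>The candidate centers of rotation, slightly beyond the original tip of
      \<open>A\<close>. Varying \<open>u\<close> lets the center avoid finitely many points, and
      \<open>u < \<epsilon>\<close> keeps it inside the prolonged \<open>A\<close>.\<close>
    define z where "z u = b A + u *\<^sub>R (b A - a A)" for u
    have abA: "a A \<noteq> b A" using sA by auto
    have zlim: "(z \<longlongrightarrow> b A) (at_right 0)"
    proof -
      have "((\<lambda>u. b A + u *\<^sub>R (b A - a A)) \<longlongrightarrow> b A + 0 *\<^sub>R (b A - a A)) (at_right 0)" by (intro tendsto_intros)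
      then show ?thesis by (simp add: z_def[abs_def])
    qed
    \<comment> \<open>The crossing points among treated segments, finitely many; the rotated
      \<open>A\<close> has to miss them.\<close>
    define X where "X = (\<Union>B\<in>J. \<Union>C\<in>J - {B}. seg (P B) \<inter> seg (P C))"
    have single: "\<exists>p. seg (P B) \<inter> seg (P C) \<subseteq> {p}" if "B \<in> J" "C \<in> J" "B \<noteq> C" for B C
    proof -
      have "good P B C" using inv2 that J(1) by blast
      then show ?thesis unfolding good_def using proper_crossing_meet by (metis empty_subsetI subset_refl)
    qed
    have finX: "finite X"
      unfolding X_def
    proof (intro finite_UN_I finJ)
      show "finite (J - {B})" for B using finJ by simp
      fix B C assume "B \<in> J" "C \<in> J - {B}"
      then show "finite (seg (P B) \<inter> seg (P C))" using single[of B C] by (metis DiffD1 DiffD2 finite.simps finite_subset insertI1)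
    qed
    have e1: "\<forall>\<^sub>F u in at_right 0. z u \<in> ball x \<rho>"
    proof -
      have "dist x (b A) < \<rho>" using sA(3) \<rho>(2) by simp
      then have "\<forall>\<^sub>F u in at_right 0. dist x (z u) < \<rho>"
        by (intro order_tendstoD(2)[of "\<lambda>u. dist x (z u)" "dist x (b A)"] tendsto_intros zlim)
      then show ?thesis by simp
    qed
    have e2: "\<forall>\<^sub>F u in at_right 0. \<forall>p\<in>X. z u \<noteq> p"
    proof (intro eventually_ball_finite finX ballI)
      fix p
      show "\<forall>\<^sub>F u in at_right 0. z u \<noteq> p"
      proof (cases "p = b A")
        case True
        show ?thesis using eventually_at_right_less[of 0] by eventually_elim (use abA True in \<open>simp add: z_def\<close>)
      next
        case False
        then show ?thesis using tendsto_imp_eventually_ne[OF zlim] by simp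
      qed
    qed
    have e3: "\<forall>\<^sub>F u in at_right 0. \<forall>B\<in>K. \<exists>s. 0 < s \<and> s < 1 \<and> z u = fst (Q B) + s *\<^sub>R (snd (Q B) - fst (Q B))"
    proof (intro eventually_ball_finite ballI)
      show "finite K" using fin by (simp add: K_def)
      fix B assume B: "B \<in> K"
      then have BS: "B \<in> S" "B \<in> S - J" and m: "closed_segment (a A) (b A) \<inter> closed_segment (a B) (b B) \<noteq> {}"
        and par: "cross (b A - a A) (b B - a B) = 0" using sA(1) S[of B] by (auto simp: K_def)
      have "\<exists>t k. 0 \<le> t \<and> t \<le> 1 \<and> b A = a B + t *\<^sub>R (b B - a B) \<and> b A - a A = k *\<^sub>R (b B - a B)"
        by (rule tip_in_collinear[OF sA(2,3) _ _ m par]) (use S[OF BS(1)] minA[OF BS(2)] in \<open>auto simp: len_def\<close>)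
      then obtain t k where tk: "0 \<le> t" "t \<le> 1" "b A = a B + t *\<^sub>R (b B - a B)" "b A - a A = k *\<^sub>R (b B - a B)"
        by blast
      have zt: "z u = a B + (t + u * k) *\<^sub>R (b B - a B)" for u
      proof -
        have "z u = (a B + t *\<^sub>R (b B - a B)) + u *\<^sub>R (k *\<^sub>R (b B - a B))"
          unfolding z_def using tk(3,4) by metis
        then show ?thesis by (simp add: scaleR_left_distrib)
      qed
      have "((\<lambda>u. t + u * k) \<longlongrightarrow> t + 0 * k) (at_right 0)" by (intro tendsto_intros)
      then have tl: "((\<lambda>u. t + u * k) \<longlongrightarrow> t) (at_right 0)" by simp
      have "\<forall>\<^sub>F u in at_right 0. - \<epsilon> < t + u * k" "\<forall>\<^sub>F u in at_right 0. t + u * k < 1 + \<epsilon>"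
        using \<epsilon>0(3) tk(1,2) by (auto intro: order_tendstoD[OF tl])
      then show "\<forall>\<^sub>F u in at_right 0. \<exists>s. 0 < s \<and> s < 1 \<and> z u = fst (Q B) + s *\<^sub>R (snd (Q B) - fst (Q B))"
      proof eventually_elim
        case (elim u)
        then show ?case unfolding zt Q_def E_def
          using extended_param(1)[OF \<epsilon>0(3), of "a B" "t + u * k" "b B"] extended_param(2,3)[OF \<epsilon>0(3), of "t + u * k"] by blast
      qed
    qed
    have e4: "\<forall>\<^sub>F u in at_right 0. u \<in> {0<..<\<epsilon>}" by (rule eventually_at_right_real[OF \<epsilon>0(3)])
    from eventually_happens'[OF trivial_limit_at_right_real eventually_conj[OF e1 eventually_conj[OF e2 eventually_conj[OF e3 e4]]]]
    obtain u where u: "z u \<in> ball x \<rho>" "\<forall>p\<in>X. z u \<noteq> p"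
      "\<forall>B\<in>K. \<exists>s. 0 < s \<and> s < 1 \<and> z u = fst (Q B) + s *\<^sub>R (snd (Q B) - fst (Q B))" "u \<in> {0<..<\<epsilon>}"
      by (elim exE conjE) (rule that)
    obtain \<sigma> where \<sigma>: "0 < \<sigma>" "\<sigma> < 1" "z u = fst (Q A) + \<sigma> *\<^sub>R (snd (Q A) - fst (Q A))"
    proof -
      have "z u = a A + (1 + u) *\<^sub>R (b A - a A)" unfolding z_def by (simp add: algebra_simps)
      then have "z u = fst (Q A) + ((1 + u + \<epsilon>) / (1 + 2 * \<epsilon>)) *\<^sub>R (snd (Q A) - fst (Q A))"
        using extended_param(1)[OF \<epsilon>0(3), of "a A" "1 + u" "b A"] unfolding Q_def E_def by (rule trans)
      then show ?thesis
        using extended_param(2,3)[OF \<epsilon>0(3), of "1 + u"] u(4) \<epsilon>0(3)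
        by (intro that[of "(1 + u + \<epsilon>) / (1 + 2 * \<epsilon>)"]) auto
    qed
    define R where "R \<theta> = rotated (z u) (Q A) \<theta>" for \<theta>
    note Rlim = rotated_tendsto[of "z u" "Q A", folded R_def]
    have f1: "\<forall>\<^sub>F \<theta> in at_right 0. \<rho> < dist x (fst (R \<theta>)) \<and> dist x (snd (R \<theta>)) < \<rho>"
    proof (rule eventually_conj)
      show "\<forall>\<^sub>F \<theta> in at_right 0. \<rho> < dist x (fst (R \<theta>))"
        using inv1 A(1) PA by (intro order_tendstoD(1)[of "\<lambda>\<theta>. dist x (fst (R \<theta>))" "dist x (fst (Q A))"] tendsto_intros Rlim) auto
      show "\<forall>\<^sub>F \<theta> in at_right 0. dist x (snd (R \<theta>)) < \<rho>"
        using inv1 A(1) PA by (intro order_tendstoD(2)[of "\<lambda>\<theta>. dist x (snd (R \<theta>))" "dist x (snd (Q A))"] tendsto_intros Rlim) auto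
    qed
    have f2: "\<forall>\<^sub>F \<theta> in at_right 0. \<forall>B\<in>S. B \<noteq> A \<longrightarrow> good (P(A := R \<theta>)) A B"
    proof (intro eventually_ball_finite fin ballI)
      fix B assume B: "B \<in> S"
      have sB: "B = closed_segment (a B) (b B)" "a B \<in> sphere x r" "b B \<in> ball x r" using S[OF B] by blast+
      have stable: "\<forall>\<^sub>F \<theta> in at_right 0. good (P(A := R \<theta>)) A B" if g: "good P A B" "B \<noteq> A"
      proof (cases "A \<inter> B = {}")
        case True
        then have "seg (Q A) \<inter> seg (P B) = {}" using g PA by (simp add: good_def)
        from disjoint_segments_stable[OF this Rlim tendsto_const tendsto_const]
        show ?thesis by eventually_elim (use True g in \<open>simp add: good_def\<close>)
      next
        case False
        then have "proper_crossing x \<rho> (fst (Q A), snd (Q A)) (P B)" using g PA by (simp add: good_def)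
        from proper_crossing_stable[OF this Rlim]
        show ?thesis by eventually_elim (use False g in \<open>simp add: good_def\<close>)
      qed
      show "\<forall>\<^sub>F \<theta> in at_right 0. B \<noteq> A \<longrightarrow> good (P(A := R \<theta>)) A B"
      proof (cases "B = A")
        case False
        show ?thesis
        proof (cases "B \<in> K")
          case True
          then have BJ: "B \<notin> J" "A \<inter> B \<noteq> {}" "cross (b A - a A) (b B - a B) = 0" by (auto simp: K_def)
          then have PB: "P B = Q B" using inv3 B by blast
          obtain s where s: "0 < s" "s < 1" "z u = fst (Q B) + s *\<^sub>R (snd (Q B) - fst (Q B))" using u(3) True by blast
          have ne: "fst (Q C) \<noteq> snd (Q C)" if "C \<in> S" for C
            using out[OF that] \<epsilon>0(1) that by (force simp: Q_def)
          have "cross ((1 + 2 * \<epsilon>) *\<^sub>R (b A - a A)) ((1 + 2 * \<epsilon>) *\<^sub>R (b B - a B)) = (1 + 2 * \<epsilon>)\<^sup>2 * cross (b A - a A) (b B - a B)"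
            by (simp add: cross_def power2_eq_square algebra_simps)
          then have "cross (snd (Q A) - fst (Q A)) (snd (Q B) - fst (Q B)) = 0"
            unfolding Q_def E_def extended_direction BJ(3) by simp
          from rotated_proper_crossing[OF \<sigma>(3,1,2) u(1) s(3,1,2) this ne[OF A(1)] ne[OF B]]
          show ?thesis by eventually_elim (use BJ(2) PB in \<open>simp add: good_def R_def\<close>)
        next
          case nK: False
          \<comment> \<open>Outside \<open>K\<close> the pair is already in order, being treated
            before, disjoint, or nonparallel and hence properly crossing, so stability
            suffices.\<close>
          have "good P A B"
          proof (cases "B \<in> J")
            case True
            then show ?thesis using inv2 A False good_sym by blast
          next
            case BJ: False
            then have PB: "P B = Q B" using inv3 B by blast
            show ?thesis
            proof (cases "A \<inter> B = {}")
              case True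
              then show ?thesis using \<epsilon>0(2) A(1) B by (simp add: good_def PA PB Q_def)
            next
              case m: False
              then have ne: "cross (b A - a A) (b B - a B) \<noteq> 0" using nK B BJ False by (auto simp: K_def)
              have "closed_segment (a A) (b A) \<inter> closed_segment (a B) (b B) \<noteq> {}" using m sA(1) sB(1) by simp
              from extended_proper_crossing[OF sA(2,3) \<epsilon>0(3) \<rho>(2) this ne]
              show ?thesis using m by (simp add: good_def PA PB Q_def E_def)
            qed
          qed
          from stable[OF this False] show ?thesis by eventually_elim simp
        qed
      qed simp
    qed
    have f3: "\<forall>\<^sub>F \<theta> in at_right 0. \<forall>p\<in>X. p \<notin> seg (R \<theta>)"
    proof (intro eventually_ball_finite finX ballI)
      fix p assume "p \<in> X"
      then have "p \<noteq> z u" using u(2) by blast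
      then show "\<forall>\<^sub>F \<theta> in at_right 0. p \<notin> seg (R \<theta>)" unfolding R_def by (rule rotated_avoids[OF \<sigma>(3)])
    qed
    from eventually_happens'[OF trivial_limit_at_right_real eventually_conj[OF f1 eventually_conj[OF f2 f3]]]
    obtain \<theta> where \<theta>0: "\<rho> < dist x (fst (R \<theta>))" "dist x (snd (R \<theta>)) < \<rho>"
      "\<forall>B\<in>S. B \<noteq> A \<longrightarrow> good (P(A := R \<theta>)) A B" "\<forall>p\<in>X. p \<notin> seg (R \<theta>)"
      by (elim exE conjE) (rule that)
    note \<theta> = conjI[OF \<theta>0(1,2)] \<theta>0(3,4)
    define P' where "P' = P(A := R \<theta>)"
    have P': "P' A = R \<theta>" "\<And>B. B \<noteq> A \<Longrightarrow> P' B = P B" by (simp_all add: P'_def)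
    have g': "good P' B C \<longleftrightarrow> good P B C" if "B \<noteq> A" "C \<noteq> A" for B C using that P' by (simp add: good_def)
    have avoid: "seg (P' A) \<inter> seg (P' B) \<inter> seg (P' C) = {}" if "B \<in> J" "C \<in> J" "B \<noteq> C" for B C
    proof -
      have "B \<noteq> A" "C \<noteq> A" using that A(2) by blast+
      then have "P' B = P B" "P' C = P C" using P'(2) by blast+
      then show ?thesis using \<theta>(3) that unfolding P'(1) X_def by auto
    qed
    have "Inv (insert A J) P'"
      unfolding Inv_def
    proof (intro conjI ballI impI)
      fix B assume B: "B \<in> S"
      show "\<rho> < dist x (fst (P' B))" "dist x (snd (P' B)) < \<rho>"
        using \<theta>(1) inv1 B P' by (cases "B = A"; simp)+
    next
      fix B C assume BC: "B \<in> insert A J" "C \<in> S" "B \<noteq> C"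
      show "good P' B C"
      proof (cases "B = A")
        case True then show ?thesis using \<theta>(2) BC unfolding P'_def by blast
      next
        case False
        show ?thesis
        proof (cases "C = A")
          case True
          have "B \<in> S" using BC False J by blast
          then have "good P' A B" using \<theta>(2) False unfolding P'_def by blast
          then show ?thesis using True good_sym by blast
        next
          case C: False
          have "good P B C" using inv2 BC False by blast
          then show ?thesis using g' False C by blast
        qed
      qed
    next
      fix B assume "B \<in> S - insert A J"
      then show "P' B = Q B" using inv3 P' by auto
    next
      fix B C D assume BCD: "B \<in> insert A J" "C \<in> insert A J" "D \<in> insert A J" "B \<noteq> C \<and> B \<noteq> D \<and> C \<noteq> D"
      show "seg (P' B) \<inter> seg (P' C) \<inter> seg (P' D) = {}"
      proof (cases "B = A \<or> C = A \<or> D = A")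
        case True
        then show ?thesis
        proof (elim disjE)
          assume "B = A"
          then have "C \<in> J" "D \<in> J" "C \<noteq> D" using BCD by blast+
          from avoid[OF this] show ?thesis unfolding \<open>B = A\<close> .
        next
          assume "C = A"
          then have "B \<in> J" "D \<in> J" "B \<noteq> D" using BCD by blast+
          from avoid[OF this] show ?thesis unfolding \<open>C = A\<close> by blast
        next
          assume "D = A"
          then have "B \<in> J" "C \<in> J" "B \<noteq> C" using BCD by blast+
          from avoid[OF this] show ?thesis unfolding \<open>D = A\<close> by blast
        qed
      next
        case False
        then have "B \<in> J" "C \<in> J" "D \<in> J" using BCD by auto
        then have "seg (P B) \<inter> seg (P C) \<inter> seg (P D) = {}" using inv4 BCD(4) by blast
        then show ?thesis using False P'(2) by simp
      qed
    qed
    moreover have "insert A J \<subseteq> S" "card (insert A J) = Suc n" using A J finJ by auto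
    ultimately show ?case by blast
  qed
  then obtain J P where "J \<subseteq> S" "card J = card S" and inv: "Inv J P" by blast
  then have "J = S" using fin card_subset_eq by blast
  then show ?thesis
    using inv r \<rho>(2) unfolding Inv_def good_def by (intro exI[of _ \<rho>] exI[of _ P]) simp
qed


lemma truncated_segment:
  fixes c d :: complex
  assumes c: "\<rho> < dist x c" and d: "dist x d < \<rho>"
  shows "\<exists>e. e \<in> sphere x \<rho> \<and> closed_segment c d \<inter> cball x \<rho> = closed_segment e d"
proof -
  obtain T where T: "0 < T" "T < 1" "d + T *\<^sub>R (c - d) \<in> sphere x \<rho>"
    and io: "\<And>t. 0 \<le> t \<Longrightarrow> (t < T \<longrightarrow> d + t *\<^sub>R (c - d) \<in> ball x \<rho>) \<and> (t > T \<longrightarrow> d + t *\<^sub>R (c - d) \<notin> cball x \<rho>)"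
    using convex_exit[of d x \<rho> 1 "c - d"] c d by auto
  have seg: "closed_segment d (d + k *\<^sub>R (c - d)) = {d + t *\<^sub>R (c - d) | t. 0 \<le> t \<and> t \<le> k}" if "k > 0" for k
  proof (intro set_eqI iffI)
    fix z assume "z \<in> closed_segment d (d + k *\<^sub>R (c - d))"
    then obtain u where u: "0 \<le> u" "u \<le> 1" "z = d + u *\<^sub>R (k *\<^sub>R (c - d))"
      using seg_param[of z "(d, d + k *\<^sub>R (c - d))"] by auto
    then have "z = d + (u * k) *\<^sub>R (c - d)" "0 \<le> u * k" "u * k \<le> k"
      using that by (auto simp: mult_left_le_one_le)
    then show "z \<in> {d + t *\<^sub>R (c - d) | t. 0 \<le> t \<and> t \<le> k}" by blast
  next
    fix z assume "z \<in> {d + t *\<^sub>R (c - d) | t. 0 \<le> t \<and> t \<le> k}"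
    then obtain t where t: "0 \<le> t" "t \<le> k" "z = d + t *\<^sub>R (c - d)" by blast
    then have "z = d + (t / k) *\<^sub>R (k *\<^sub>R (c - d))" "0 \<le> t / k" "t / k \<le> 1" using that by auto
    then show "z \<in> closed_segment d (d + k *\<^sub>R (c - d))"
      using seg_param[of z "(d, d + k *\<^sub>R (c - d))"] by auto
  qed
  have 1: "closed_segment d c = {d + t *\<^sub>R (c - d) | t. 0 \<le> t \<and> t \<le> 1}" using seg[of 1] by simp
  have "closed_segment d c \<inter> cball x \<rho> = closed_segment d (d + T *\<^sub>R (c - d))"
  proof (intro set_eqI iffI)
    fix z assume z: "z \<in> closed_segment d c \<inter> cball x \<rho>"
    then obtain t where t: "0 \<le> t" "z = d + t *\<^sub>R (c - d)" unfolding 1 by blast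
    then have "t \<le> T" using io[of t] z by (meson IntD2 not_le)
    then show "z \<in> closed_segment d (d + T *\<^sub>R (c - d))" unfolding seg[OF T(1)] using t by blast
  next
    fix z assume "z \<in> closed_segment d (d + T *\<^sub>R (c - d))"
    then obtain t where t: "0 \<le> t" "t \<le> T" "z = d + t *\<^sub>R (c - d)" unfolding seg[OF T(1)] by blast
    have "z \<in> cball x \<rho>"
    proof (cases "t = T")
      case True then show ?thesis using T(3) t(3) sphere_cball by blast
    next
      case False then show ?thesis using io[of t] t ball_subset_cball by (meson order_le_less subsetD)
    qed
    moreover have "t \<le> 1" using t(2) T(2) by simp
    ultimately show "z \<in> closed_segment d c \<inter> cball x \<rho>" unfolding 1 using t by blast
  qed
  then show ?thesis using T(3) by (metis closed_segment_commute)
qed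

lemma outer_segment_graphs_subset_outer_1_string_graphs:
  "outer_segment_graphs \<subseteq> outer_1_string_graphs"
  unfolding outer_segment_graphs_def outer_1_string_graphs_def
proof (rule intersection_graph_class_mono)
  fix S :: "complex set set"
  assume fin: "finite S" and "\<exists>x r. r > 0 \<and> (\<forall>A\<in>S. outer_segment x r A)"
  then obtain x r where r: "r > 0" and out: "\<And>A. A \<in> S \<Longrightarrow> outer_segment x r A" by blast
  have "\<forall>A\<in>S. \<exists>c. A = closed_segment (fst c) (snd c) \<and> fst c \<in> sphere x r \<and> snd c \<in> ball x r"
    using outer_segment_ends[OF out] by fastforce
  then obtain c where c: "\<forall>A\<in>S. A = closed_segment (fst (c A)) (snd (c A)) \<and> fst (c A) \<in> sphere x r \<and> snd (c A) \<in> ball x r"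
    unfolding bchoice_iff by (elim exE)
  obtain \<rho> P where \<rho>: "\<rho> > 0" and P: "\<forall>A\<in>S. \<rho> < dist x (fst (P A)) \<and> dist x (snd (P A)) < \<rho>"
    and two: "\<forall>A\<in>S. \<forall>B\<in>S. A \<noteq> B \<longrightarrow> (if A \<inter> B = {} then seg (P A) \<inter> seg (P B) = {} else proper_crossing x \<rho> (P A) (P B))"
    and three: "\<forall>A\<in>S. \<forall>B\<in>S. \<forall>C\<in>S. A \<noteq> B \<and> A \<noteq> C \<and> B \<noteq> C \<longrightarrow> seg (P A) \<inter> seg (P B) \<inter> seg (P C) = {}"
    by atomize_elim (rule outer_segments_general_position[of S r "\<lambda>A. fst (c A)" "\<lambda>A. snd (c A)" x, OF fin r], rule bspec[OF c])
  have "\<forall>A\<in>S. \<exists>e. e \<in> sphere x \<rho> \<and> seg (P A) \<inter> cball x \<rho> = closed_segment e (snd (P A))"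
    using P truncated_segment by blast
  then obtain e where e: "\<forall>A\<in>S. e A \<in> sphere x \<rho> \<and> seg (P A) \<inter> cball x \<rho> = closed_segment (e A) (snd (P A))"
    unfolding bchoice_iff by (elim exE)
  \<comment> \<open>The new circle cuts every prolonged segment once and loses no crossing, since
    proper crossings lie in its open disc.\<close>
  define h where "h A = seg (P A) \<inter> cball x \<rho>" for A
  have h: "h A = closed_segment (e A) (snd (P A))" "e A \<in> sphere x \<rho>" "snd (P A) \<in> ball x \<rho>" if "A \<in> S" for A
    using bspec[OF e that] bspec[OF P that] by (auto simp: h_def)
  have ends: "e A \<noteq> snd (P A)" if "A \<in> S" for A using h(2,3)[OF that] by auto
  have meet: "if A \<inter> B = {} then h A \<inter> h B = {} else \<exists>p. h A \<inter> h B = {p}" if "A \<in> S" "B \<in> S" "A \<noteq> B" for A B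
  proof (cases "A \<inter> B = {}")
    case True
    then have "seg (P A) \<inter> seg (P B) = {}" using two that by metis
    then show ?thesis using True by (auto simp: h_def)
  next
    case False
    then have "proper_crossing x \<rho> (P A) (P B)" using two that by metis
    then obtain p where "p \<in> ball x \<rho>" "seg (P A) \<inter> seg (P B) = {p}" using proper_crossing_meet by blast
    then have "h A \<inter> h B = {p}" using ball_subset_cball[of x \<rho>] unfolding h_def by blast
    then show ?thesis using False by simp
  qed
  have sub1: "\<exists>p. h A \<inter> h B \<subseteq> {p}" if "A \<in> S" "B \<in> S" "A \<noteq> B" for A B
    using meet[OF that] by (cases "A \<inter> B = {}") auto
  have ne: "h A \<noteq> h B" if AB: "A \<in> S" "B \<in> S" "A \<noteq> B" for A B
  proof
    assume "h A = h B"
    then obtain p where "h A \<subseteq> {p}" using sub1[OF AB] by auto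
    moreover have "e A \<in> h A" "snd (P A) \<in> h A" using h(1)[OF AB(1)] by auto
    ultimately show False using ends[OF AB(1)] by blast
  qed
  show "\<exists>h. inj_on h S \<and> (one_strings (h ` S) \<and> (\<exists>x r. r > 0 \<and> (\<forall>A\<in>h ` S. outer_string x r A))) \<and>
      (\<forall>A\<in>S. \<forall>B\<in>S. A \<noteq> B \<longrightarrow> (h A \<inter> h B \<noteq> {} \<longleftrightarrow> A \<inter> B \<noteq> {}))"
  proof (intro exI[of _ h] conjI ballI impI)
    show "inj_on h S" by (rule inj_onI) (use ne in blast)
    show "one_strings (h ` S)"
      unfolding one_strings_def
    proof (intro conjI ballI impI)
      fix A assume "A \<in> h ` S"
      then obtain A' where A: "A' \<in> S" "A = h A'" by blast
      have "arc (linepath (e A') (snd (P A')))" using ends[OF A(1)] by (rule arc_linepath)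
      moreover have "A = path_image (linepath (e A') (snd (P A')))" unfolding A(2) h(1)[OF A(1)] by simp
      ultimately show "\<exists>g. arc g \<and> A = path_image g" by blast
      fix B assume "B \<in> h ` S"
      then obtain B' where B: "B' \<in> S" "B = h B'" by blast
      show "\<exists>p. A \<inter> B \<subseteq> {p}" if "A \<noteq> B"
      proof -
        have "A' \<noteq> B'" using that A(2) B(2) by blast
        then show ?thesis unfolding A(2) B(2) by (rule sub1[OF A(1) B(1)])
      qed
      fix C assume "C \<in> h ` S"
      then obtain C' where C: "C' \<in> S" "C = h C'" by blast
      show "A \<inter> B \<inter> C = {}" if "A \<noteq> B \<and> A \<noteq> C \<and> B \<noteq> C"
      proof -
        have "A' \<noteq> B' \<and> A' \<noteq> C' \<and> B' \<noteq> C'" using that A(2) B(2) C(2) by blast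
        then have "seg (P A') \<inter> seg (P B') \<inter> seg (P C') = {}"
          using bspec[OF bspec[OF bspec[OF three A(1)] B(1)] C(1)] by blast
        then show ?thesis unfolding A(2) B(2) C(2) h_def by blast
      qed
    qed
    have "outer_string x \<rho> (h A)" if A: "A \<in> S" for A
    proof -
      have "h A - {e A} \<subseteq> ball x \<rho>"
        using segment_in_ball[OF h(2,3)[OF A]] h(1)[OF A] by blast
      then show ?thesis
        unfolding outer_string_def using arc_linepath[OF ends[OF A]] h(1,2)[OF A]
        by (intro exI[of _ "linepath (e A) (snd (P A))"]) simp
    qed
    then show "\<exists>x r. r > 0 \<and> (\<forall>A\<in>h ` S. outer_string x r A)" using \<rho> by blast
    fix A B assume "A \<in> S" "B \<in> S" "A \<noteq> B"
    then show "h A \<inter> h B \<noteq> {} \<longleftrightarrow> A \<inter> B \<noteq> {}" using meet[of A B] by (cases "A \<inter> B = {}") auto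
  qed
qed

subsection \<open>Explicit representations\<close>

text \<open>Each entry \<open>(a, b, c, d)\<close> is the ray from \<open>(a, b)\<close> in direction \<open>(c, d)\<close>.\<close>

definition net_rays :: "(int \<times> int \<times> int \<times> int) list" where
  "net_rays =
   [(113, -41, 33, 37), (85, 82, 36, 35), (92, 77, -15, 48),
    (-28, 114, -12, 49), (-21, 118, -49, 10), (-113, 32, -48, 14),
    (-113, 41, -32, -37), (-85, -82, -35, -35), (-92, -77, 17, -48),
    (28, -114, 12, -48), (21, -118, 50, -10), (113, -32, 50, -13),
    (-24, -2, 50, 1), (1, 9, 32, 41), (14, -20, -24, 43),
    (-8, -4, -50, 9), (10, 22, -23, -44), (7, -5, 21, -46)]"

text \<open>
  Each entry \<open>(a, b, c, d)\<close> is the segment from \<open>(a, b)\<close> to \<open>(a + c, b + d)\<close>. The bases are lattice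
  points of the circle of radius \<open>32045 = 5 * 13 * 17 * 29\<close> about the origin.
\<close>

definition two_paths_segments :: "(int \<times> int \<times> int \<times> int) list" where
  "two_paths_segments =
   [(31603, -5304, -594, 13323), (31323, 6764, -5743, 12515), (26312, 18291, -10054, 9312),
    (17253, 27004, -12792, 4722), (5304, 31603, -13312, -582), (-6764, 31323, -12500, -5729),
    (-18291, 26312, -9293, -10038), (-27004, 17253, -4699, -12774), (-31603, 5304, 609, -13299),
    (-31323, -6764, 5760, -12485), (-26312, -18291, 10073, -9276), (-17253, -27004, 12813, -4680),
    (-5304, -31603, 13342, 630), (6764, -31323, 12532, 5783), (18291, -26312, 9327, 10098),
    (27004, -17253, 4735, 12840), (32045, 0, -32989, 27749), (23067, 22244, -5142, -4292),
    (0, 32045, 25, -6675), (-22244, 23067, 42541, -4107), (-32045, 0, 33039, -27641),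
    (-23067, -22244, 5194, 4406), (0, -32045, 29, 6795), (22244, -23067, -42485, 4233)]"

text \<open>Rectilinear chains rising from the real axis. The first 16 form the cycle: each bends
  right into its successor, and the last one returns above all others to the first. The other seven
  start at abscissa \<open>8 * v + 2\<close>, where they cross the arm of the cycle vertex
  \<open>2 * v\<close>, and meet each other higher up.\<close>

definition fan_strings :: "(int \<times> int) list list" where
  "fan_strings =
   [[(0, 0), (0, 2), (5, 2)], [(4, 0), (4, 3), (9, 3)], [(8, 0), (8, 4), (13, 4)],
    [(12, 0), (12, 5), (17, 5)], [(16, 0), (16, 6), (21, 6)], [(20, 0), (20, 7), (25, 7)],
    [(24, 0), (24, 8), (29, 8)], [(28, 0), (28, 9), (33, 9)], [(32, 0), (32, 10), (37, 10)],
    [(36, 0), (36, 11), (41, 11)], [(40, 0), (40, 12), (45, 12)], [(44, 0), (44, 13), (49, 13)],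
    [(48, 0), (48, 14), (53, 14)], [(52, 0), (52, 15), (57, 15)], [(56, 0), (56, 16), (61, 16)],
    [(60, 0), (60, 34), (-5, 34), (-5, 1), (1, 1)], [(2, 0), (2, 25)], [(10, 0), (10, 23)],
    [(18, 0), (18, 24), (1, 24)], [(26, 0), (26, 26), (0, 26), (0, 22), (12, 22)], [(34, 0), (34, 22)],
    [(42, 0), (42, 24), (25, 24)], [(50, 0), (50, 28), (-2, 28), (-2, 20), (36, 20)]]"

section \<open>Integer tests for rays, segments and rectilinear chains\<close>

definition pt :: "int \<Rightarrow> int \<Rightarrow> complex" where "pt a b = Complex (of_int a) (of_int b)"

text \<open>Cramer's rule without division: both numerators are multiplied by the determinant
  \<open>D\<close>, so the test against \<open>0\<close> needs no case distinction on its sign, and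
  a parameter at most 1 reads \<open>s \<le> D * D\<close>.\<close>

fun crosses :: "bool \<Rightarrow> int \<times> int \<times> int \<times> int \<Rightarrow> int \<times> int \<times> int \<times> int \<Rightarrow> bool" where
  "crosses bounded_fig (a, b, c, d) (a', b', c', d') \<longleftrightarrow>
     (let D = c * d' - d * c'; s = ((a' - a) * d' - (b' - b) * c') * D; t = ((a' - a) * d - (b' - b) * c) * D
      in s \<ge> 0 \<and> t \<ge> 0 \<and> (bounded_fig \<longrightarrow> s \<le> D * D \<and> t \<le> D * D))"

fun parallel :: "int \<times> int \<times> int \<times> int \<Rightarrow> int \<times> int \<times> int \<times> int \<Rightarrow> bool" where
  "parallel (a, b, c, d) (a', b', c', d') \<longleftrightarrow> c * d' = d * c'"

definition realizes :: "bool \<Rightarrow> nat \<Rightarrow> (nat \<times> nat) list \<Rightarrow> (int \<times> int \<times> int \<times> int) list \<Rightarrow> bool" where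
  "realizes bounded_fig N E xs \<longleftrightarrow> (\<forall>j\<in>set [0..<length xs]. \<forall>i\<in>set [0..<j].
     \<not> parallel (xs ! i) (xs ! j) \<and> crosses bounded_fig (xs ! i) (xs ! j) = ring_adj N E i j)"

lemma net_rays_realize: "realizes False 6 net_edges net_rays"
  by code_simp

lemma two_paths_segments_realize: "realizes True 8 two_paths_edges two_paths_segments"
  by code_simp

text \<open>The tuple \<open>(a, b, c, d)\<close> stands for the rectangle from \<open>a\<close> to
  \<open>b\<close> and from \<open>c\<close> to \<open>d\<close>. An axis-parallel edge is a
  degenerate rectangle, so intersections reduce to maxima and minima of integers.\<close>

type_synonym box = "int \<times> int \<times> int \<times> int"

fun boxes :: "(int \<times> int) list \<Rightarrow> box list" where
  "boxes ((a, b) # (c, d) # ps) = (min a c, max a c, min b d, max b d) # boxes ((c, d) # ps)"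
| "boxes _ = []"

fun meet :: "box \<Rightarrow> box \<Rightarrow> box" where
  "meet (a, b, c, d) (a', b', c', d') = (max a a', min b b', max c c', min d d')"

fun is_empty :: "box \<Rightarrow> bool" where
  "is_empty (a, b, c, d) \<longleftrightarrow> b < a \<or> d < c"

fun is_point :: "box \<Rightarrow> bool" where
  "is_point (a, b, c, d) \<longleftrightarrow> a = b \<and> c = d"

text \<open>Two consecutive edges share a corner, so one common point may be found several times.
  After removal of duplicates the length counts common points, provided that all entries are
  points.\<close>

definition meets :: "(int \<times> int) list \<Rightarrow> (int \<times> int) list \<Rightarrow> box list" where
  "meets ps qs = remdups (filter (\<lambda>b. \<not> is_empty b) [meet b c. b \<leftarrow> boxes ps, c \<leftarrow> boxes qs])"

text \<open>The inequality of the two equations says that the edge is axis-parallel and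
  nondegenerate. The remaining test lets an edge meet the later ones only in its end
  \<open>(c, d)\<close>.\<close>

fun simple_chain :: "(int \<times> int) list \<Rightarrow> bool" where
  "simple_chain [(a, b), (c, d)] \<longleftrightarrow> (a = c) \<noteq> (b = d)"
| "simple_chain ((a, b) # (c, d) # ps) \<longleftrightarrow> (a = c) \<noteq> (b = d) \<and> simple_chain ((c, d) # ps) \<and>
     (\<forall>x\<in>set (boxes ((c, d) # ps)). let y = meet (min a c, max a c, min b d, max b d) x in
        is_empty y \<or> y = (c, c, d, d))"
| "simple_chain _ \<longleftrightarrow> False"

definition realizes_strings :: "nat \<Rightarrow> (nat \<times> nat) list \<Rightarrow> (int \<times> int) list list \<Rightarrow> bool" where
  "realizes_strings N E xs \<longleftrightarrow>
     (\<forall>ps\<in>set xs. simple_chain ps \<and> snd (hd ps) = 0 \<and> (\<forall>p\<in>set (tl ps). snd p > 0)) \<and>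
     (\<forall>j\<in>set [0..<length xs]. \<forall>i\<in>set [0..<j]. list_all is_point (meets (xs ! i) (xs ! j)) \<and>
        length (meets (xs ! i) (xs ! j)) = (if ring_adj N E i j then 1 else 0)) \<and>
     (\<forall>j\<in>set [0..<length xs]. \<forall>i\<in>set [0..<j]. \<forall>x\<in>set (meets (xs ! i) (xs ! j)). \<forall>k\<in>set [0..<length xs].
        k = i \<or> k = j \<or> (\<forall>y\<in>set (boxes (xs ! k)). is_empty (meet x y)))"

lemma fan_strings_realize: "realizes_strings 8 fan_edges fan_strings"
  by code_simp


section \<open>Soundness of the integer tests\<close>

lemma Re_pt [simp]: "Re (pt a b) = of_int a" and Im_pt [simp]: "Im (pt a b) = of_int b"
  by (simp_all add: pt_def)

lemma rays_meet_iff: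
  assumes "cross v w \<noteq> 0"
  shows "ray_from a v \<inter> ray_from b w \<noteq> {} \<longleftrightarrow>
    cross (b - a) w * cross v w \<ge> 0 \<and> cross (b - a) v * cross v w \<ge> 0"
proof -
  have "ray_from a v \<inter> ray_from b w \<noteq> {} \<longleftrightarrow> (\<exists>s t. 0 \<le> s \<and> 0 \<le> t \<and> a + s *\<^sub>R v = b + t *\<^sub>R w)"
    unfolding ray_from_def by blast
  also have "\<dots> \<longleftrightarrow> 0 \<le> cross (b - a) w / cross v w \<and> 0 \<le> cross (b - a) v / cross v w"
    unfolding lines_meet_iff[OF assms] by blast
  also have "\<dots> \<longleftrightarrow> cross (b - a) w * cross v w \<ge> 0 \<and> cross (b - a) v * cross v w \<ge> 0"
    by (simp add: zero_le_divide_iff zero_le_mult_iff)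
  finally show ?thesis .
qed

lemma closed_segment_plus: "closed_segment a (a + v) = {a + s *\<^sub>R v | s. 0 \<le> s \<and> s \<le> 1}"
  for a v :: complex
proof -
  have "(1 - s) *\<^sub>R a + s *\<^sub>R (a + v) = a + s *\<^sub>R v" for s by (simp add: algebra_simps)
  then show ?thesis unfolding closed_segment_def by simp
qed

lemma segments_meet_iff:
  assumes "cross v w \<noteq> 0"
  shows "closed_segment a (a + v) \<inter> closed_segment b (b + w) \<noteq> {} \<longleftrightarrow>
    cross (b - a) w * cross v w \<ge> 0 \<and> cross (b - a) v * cross v w \<ge> 0 \<and>
    cross (b - a) w * cross v w \<le> cross v w * cross v w \<and> cross (b - a) v * cross v w \<le> cross v w * cross v w"
proof -
  have le1: "x / c \<le> 1 \<longleftrightarrow> x * c \<le> c * c" if "c \<noteq> 0" for x c :: real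
  proof -
    have "x / c * (c * c) = x * c" using that by simp
    moreover have "c * c > 0" using that by (auto simp: zero_less_mult_iff)
    ultimately show ?thesis using mult_le_cancel_right_pos[of "c * c" "x / c" 1] by simp
  qed
  have "closed_segment a (a + v) \<inter> closed_segment b (b + w) \<noteq> {} \<longleftrightarrow>
      (\<exists>s t. 0 \<le> s \<and> s \<le> 1 \<and> 0 \<le> t \<and> t \<le> 1 \<and> a + s *\<^sub>R v = b + t *\<^sub>R w)"
    unfolding closed_segment_plus by blast
  also have "\<dots> \<longleftrightarrow> 0 \<le> cross (b - a) w / cross v w \<and> cross (b - a) w / cross v w \<le> 1 \<and>
      0 \<le> cross (b - a) v / cross v w \<and> cross (b - a) v / cross v w \<le> 1"
    unfolding lines_meet_iff[OF assms] by blast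
  also have "\<dots> \<longleftrightarrow> cross (b - a) w * cross v w \<ge> 0 \<and> cross (b - a) v * cross v w \<ge> 0 \<and>
    cross (b - a) w * cross v w \<le> cross v w * cross v w \<and> cross (b - a) v * cross v w \<le> cross v w * cross v w"
    unfolding le1[OF assms] by (auto simp: zero_le_divide_iff zero_le_mult_iff)
  finally show ?thesis .
qed

definition figure :: "bool \<Rightarrow> int \<times> int \<times> int \<times> int \<Rightarrow> complex set" where
  "figure bounded_fig y = (case y of (a, b, c, d) \<Rightarrow>
     if bounded_fig then closed_segment (pt a b) (pt a b + pt c d) else ray_from (pt a b) (pt c d))"

lemma figures_meet_iff:
  assumes "\<not> parallel y z"
  shows "figure bounded_fig y \<inter> figure bounded_fig z \<noteq> {} \<longleftrightarrow> crosses bounded_fig y z"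
proof -
  obtain a b c d where y: "y = (a, b, c, d)" by (cases y)
  obtain a' b' c' d' where z: "z = (a', b', c', d')" by (cases z)
  let ?D = "c * d' - d * c'" and ?s = "(a' - a) * d' - (b' - b) * c'" and ?t = "(a' - a) * d - (b' - b) * c"
  have D: "cross (pt c d) (pt c' d') = of_int ?D" by (simp add: cross_def)
  have s: "cross (pt a' b' - pt a b) (pt c' d') = of_int ?s" by (simp add: cross_def)
  have t: "cross (pt a' b' - pt a b) (pt c d) = of_int ?t" by (simp add: cross_def)
  have ne: "cross (pt c d) (pt c' d') \<noteq> 0" unfolding D of_int_eq_0_iff using assms by (simp add: y z)
  have o: "(of_int m * of_int n :: real) = of_int (m * n)" for m n by simp
  show ?thesis
  proof (cases bounded_fig)
    case True
    then show ?thesis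
      unfolding y z figure_def crosses.simps Let_def
      using segments_meet_iff[OF ne, of "pt a b" "pt a' b'"] unfolding D s t o of_int_le_iff of_int_0_le_iff by auto
  next
    case False
    then show ?thesis
      unfolding y z figure_def crosses.simps Let_def
      using rays_meet_iff[OF ne, of "pt a b" "pt a' b'"] unfolding D s t o of_int_0_le_iff by auto
  qed
qed

lemma figures_distinct:
  assumes "\<not> parallel y z"
  shows "figure bounded_fig y \<noteq> figure bounded_fig z"
proof
  assume eq: "figure bounded_fig y = figure bounded_fig z"
  obtain a b c d where y: "y = (a, b, c, d)" by (cases y)
  obtain a' b' c' d' where z: "z = (a', b', c', d')" by (cases z)
  have D: "cross (pt c d) (pt c' d') = of_int (c * d' - d * c')" by (simp add: cross_def)
  have ne: "cross (pt c d) (pt c' d') \<noteq> 0" unfolding D of_int_eq_0_iff using assms by (simp add: y z)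
  have "pt a b + s *\<^sub>R pt c d \<in> figure bounded_fig y" if "0 \<le> s" "s \<le> 1" for s
    using that unfolding figure_def y closed_segment_plus ray_from_def by auto
  then have "pt a b + s *\<^sub>R pt c d \<in> figure bounded_fig z" if "0 \<le> s" "s \<le> 1" for s using that eq by blast
  moreover have "\<exists>t. p = pt a' b' + t *\<^sub>R pt c' d'" if "p \<in> figure bounded_fig z" for p
    using that unfolding figure_def z closed_segment_plus ray_from_def by (auto split: if_splits)
  ultimately have ex: "\<exists>t. pt a b + s *\<^sub>R pt c d = pt a' b' + t *\<^sub>R pt c' d'" if "0 \<le> s" "s \<le> 1" for s using that by blast
  have "s = cross (pt a' b' - pt a b) (pt c' d') / cross (pt c d) (pt c' d')" if "0 \<le> s" "s \<le> 1" for s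
    using ex[OF that] unfolding lines_meet_iff[OF ne] by blast
  \<comment> \<open>Cramer's value does not depend on \<open>s\<close>, so it would equal both
    \<open>0\<close> and \<open>1\<close>.\<close>
  from this[of 0] this[of 1] show False by simp
qed

lemma realizes_in_class:
  assumes real: "realizes bounded_fig N E xs" and e: "inj e"
    and P: "P (figure bounded_fig ` set xs)"
  shows "numbered_graph e (length xs) (ring_adj N E) \<in> intersection_graph_class P"
proof -
  let ?n = "length xs" and ?f = "\<lambda>i. figure bounded_fig (xs ! i)"
  have np: "\<not> parallel (xs ! i) (xs ! j)" and cr: "crosses bounded_fig (xs ! i) (xs ! j) = ring_adj N E i j"
    if "i < j" "j < ?n" for i j
    using real that unfolding realizes_def by auto
  have ne: "?f i \<noteq> ?f j" if "i < j" "j < ?n" for i j using figures_distinct np that by blast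
  have "inj_on ?f {..<?n}"
  proof (rule inj_onI)
    fix i j assume "i \<in> {..<?n}" "j \<in> {..<?n}" "?f i = ?f j"
    then show "i = j" using ne[of i j] ne[of j i] by (cases i j rule: linorder_cases) auto
  qed
  moreover have "?f ` {..<?n} = figure bounded_fig ` set xs"
    unfolding set_conv_nth by blast
  moreover have "ring_adj N E i j \<longleftrightarrow> ?f i \<inter> ?f j \<noteq> {}" if "i < ?n" "j < ?n" "i \<noteq> j" for i j
  proof (cases "i < j")
    case True then show ?thesis using figures_meet_iff[OF np[of i j]] cr[of i j] that by simp
  next
    case False
    then have "j < i" using that by simp
    then show ?thesis using figures_meet_iff[OF np[of j i]] cr[of j i] that ring_adj_sym by (simp add: Int_commute)
  qed
  ultimately show ?thesis
    unfolding numbered_graph_in_class_iff[OF e ring_adj_sym] using P by (intro exI[of _ ?f]) simp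
qed

lemma net_in_ray_graphs:
  assumes "inj e"
  shows "numbered_graph e 18 (ring_adj 6 net_edges) \<in> ray_graphs"
proof -
  have "\<forall>y\<in>set net_rays. is_ray (figure False y)"
  proof
    fix y assume y: "y \<in> set net_rays"
    obtain a b c d where abcd: "y = (a, b, c, d)" by (cases y)
    have "\<forall>(a, b, c, d)\<in>set net_rays. c \<noteq> 0" by (simp add: net_rays_def)
    then have "pt c d \<noteq> 0" using y by (auto simp: abcd complex_eq_iff)
    then show "is_ray (figure False y)" unfolding is_ray_def figure_def abcd by auto
  qed
  moreover have "length net_rays = 18" by (simp add: net_rays_def)
  ultimately show ?thesis
    unfolding ray_graphs_def using realizes_in_class[OF net_rays_realize assms, of "\<lambda>S. \<forall>A\<in>S. is_ray A"] by simp
qed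

lemma two_paths_in_outer_segment_graphs:
  assumes "inj e"
  shows "numbered_graph e 24 (ring_adj 8 two_paths_edges) \<in> outer_segment_graphs"
proof -
  have "\<forall>y\<in>set two_paths_segments. outer_segment 0 32045 (figure True y)"
  proof
    fix y assume y: "y \<in> set two_paths_segments"
    obtain a b c d where abcd: "y = (a, b, c, d)" by (cases y)
    have "\<forall>(a, b, c, d)\<in>set two_paths_segments. a\<^sup>2 + b\<^sup>2 = 32045\<^sup>2 \<and> (a + c)\<^sup>2 + (b + d)\<^sup>2 < 32045\<^sup>2"
      by (simp add: two_paths_segments_def)
    then have *: "a\<^sup>2 + b\<^sup>2 = 32045\<^sup>2" "(a + c)\<^sup>2 + (b + d)\<^sup>2 < 32045\<^sup>2" using y by (auto simp: abcd)
    have n: "(cmod (pt i j))\<^sup>2 = of_int (i\<^sup>2 + j\<^sup>2)" for i j by (simp add: cmod_power2)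
    have "(cmod (pt a b))\<^sup>2 = 32045\<^sup>2" unfolding n *(1) by simp
    then have 1: "cmod (pt a b) = 32045" by (simp only: power2_eq_iff_nonneg norm_ge_zero zero_le_numeral)
    have "(cmod (pt (a + c) (b + d)))\<^sup>2 < of_int (32045\<^sup>2)" unfolding n of_int_less_iff by (rule *(2))
    then have "(cmod (pt (a + c) (b + d)))\<^sup>2 < 32045\<^sup>2" by simp
    then have "cmod (pt (a + c) (b + d)) < 32045" by (rule power2_less_imp_less) simp
    moreover have "pt a b + pt c d = pt (a + c) (b + d)" by (simp add: complex_eq_iff)
    ultimately have 2: "cmod (pt a b + pt c d) < 32045" by simp
    show "outer_segment 0 32045 (figure True y)"
      unfolding figure_def abcd using outer_segmentI[of "pt a b" 0 32045 "pt a b + pt c d"] 1 2 by simp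
  qed
  moreover have "length two_paths_segments = 24" by (simp add: two_paths_segments_def)
  ultimately show ?thesis
    unfolding outer_segment_graphs_def
    using realizes_in_class[OF two_paths_segments_realize assms, of "\<lambda>S. \<exists>x r. r > 0 \<and> (\<forall>A\<in>S. outer_segment x r A)"]
    by (simp add: exI[of "\<lambda>x. \<exists>r>0. \<forall>y\<in>set two_paths_segments. outer_segment x r (figure True y)" 0] exI[of _ "32045::real"])
qed

definition bset :: "box \<Rightarrow> complex set" where
  "bset x = (case x of (a, b, c, d) \<Rightarrow> {z. of_int a \<le> Re z \<and> Re z \<le> of_int b \<and> of_int c \<le> Im z \<and> Im z \<le> of_int d})"

definition chain :: "(int \<times> int) list \<Rightarrow> complex set" where
  "chain ps = (\<Union>x\<in>set (boxes ps). bset x)"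

lemma bset_meet: "bset x \<inter> bset y = bset (meet x y)"
  by (cases x; cases y) (auto simp: bset_def)

lemma is_empty_iff: "is_empty x \<longleftrightarrow> bset x = {}"
proof -
  obtain a b c d where x: "x = (a, b, c, d)" by (cases x)
  have "pt a c \<in> bset x" if "\<not> is_empty x" using that by (simp add: x bset_def)
  moreover have "bset x = {}" if "is_empty x"
  proof (rule ccontr)
    assume "bset x \<noteq> {}"
    then obtain z where "of_int a \<le> Re z" "Re z \<le> of_int b" "of_int c \<le> Im z" "Im z \<le> of_int d"
      by (auto simp: x bset_def)
    then have "(of_int a :: real) \<le> of_int b" "(of_int c :: real) \<le> of_int d" by linarith+
    then show False using that by (auto simp: x)
  qed
  ultimately show ?thesis by blast
qed

lemma bset_point: "bset (a, a, b, b) = {pt a b}"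
  by (auto simp: bset_def complex_eq_iff)

lemma bset_segment:
  assumes "a = c \<or> b = d"
  shows "bset (min a c, max a c, min b d, max b d) = closed_segment (pt a b) (pt c d)"
proof -
  have cl: "closed_segment (real_of_int i) (real_of_int j) = {of_int (min i j)..of_int (max i j)}" for i j
    by (cases "i \<le> j") (simp_all add: closed_segment_eq_real_ivl min_def max_def)
  show ?thesis
  proof (cases "a = c")
    case True
    have "closed_segment (pt a b) (pt c d) = {z. Re z = of_int a \<and> Im z \<in> {of_int (min b d)..of_int (max b d)}}"
      using closed_segment_same_Re[of "pt a b" "pt c d"] True by (simp add: cl del: of_int_min of_int_max)
    moreover have "min a c = a" "max a c = a" using True by simp_all
    moreover have "bset (a, a, m, M) = {z. Re z = of_int a \<and> Im z \<in> {of_int m..of_int M}}" for m M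
      by (auto simp: bset_def)
    ultimately show ?thesis by (simp only:)
  next
    case False
    then have b: "b = d" using assms by blast
    have "closed_segment (pt a b) (pt c d) = {z. Im z = of_int b \<and> Re z \<in> {of_int (min a c)..of_int (max a c)}}"
      using closed_segment_same_Im[of "pt a b" "pt c d"] b by (simp add: cl del: of_int_min of_int_max)
    moreover have "min b d = b" "max b d = b" using b by simp_all
    moreover have "bset (m, M, b, b) = {z. Im z = of_int b \<and> Re z \<in> {of_int m..of_int M}}" for m M
      by (auto simp: bset_def)
    ultimately show ?thesis by (simp only:)
  qed
qed

lemma simple_chain_arc:
  "simple_chain ps \<Longrightarrow> \<exists>g. arc g \<and> path_image g = chain ps \<and> pathstart g = pt (fst (hd ps)) (snd (hd ps))"
proof (induction ps rule: simple_chain.induct)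
  case (1 a b c d)
  then have ne: "pt a b \<noteq> pt c d" by (auto simp: complex_eq_iff)
  show ?case
  proof (intro exI conjI)
    show "arc (linepath (pt a b) (pt c d))" using ne by (rule arc_linepath)
    show "path_image (linepath (pt a b) (pt c d)) = chain [(a, b), (c, d)]"
      using 1 by (simp add: chain_def bset_segment)
  qed simp
next
  case (2 a b c d p ps)
  let ?q = "(c, d) # p # ps"
  have h: "(a = c) \<noteq> (b = d)" "simple_chain ?q"
    and cut: "\<And>x. x \<in> set (boxes ?q) \<Longrightarrow> let y = meet (min a c, max a c, min b d, max b d) x in is_empty y \<or> y = (c, c, d, d)"
    using 2(2) by auto
  obtain g where g: "arc g" "path_image g = chain ?q" "pathstart g = pt c d"
    using 2(1) h by auto
  have ne: "pt a b \<noteq> pt c d" using h by (auto simp: complex_eq_iff)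
  have bounded_fig: "closed_segment (pt a b) (pt c d) = bset (min a c, max a c, min b d, max b d)"
    using bset_segment h(1) by metis
  have "closed_segment (pt a b) (pt c d) \<inter> bset x \<subseteq> {pt c d}" if "x \<in> set (boxes ?q)" for x
    unfolding bounded_fig bset_meet using cut[OF that] by (auto simp: Let_def is_empty_iff bset_point)
  then have "closed_segment (pt a b) (pt c d) \<inter> chain ?q \<subseteq> {pt c d}" unfolding chain_def by blast
  then have "arc (linepath (pt a b) (pt c d) +++ g)"
    using ne g by (intro arc_join arc_linepath) auto
  moreover have "path_image (linepath (pt a b) (pt c d) +++ g) = chain ((a, b) # ?q)"
    using g bounded_fig by (simp add: path_image_join chain_def)
  ultimately show ?case by (intro exI[of _ "linepath (pt a b) (pt c d) +++ g"]) simp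
qed auto

lemma chain_Int_chain: "chain ps \<inter> chain qs = (\<Union>x\<in>set (meets ps qs). bset x)"
proof -
  have "chain ps \<inter> chain qs = (\<Union>x\<in>set (boxes ps). \<Union>y\<in>set (boxes qs). bset (meet x y))"
    unfolding chain_def bset_meet[symmetric] by blast
  also have "\<dots> = (\<Union>x\<in>{x. \<exists>y\<in>set (boxes ps). \<exists>z\<in>set (boxes qs). x = meet y z \<and> \<not> is_empty x}. bset x)"
    unfolding is_empty_iff by blast
  also have "{x. \<exists>y\<in>set (boxes ps). \<exists>z\<in>set (boxes qs). x = meet y z \<and> \<not> is_empty x} = set (meets ps qs)"
    unfolding meets_def set_remdups set_filter set_concat set_map image_image by blast
  finally show ?thesis .
qed

lemma fan_in_grounded_1_string_graphs:
  assumes e: "inj e"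
  shows "numbered_graph e 23 (ring_adj 8 fan_edges) \<in> grounded_1_string_graphs"
proof -
  let ?f = "\<lambda>i. chain (fan_strings ! i)"
  have len: "length fan_strings = 23" by (simp add: fan_strings_def)
  note real = fan_strings_realize[unfolded realizes_strings_def len]
  have sc: "simple_chain (fan_strings ! i)" "snd (hd (fan_strings ! i)) = 0" "\<forall>p\<in>set (tl (fan_strings ! i)). snd p > 0"
    if "i < 23" for i
    using real[THEN conjunct1] nth_mem[of i fan_strings] that len by auto
  have m: "list_all is_point (meets (fan_strings ! i) (fan_strings ! j))"
    "length (meets (fan_strings ! i) (fan_strings ! j)) = (if ring_adj 8 fan_edges i j then 1 else 0)" if "i < j" "j < 23" for i j
    using real[THEN conjunct2, THEN conjunct1] that by auto
  have far: "is_empty (meet x y)"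
    if "i < j" "j < 23" "x \<in> set (meets (fan_strings ! i) (fan_strings ! j))" "k < 23" "k \<noteq> i" "k \<noteq> j" "y \<in> set (boxes (fan_strings ! k))" for i j k x y
  proof -
    have "k = i \<or> k = j \<or> (\<forall>y\<in>set (boxes (fan_strings ! k)). is_empty (meet x y))"
      using real[THEN conjunct2, THEN conjunct2, THEN bspec, THEN bspec, THEN bspec, THEN bspec, of j i x k] that(1-4) by simp
    then show ?thesis using that(5-7) by blast
  qed
  have cross0: "if ring_adj 8 fan_edges i j then \<exists>p. ?f i \<inter> ?f j = {p} else ?f i \<inter> ?f j = {}" if ij: "i < j" "j < 23" for i j
  proof (cases "ring_adj 8 fan_edges i j")
    case True
    then obtain x where x: "meets (fan_strings ! i) (fan_strings ! j) = [x]"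
      using m(2)[OF ij] by (auto simp: length_Suc_conv)
    then have "is_point x" using m(1)[OF ij] by simp
    then obtain a b where "x = (a, a, b, b)" by (cases x) auto
    then show ?thesis using True x by (simp add: chain_Int_chain bset_point)
  next
    case False
    then show ?thesis using m(2)[OF ij] by (simp add: chain_Int_chain)
  qed
  have cr: "if ring_adj 8 fan_edges i j then \<exists>p. ?f i \<inter> ?f j = {p} else ?f i \<inter> ?f j = {}" if "i < 23" "j < 23" "i \<noteq> j" for i j
  proof (cases "i < j")
    case False
    then have "j < i" using that by simp
    moreover have "?f i \<inter> ?f j = ?f j \<inter> ?f i" by blast
    ultimately show ?thesis using cross0[of j i] that ring_adj_sym[of 8 fan_edges i j] by simp
  qed (use cross0 that in blast)
  have no3: "?f i \<inter> ?f j \<inter> ?f k = {}" if "i < j" "j < 23" "k < 23" "k \<noteq> i" "k \<noteq> j" for i j k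
  proof -
    have "bset x \<inter> bset y = {}"
      if "x \<in> set (meets (fan_strings ! i) (fan_strings ! j))" "y \<in> set (boxes (fan_strings ! k))" for x y
      unfolding bset_meet using far[OF \<open>i < j\<close> \<open>j < 23\<close> that(1) \<open>k < 23\<close> \<open>k \<noteq> i\<close> \<open>k \<noteq> j\<close> that(2)] by (simp add: is_empty_iff)
    then show ?thesis unfolding chain_Int_chain chain_def[of "fan_strings ! k"] by blast
  qed
  have no3': "?f i \<inter> ?f j \<inter> ?f k = {}" if "i < 23" "j < 23" "k < 23" "i \<noteq> j" "k \<noteq> i" "k \<noteq> j" for i j k
    using no3[of i j k] no3[of j i k] that by (cases "i < j") auto
  have arc: "\<exists>g. arc g \<and> path_image g = ?f i \<and> pathstart g = pt (fst (hd (fan_strings ! i))) 0" if "i < 23" for i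
    using simple_chain_arc[OF sc(1)[OF that]] sc(2)[OF that] by simp
  \<comment> \<open>An arc has two distinct ends, so two chains that share at most one point cannot
    coincide.\<close>
  have two: "\<exists>p q. p \<in> ?f i \<and> q \<in> ?f i \<and> p \<noteq> q" if i: "i < 23" for i
  proof -
    obtain g where g: "arc g" "path_image g = ?f i" using arc[OF i] by blast
    have "pathstart g \<noteq> pathfinish g" using arc_distinct_ends[OF g(1)] by metis
    then show ?thesis using g(2) pathstart_in_path_image pathfinish_in_path_image by metis
  qed
  have ne: "?f i \<noteq> ?f j" if "i < 23" "j < 23" "i \<noteq> j" for i j
  proof
    assume "?f i = ?f j"
    then have "\<exists>p. ?f i \<subseteq> {p}" using cr[OF that] by (auto split: if_splits)
    then show False using two[OF that(1)] by blast
  qed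
  have "inj_on ?f {..<23}" by (rule inj_onI) (use ne in blast)
  moreover have "one_strings (?f ` {..<23})"
    unfolding one_strings_def
  proof (intro conjI ballI impI)
    fix A assume "A \<in> ?f ` {..<23}"
    then obtain i where i: "i < 23" "A = ?f i" by blast
    show "\<exists>g. arc g \<and> A = path_image g" using arc[OF i(1)] unfolding i(2) by metis
    fix B assume "B \<in> ?f ` {..<23}"
    then obtain j where j: "j < 23" "B = ?f j" by blast
    show "\<exists>p. A \<inter> B \<subseteq> {p}" if "A \<noteq> B"
    proof -
      have "i \<noteq> j" using that i j by blast
      then show ?thesis using cr[OF i(1) j(1)] unfolding i(2) j(2) by (auto split: if_splits)
    qed
    fix C assume "C \<in> ?f ` {..<23}"
    then obtain k where k: "k < 23" "C = ?f k" by blast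
    show "A \<inter> B \<inter> C = {}" if "A \<noteq> B \<and> A \<noteq> C \<and> B \<noteq> C"
    proof -
      have "i \<noteq> j" "k \<noteq> i" "k \<noteq> j" using that i j k by blast+
      then show ?thesis using no3'[OF i(1) j(1) k(1)] unfolding i(2) j(2) k(2) by blast
    qed
  qed
  moreover have "grounded_string 0 0 (?f i)" if i: "i < 23" for i
  proof -
    obtain g where g: "arc g" "path_image g = ?f i" "pathstart g = pt (fst (hd (fan_strings ! i))) 0"
      using arc[OF i] by blast
    obtain a b c d ps where ps: "fan_strings ! i = (a, b) # (c, d) # ps"
      using sc(1)[OF i] by (cases "fan_strings ! i" rule: simple_chain.cases) auto
    have b: "b = 0" "d > 0" "\<forall>p\<in>set ps. snd p > 0" using sc[OF i] ps by auto
    \<comment> \<open>The first edge starts at height \<open>0\<close> and ends above it, so it is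
      vertical and touches the axis only in the base.\<close>
    have ac: "a = c" using sc(1)[OF i] b unfolding ps by (cases ps) auto
    have high: "Im z > 0" if "\<forall>p\<in>set qs. snd p > 0" "z \<in> chain qs" for z qs
      using that
    proof (induction qs rule: boxes.induct)
      case (1 a b c d ps)
      have "(0::real) < of_int b" "(0::real) < of_int d" using 1(2) by auto
      then show ?case using 1 by (auto simp: chain_def bset_def min_def split: if_splits)
    qed (auto simp: chain_def)
    have "?f i - {pathstart g} \<subseteq> above_line 0 0"
    proof
      fix z assume z: "z \<in> ?f i - {pathstart g}"
      have "?f i = bset (min a c, max a c, min b d, max b d) \<union> chain ((c, d) # ps)"
        unfolding ps by (simp add: chain_def)
      then consider "z \<in> bset (min a c, max a c, min b d, max b d)" | "z \<in> chain ((c, d) # ps)" using z by blast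
      then have "Im z > 0"
      proof cases
        case 1
        then have "Re z = of_int a" "Im z \<ge> 0" using ac b by (auto simp: bset_def)
        moreover have "z \<noteq> pt a 0" using z g(3) ps by simp
        ultimately show ?thesis by (auto simp: complex_eq_iff)
      next
        case 2
        show ?thesis by (rule high[OF _ 2]) (use b in auto)
      qed
      then show "z \<in> above_line 0 0" by (simp add: above_line_def)
    qed
    then show ?thesis
      unfolding grounded_string_def using g by (intro exI[of _ g]) (simp add: ground_line_def)
  qed
  moreover have "ring_adj 8 fan_edges i j \<longleftrightarrow> ?f i \<inter> ?f j \<noteq> {}" if "i < 23" "j < 23" "i \<noteq> j" for i j
    using cr[OF that] by (auto split: if_splits)
  ultimately show ?thesis
    unfolding grounded_1_string_graphs_def numbered_graph_in_class_iff[OF e ring_adj_sym]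
    by (intro exI[of _ ?f]) blast
qed

subsection \<open>The hierarchy\<close>

lemma obtain_inj_nat: "\<exists>e :: nat \<Rightarrow> 'v :: infinite. inj e"
  using infinite_countable_subset[OF infinite_UNIV] by blast

lemma net_not_in_downward_ray_graphs:
  assumes "inj e"
  shows "numbered_graph e 18 (ring_adj 6 net_edges) \<notin> downward_ray_graphs"
proof
  assume "numbered_graph e 18 (ring_adj 6 net_edges) \<in> downward_ray_graphs"
  then obtain f where "\<forall>A\<in>f ` {..<18}. is_downward_ray A"
    and "\<forall>i<18. \<forall>j<18. i \<noteq> j \<longrightarrow> (ring_adj 6 net_edges i j \<longleftrightarrow> f i \<inter> f j \<noteq> {})"
    unfolding downward_ray_graphs_def numbered_graph_in_class_iff[OF assms ring_adj_sym] by blast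
  then show False by (intro downward_rays_not_net[of f]) auto
qed

lemma two_paths_not_in_ray_graphs:
  assumes "inj e"
  shows "numbered_graph e 24 (ring_adj 8 two_paths_edges) \<notin> ray_graphs"
proof
  assume "numbered_graph e 24 (ring_adj 8 two_paths_edges) \<in> ray_graphs"
  then obtain f where "\<forall>A\<in>f ` {..<24}. is_ray A"
    and "\<forall>i<24. \<forall>j<24. i \<noteq> j \<longrightarrow> (ring_adj 8 two_paths_edges i j \<longleftrightarrow> f i \<inter> f j \<noteq> {})"
    unfolding ray_graphs_def numbered_graph_in_class_iff[OF assms ring_adj_sym] by blast
  then show False by (intro rays_not_two_paths[of f]) auto
qed

lemma fan_not_in_outer_segment_graphs:
  assumes "inj e"
  shows "numbered_graph e 23 (ring_adj 8 fan_edges) \<notin> outer_segment_graphs"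
proof
  assume "numbered_graph e 23 (ring_adj 8 fan_edges) \<in> outer_segment_graphs"
  then obtain f x r where "r > 0" "\<forall>A\<in>f ` {..<23}. outer_segment x r A"
    and "\<forall>i<23. \<forall>j<23. i \<noteq> j \<longrightarrow> (ring_adj 8 fan_edges i j \<longleftrightarrow> f i \<inter> f j \<noteq> {})"
    unfolding outer_segment_graphs_def numbered_graph_in_class_iff[OF assms ring_adj_sym]
    by (elim exE conjE) (rule that)
  then show False by (intro outer_segments_not_fan[of x r f]) auto
qed

theorem theorem1:
  shows "(grounded_segment_graphs :: 'v::infinite pair_pre_digraph set) = downward_ray_graphs
    \<and> (downward_ray_graphs :: 'v pair_pre_digraph set) \<subset> ray_graphs
    \<and> (ray_graphs :: 'v pair_pre_digraph set) \<subset> outer_segment_graphs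
    \<and> (outer_segment_graphs :: 'v pair_pre_digraph set) \<subset> outer_1_string_graphs
    \<and> (outer_1_string_graphs :: 'v pair_pre_digraph set) = grounded_1_string_graphs"
proof (intro conjI)
  obtain e :: "nat \<Rightarrow> 'v" where e: "inj e" using obtain_inj_nat by blast
  show "(grounded_segment_graphs :: 'v pair_pre_digraph set) = downward_ray_graphs"
    using grounded_segment_graphs_subset_downward_ray_graphs downward_ray_graphs_subset_grounded_segment_graphs
    by (rule equalityI)
  show "(downward_ray_graphs :: 'v pair_pre_digraph set) \<subset> ray_graphs"
    using downward_ray_graphs_subset_ray_graphs net_in_ray_graphs[OF e] net_not_in_downward_ray_graphs[OF e] by blast
  show "(ray_graphs :: 'v pair_pre_digraph set) \<subset> outer_segment_graphs"
    using ray_graphs_subset_outer_segment_graphs two_paths_in_outer_segment_graphs[OF e] two_paths_not_in_ray_graphs[OF e]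
    by blast
  \<comment> \<open>Proved before the strictness of the preceding inclusion, because the fan is
    drawn with grounded strings.\<close>
  show eq: "(outer_1_string_graphs :: 'v pair_pre_digraph set) = grounded_1_string_graphs"
    using outer_1_string_graphs_subset_grounded_1_string_graphs grounded_1_string_graphs_subset_outer_1_string_graphs
    by (rule equalityI)
  show "(outer_segment_graphs :: 'v pair_pre_digraph set) \<subset> outer_1_string_graphs"
    using outer_segment_graphs_subset_outer_1_string_graphs fan_in_grounded_1_string_graphs[OF e]
      fan_not_in_outer_segment_graphs[OF e] eq by blast
qed

end
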